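(* Let $0<q<1$ and let $l$ be a positive integer. The coaction $\varrho_{1,l}$ of $\mathcal{O}(U(1))$ on $\mathcal{O}(\Sigma_q^3)$ is almost free.
   Context: All algebras are unital associative $*$-algebras over $\mathbb{C}$. $\mathcal{O}(U(1))=\mathbb{C}[u,u^*]$ is the Hopf $*$-algebra of Laurent polynomials in a unitary grouplike variable $u$. $\mathcal{O}(\Sigma_q^3)$ is the $*$-algebra generated by $\zeta_0,\zeta_1$ and a central unitary $\xi$ subject to $\zeta_0\zeta_1=q\zeta_1\zeta_0$, $\zeta_0\zeta_1^*=q\zeta_1^*\zeta_0$, $\zeta_0\zeta_0^*=\zeta_0^*\zeta_0+(q^{-2}-1)\zeta_1^2\xi$, $\zeta_0\zeta_0^*+\zeta_1^2\xi=1$, $\zeta_1^*=\zeta_1\xi$. $\varrho_{1,l}:\mathcal{O}(\Sigma_q^3)\to\mathcal{O}(\Sigma_q^3)\otimes\mathcal{O}(U(1))$ is the $*$-algebra map $\zeta_0\mapsto\zeta_0\otimes u$, $\zeta_1\mapsto\zeta_1\otimes u^l$, $\xi\mapsto\xi\otimes u^{-2l}$. For a Hopf algebra $H$ and a right $H$-comodule algebra $A$ with coaction $\varrho^A:A\to A\otimes H$, the coaction is almost free if the cokernel of the lifted canonical map $A\otimes A\to A\otimes H$, $a\otimes a'\mapsto a\varrho^A(a')$ (tensor products over $\mathbb{C}$), is finitely generated as a left $A$-module. *)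

theory Defs
  imports "HOL-Algebra.QuotRing" "HOL-Algebra.Module" "HOL-Algebra.Elementary_Groups"
    "HOL-Library.Poly_Mapping" Complex_Main
begin

section \<open>Definitions\<close>

record 'a star_algebra = "(complex, 'a) module" +
  star :: "'a \<Rightarrow> 'a"  (\<open>_\<^sup>\<star>\<index>\<close> [1000] 999)

definition complex_alg :: "complex star_algebra" where
  "complex_alg = \<lparr>carrier = UNIV, monoid.mult = (*), one = 1, zero = 0, add = (+),
     smult = (*), star = cnj\<rparr>"

locale star_algebra = Module.module complex_alg A + ring A for A (structure) +
  assumes smult_mult_left:
      "\<lbrakk>x \<in> carrier A; y \<in> carrier A\<rbrakk> \<Longrightarrow> (c \<odot> x) \<otimes> y = c \<odot> (x \<otimes> y)"
    and smult_mult_right: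
      "\<lbrakk>x \<in> carrier A; y \<in> carrier A\<rbrakk> \<Longrightarrow> x \<otimes> (c \<odot> y) = c \<odot> (x \<otimes> y)"
    and star_closed [simp, intro]: "x \<in> carrier A \<Longrightarrow> x\<^sup>\<star> \<in> carrier A"
    and star_add: "\<lbrakk>x \<in> carrier A; y \<in> carrier A\<rbrakk> \<Longrightarrow> (x \<oplus> y)\<^sup>\<star> = x\<^sup>\<star> \<oplus> y\<^sup>\<star>"
    and star_smult: "x \<in> carrier A \<Longrightarrow> (c \<odot> x)\<^sup>\<star> = cnj c \<odot> x\<^sup>\<star>"
    and star_mult: "\<lbrakk>x \<in> carrier A; y \<in> carrier A\<rbrakk> \<Longrightarrow> (x \<otimes> y)\<^sup>\<star> = y\<^sup>\<star> \<otimes> x\<^sup>\<star>"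
    and star_star [simp]: "x \<in> carrier A \<Longrightarrow> (x\<^sup>\<star>)\<^sup>\<star> = x"

definition linear_hom :: "('a, 'x) star_algebra_scheme \<Rightarrow> ('b, 'y) star_algebra_scheme \<Rightarrow> ('a \<Rightarrow> 'b) set" where
  "linear_hom A B = {f \<in> carrier A \<rightarrow> carrier B.
     (\<forall>x\<in>carrier A. \<forall>y\<in>carrier A. f (x \<oplus>\<^bsub>A\<^esub> y) = f x \<oplus>\<^bsub>B\<^esub> f y) \<and>
     (\<forall>c. \<forall>x\<in>carrier A. f (c \<odot>\<^bsub>A\<^esub> x) = c \<odot>\<^bsub>B\<^esub> f x)}"

definition star_hom :: "('a, 'x) star_algebra_scheme \<Rightarrow> ('b, 'y) star_algebra_scheme \<Rightarrow> ('a \<Rightarrow> 'b) set" where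
  "star_hom A B = {f \<in> linear_hom A B \<inter> ring_hom A B. \<forall>x\<in>carrier A. f (x\<^sup>\<star>\<^bsub>A\<^esub>) = (f x)\<^sup>\<star>\<^bsub>B\<^esub>}"

definition linear_ext :: "('b, 'x) star_algebra_scheme \<Rightarrow> ('m \<Rightarrow> 'b) \<Rightarrow> ('m \<Rightarrow>\<^sub>0 complex) \<Rightarrow> 'b" where
  "linear_ext B g f = (\<Oplus>\<^bsub>B\<^esub>m \<in> Poly_Mapping.keys f. Poly_Mapping.lookup f m \<odot>\<^bsub>B\<^esub> g m)"

definition monoid_star_algebra :: "('m, 'x) monoid_scheme \<Rightarrow> ('m \<Rightarrow> 'm) \<Rightarrow> ('m \<Rightarrow>\<^sub>0 complex) star_algebra" where
  "monoid_star_algebra M s = \<lparr>carrier = {f. Poly_Mapping.keys f \<subseteq> carrier M},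
     monoid.mult = (\<lambda>f g. \<Sum>u\<in>Poly_Mapping.keys f. \<Sum>v\<in>Poly_Mapping.keys g.
        Poly_Mapping.single (u \<otimes>\<^bsub>M\<^esub> v) (Poly_Mapping.lookup f u * Poly_Mapping.lookup g v)),
     one = Poly_Mapping.single \<one>\<^bsub>M\<^esub> 1, zero = 0, add = (+),
     smult = (\<lambda>c. Poly_Mapping.map ((*) c)),
     star = (\<lambda>f. \<Sum>u\<in>Poly_Mapping.keys f. Poly_Mapping.single (s u) (cnj (Poly_Mapping.lookup f u)))\<rparr>"

text \<open>The scalar multiplication and the star of a coset are formed elementwise, like the product
  of cosets in \<open>FactRing\<close>.\<close>

definition quotient_star_algebra :: "('a, 'x) star_algebra_scheme \<Rightarrow> 'a set \<Rightarrow> 'a set star_algebra" where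
  "quotient_star_algebra A I = \<lparr>carrier = carrier (A Quot I), monoid.mult = monoid.mult (A Quot I),
     one = one (A Quot I), zero = zero (A Quot I), add = add (A Quot I),
     smult = (\<lambda>c X. \<Union>x\<in>X. I +>\<^bsub>A\<^esub> (c \<odot>\<^bsub>A\<^esub> x)), star = (\<lambda>X. \<Union>x\<in>X. I +>\<^bsub>A\<^esub> x\<^sup>\<star>\<^bsub>A\<^esub>)\<rparr>"

text \<open>Words are lists of letters: \<open>(g, False)\<close> is the generator \<open>g\<close> and \<open>(g, True)\<close> its adjoint.\<close>

definition free_star_algebra :: "(('g \<times> bool) list \<Rightarrow>\<^sub>0 complex) star_algebra" where
  "free_star_algebra = monoid_star_algebra \<lparr>carrier = UNIV, monoid.mult = (@), one = []\<rparr>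
     (\<lambda>w. rev (map (apsnd Not) w))"

definition free_gen :: "'g \<Rightarrow> (('g \<times> bool) list \<Rightarrow>\<^sub>0 complex)" where
  "free_gen g = Poly_Mapping.single [(g, False)] 1"

text \<open>A pair \<open>(x, y) \<in> R\<close> stands for the relation \<open>x = y\<close>. The ideal is closed under the star, so
  that the adjoint of every relation holds as well.\<close>

definition relation_ideal ::
  "((('g \<times> bool) list \<Rightarrow>\<^sub>0 complex) \<times> (('g \<times> bool) list \<Rightarrow>\<^sub>0 complex)) set \<Rightarrow> (('g \<times> bool) list \<Rightarrow>\<^sub>0 complex) set" where
  "relation_ideal R = (let D = {x \<ominus>\<^bsub>free_star_algebra\<^esub> y | x y. (x, y) \<in> R}
     in Idl\<^bsub>free_star_algebra\<^esub> (D \<union> star free_star_algebra ` D))"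

definition presented_star_algebra where
  "presented_star_algebra R = quotient_star_algebra free_star_algebra (relation_ideal R)"

definition presented_gen where
  "presented_gen R g = relation_ideal R +>\<^bsub>free_star_algebra\<^esub> free_gen g"

definition word_value :: "('b, 'x) star_algebra_scheme \<Rightarrow> ('g \<Rightarrow> 'b) \<Rightarrow> ('g \<times> bool) list \<Rightarrow> 'b" where
  "word_value B h w = foldr (\<lambda>(g, b) y. (if b then (h g)\<^sup>\<star>\<^bsub>B\<^esub> else h g) \<otimes>\<^bsub>B\<^esub> y) w \<one>\<^bsub>B\<^esub>"

text \<open>If the elements \<open>h g\<close> of \<open>B\<close> satisfy the relations, then \<open>linear_ext B (word_value B h)\<close> is
  constant on cosets, and \<open>presented_lift B h\<close> is the star homomorphism with \<open>g \<mapsto> h g\<close>.\<close>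

definition presented_lift ::
  "('b, 'x) star_algebra_scheme \<Rightarrow> ('g \<Rightarrow> 'b) \<Rightarrow> (('g \<times> bool) list \<Rightarrow>\<^sub>0 complex) set \<Rightarrow> 'b" where
  "presented_lift B h X = the_elem (linear_ext B (word_value B h) ` X)"

lemma lookup_scale [simp]:
  "Poly_Mapping.lookup (Poly_Mapping.map ((*) (c::complex)) f) k = c * Poly_Mapping.lookup f k"
  by (simp add: Poly_Mapping.map.rep_eq when_def)

interpretation pm: vector_space "\<lambda>c :: complex. Poly_Mapping.map ((*) c)"
  by unfold_locales (auto intro!: poly_mapping_eqI simp: lookup_add algebra_simps)

type_synonym ('a, 'b) tensor = "('a \<times> 'b \<Rightarrow>\<^sub>0 complex) set"

definition pair_star_algebra :: "'a star_algebra \<Rightarrow> 'b star_algebra \<Rightarrow> ('a \<times> 'b \<Rightarrow>\<^sub>0 complex) star_algebra" where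
  "pair_star_algebra A B = monoid_star_algebra (A \<times>\<times> B) (\<lambda>(x, y). (x\<^sup>\<star>\<^bsub>A\<^esub>, y\<^sup>\<star>\<^bsub>B\<^esub>))"

definition bilinear_relators :: "'a star_algebra \<Rightarrow> 'b star_algebra \<Rightarrow> ('a \<times> 'b \<Rightarrow>\<^sub>0 complex) set" where
  "bilinear_relators A B =
     {Poly_Mapping.single (x \<oplus>\<^bsub>A\<^esub> x', y) 1 - (Poly_Mapping.single (x, y) 1 + Poly_Mapping.single (x', y) 1) | x x' y.
        x \<in> carrier A \<and> x' \<in> carrier A \<and> y \<in> carrier B} \<union>
     {Poly_Mapping.single (x, y \<oplus>\<^bsub>B\<^esub> y') 1 - (Poly_Mapping.single (x, y) 1 + Poly_Mapping.single (x, y') 1) | x y y'.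
        x \<in> carrier A \<and> y \<in> carrier B \<and> y' \<in> carrier B} \<union>
     {Poly_Mapping.single (c \<odot>\<^bsub>A\<^esub> x, y) 1 - Poly_Mapping.single (x, y) c | c x y.
        x \<in> carrier A \<and> y \<in> carrier B} \<union>
     {Poly_Mapping.single (x, c \<odot>\<^bsub>B\<^esub> y) 1 - Poly_Mapping.single (x, y) c | c x y.
        x \<in> carrier A \<and> y \<in> carrier B}"

text \<open>This span is a two-sided ideal of \<open>pair_star_algebra A B\<close>, closed under the star. Hence
  the tensor product of vector spaces inherits the operations \<open>(x \<otimes> y) (x' \<otimes> y') = x x' \<otimes> y y'\<close>
  and \<open>(x \<otimes> y)\<^sup>\<star> = x\<^sup>\<star> \<otimes> y\<^sup>\<star>\<close>.\<close>

definition tensor_null :: "'a star_algebra \<Rightarrow> 'b star_algebra \<Rightarrow> ('a \<times> 'b \<Rightarrow>\<^sub>0 complex) set" where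
  "tensor_null A B = pm.span (bilinear_relators A B)"

definition tensor :: "'a star_algebra \<Rightarrow> 'b star_algebra \<Rightarrow> ('a, 'b) tensor star_algebra" where
  "tensor A B = quotient_star_algebra (pair_star_algebra A B) (tensor_null A B)"

definition pure_tensor :: "'a star_algebra \<Rightarrow> 'b star_algebra \<Rightarrow> 'a \<Rightarrow> 'b \<Rightarrow> ('a, 'b) tensor" where
  "pure_tensor A B x y = tensor_null A B +>\<^bsub>pair_star_algebra A B\<^esub> Poly_Mapping.single (x, y) 1"

text \<open>The linear map on the tensor product induced by a bilinear map \<open>g\<close> with values in \<open>C\<close>.\<close>

definition tensor_lift :: "'c star_algebra \<Rightarrow> ('a \<Rightarrow> 'b \<Rightarrow> 'c) \<Rightarrow> ('a, 'b) tensor \<Rightarrow> 'c" where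
  "tensor_lift C g X = the_elem (linear_ext C (\<lambda>(x, y). g x y) ` X)"

definition tensor_map :: "'c star_algebra \<Rightarrow> 'd star_algebra \<Rightarrow> ('a \<Rightarrow> 'c) \<Rightarrow> ('b \<Rightarrow> 'd) \<Rightarrow>
    ('a, 'b) tensor \<Rightarrow> ('c, 'd) tensor" where
  "tensor_map C D f g = tensor_lift (tensor C D) (\<lambda>x y. pure_tensor C D (f x) (g y))"

definition tensor_assoc :: "'a star_algebra \<Rightarrow> 'b star_algebra \<Rightarrow> 'c star_algebra \<Rightarrow>
    (('a, 'b) tensor, 'c) tensor \<Rightarrow> ('a, ('b, 'c) tensor) tensor" where
  "tensor_assoc A B C = tensor_lift (tensor A (tensor B C))
     (\<lambda>t z. tensor_lift (tensor A (tensor B C)) (\<lambda>x y. pure_tensor A (tensor B C) x (pure_tensor B C y z)) t)"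

locale hopf_star_algebra = star_algebra H
  for H :: "'h star_algebra" and \<Delta> :: "'h \<Rightarrow> ('h, 'h) tensor" and \<epsilon> :: "'h \<Rightarrow> complex" and S :: "'h \<Rightarrow> 'h" +
  assumes comult: "\<Delta> \<in> star_hom H (tensor H H)"
    and counit: "\<epsilon> \<in> star_hom H complex_alg"
    and antipode: "S \<in> linear_hom H H"
    and coassoc: "h \<in> carrier H \<Longrightarrow>
        tensor_assoc H H H (tensor_map (tensor H H) H \<Delta> (\<lambda>x. x) (\<Delta> h))
          = tensor_map H (tensor H H) (\<lambda>x. x) \<Delta> (\<Delta> h)"
    and counit_left: "h \<in> carrier H \<Longrightarrow> tensor_lift H (\<lambda>x y. \<epsilon> x \<odot>\<^bsub>H\<^esub> y) (\<Delta> h) = h"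
    and counit_right: "h \<in> carrier H \<Longrightarrow> tensor_lift H (\<lambda>x y. \<epsilon> y \<odot>\<^bsub>H\<^esub> x) (\<Delta> h) = h"
    and antipode_left: "h \<in> carrier H \<Longrightarrow> tensor_lift H (\<lambda>x y. S x \<otimes>\<^bsub>H\<^esub> y) (\<Delta> h) = \<epsilon> h \<odot>\<^bsub>H\<^esub> \<one>\<^bsub>H\<^esub>"
    and antipode_right: "h \<in> carrier H \<Longrightarrow> tensor_lift H (\<lambda>x y. x \<otimes>\<^bsub>H\<^esub> S y) (\<Delta> h) = \<epsilon> h \<odot>\<^bsub>H\<^esub> \<one>\<^bsub>H\<^esub>"

locale right_comodule_algebra = H: hopf_star_algebra H \<Delta> \<epsilon> S + A: star_algebra A
  for A :: "'a star_algebra" and H :: "'h star_algebra" and \<Delta> \<epsilon> S and \<rho> :: "'a \<Rightarrow> ('a, 'h) tensor" +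
  assumes coaction: "\<rho> \<in> star_hom A (tensor A H)"
    and coaction_coassoc: "a \<in> carrier A \<Longrightarrow>
        tensor_assoc A H H (tensor_map (tensor A H) H \<rho> (\<lambda>x. x) (\<rho> a))
          = tensor_map A (tensor H H) (\<lambda>x. x) \<Delta> (\<rho> a)"
    and coaction_counit: "a \<in> carrier A \<Longrightarrow> tensor_lift A (\<lambda>x h. \<epsilon> h \<odot>\<^bsub>A\<^esub> x) (\<rho> a) = a"

locale left_module = R: ring R + M: abelian_group M
  for R :: "('r, 'x) ring_scheme" and M :: "('r, 'm, 'y) module_scheme" +
  assumes lsmult_closed: "\<lbrakk>a \<in> carrier R; x \<in> carrier M\<rbrakk> \<Longrightarrow> a \<odot>\<^bsub>M\<^esub> x \<in> carrier M"
    and lsmult_add_left: "\<lbrakk>a \<in> carrier R; b \<in> carrier R; x \<in> carrier M\<rbrakk> \<Longrightarrow> (a \<oplus>\<^bsub>R\<^esub> b) \<odot>\<^bsub>M\<^esub> x = a \<odot>\<^bsub>M\<^esub> x \<oplus>\<^bsub>M\<^esub> b \<odot>\<^bsub>M\<^esub> x"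
    and lsmult_add_right: "\<lbrakk>a \<in> carrier R; x \<in> carrier M; y \<in> carrier M\<rbrakk> \<Longrightarrow> a \<odot>\<^bsub>M\<^esub> (x \<oplus>\<^bsub>M\<^esub> y) = a \<odot>\<^bsub>M\<^esub> x \<oplus>\<^bsub>M\<^esub> a \<odot>\<^bsub>M\<^esub> y"
    and lsmult_assoc: "\<lbrakk>a \<in> carrier R; b \<in> carrier R; x \<in> carrier M\<rbrakk> \<Longrightarrow> (a \<otimes>\<^bsub>R\<^esub> b) \<odot>\<^bsub>M\<^esub> x = a \<odot>\<^bsub>M\<^esub> (b \<odot>\<^bsub>M\<^esub> x)"
    and lsmult_one: "x \<in> carrier M \<Longrightarrow> \<one>\<^bsub>R\<^esub> \<odot>\<^bsub>M\<^esub> x = x"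

definition finitely_generated_left_module :: "('r, 'x) ring_scheme \<Rightarrow> ('r, 'm, 'y) module_scheme \<Rightarrow> bool" where
  "finitely_generated_left_module R M \<longleftrightarrow> left_module R M \<and>
     (\<exists>G. finite G \<and> G \<subseteq> carrier M \<and>
       (\<forall>m\<in>carrier M. \<exists>c\<in>G \<rightarrow> carrier R. m = (\<Oplus>\<^bsub>M\<^esub>g\<in>G. c g \<odot>\<^bsub>M\<^esub> g)))"

definition left_action :: "'a star_algebra \<Rightarrow> 'h star_algebra \<Rightarrow> 'a \<Rightarrow> ('a, 'h) tensor \<Rightarrow> ('a, 'h) tensor" where
  "left_action A H a t = pure_tensor A H a \<one>\<^bsub>H\<^esub> \<otimes>\<^bsub>tensor A H\<^esub> t"

definition lifted_canonical_map :: "'a star_algebra \<Rightarrow> 'h star_algebra \<Rightarrow> ('a \<Rightarrow> ('a, 'h) tensor) \<Rightarrow>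
    ('a, 'a) tensor \<Rightarrow> ('a, 'h) tensor" where
  "lifted_canonical_map A H \<rho> = tensor_lift (tensor A H) (\<lambda>a a'. left_action A H a (\<rho> a'))"

text \<open>The fields \<open>mult\<close> and \<open>one\<close> of the module record play no role for modules.\<close>

definition canonical_cokernel :: "'a star_algebra \<Rightarrow> 'h star_algebra \<Rightarrow> ('a \<Rightarrow> ('a, 'h) tensor) \<Rightarrow>
    ('a, ('a, 'h) tensor set) module" where
  "canonical_cokernel A H \<rho> =
    (let K = lifted_canonical_map A H \<rho> ` carrier (tensor A A)
     in \<lparr>carrier = a_rcosets\<^bsub>tensor A H\<^esub> K, monoid.mult = undefined, one = undefined,
         zero = K, add = set_add (tensor A H),
         smult = (\<lambda>a X. \<Union>t\<in>X. K +>\<^bsub>tensor A H\<^esub> left_action A H a t)\<rparr>)"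

definition almost_free :: "'a star_algebra \<Rightarrow> 'h star_algebra \<Rightarrow> ('a \<Rightarrow> ('a, 'h) tensor) \<Rightarrow> bool" where
  "almost_free A H \<rho> \<longleftrightarrow> finitely_generated_left_module A (canonical_cokernel A H \<rho>)"

text \<open>The basis element \<open>n\<close> of the group algebra of the integers is \<open>u\<^sup>n\<close>.\<close>

definition laurent :: "(int \<Rightarrow>\<^sub>0 complex) star_algebra" where
  "laurent = monoid_star_algebra integer_group uminus"

definition laurent_u :: "int \<Rightarrow> (int \<Rightarrow>\<^sub>0 complex)" where
  "laurent_u n = Poly_Mapping.single n 1"

definition laurent_comult :: "(int \<Rightarrow>\<^sub>0 complex) \<Rightarrow> (int \<Rightarrow>\<^sub>0 complex, int \<Rightarrow>\<^sub>0 complex) tensor" where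
  "laurent_comult = linear_ext (tensor laurent laurent) (\<lambda>n. pure_tensor laurent laurent (laurent_u n) (laurent_u n))"

definition laurent_counit :: "(int \<Rightarrow>\<^sub>0 complex) \<Rightarrow> complex" where
  "laurent_counit = linear_ext complex_alg (\<lambda>n. 1)"

definition laurent_antipode :: "(int \<Rightarrow>\<^sub>0 complex) \<Rightarrow> (int \<Rightarrow>\<^sub>0 complex)" where
  "laurent_antipode = linear_ext laurent (\<lambda>n. laurent_u (- n))"

datatype sigma_gen = Zeta0 | Zeta1 | Xi

definition sigma_relations ::
  "real \<Rightarrow> (((sigma_gen \<times> bool) list \<Rightarrow>\<^sub>0 complex) \<times> ((sigma_gen \<times> bool) list \<Rightarrow>\<^sub>0 complex)) set" where
  "sigma_relations q =
    (let F = free_star_algebra; z0 = free_gen Zeta0; z1 = free_gen Zeta1; xi = free_gen Xi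
     in {(z0 \<otimes>\<^bsub>F\<^esub> z1, complex_of_real q \<odot>\<^bsub>F\<^esub> (z1 \<otimes>\<^bsub>F\<^esub> z0)),
         (z0 \<otimes>\<^bsub>F\<^esub> z1\<^sup>\<star>\<^bsub>F\<^esub>, complex_of_real q \<odot>\<^bsub>F\<^esub> (z1\<^sup>\<star>\<^bsub>F\<^esub> \<otimes>\<^bsub>F\<^esub> z0)),
         (z0 \<otimes>\<^bsub>F\<^esub> z0\<^sup>\<star>\<^bsub>F\<^esub>, z0\<^sup>\<star>\<^bsub>F\<^esub> \<otimes>\<^bsub>F\<^esub> z0 \<oplus>\<^bsub>F\<^esub> complex_of_real (1 / q\<^sup>2 - 1) \<odot>\<^bsub>F\<^esub> (z1 [^]\<^bsub>F\<^esub> (2::nat) \<otimes>\<^bsub>F\<^esub> xi)),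
         (z0 \<otimes>\<^bsub>F\<^esub> z0\<^sup>\<star>\<^bsub>F\<^esub> \<oplus>\<^bsub>F\<^esub> z1 [^]\<^bsub>F\<^esub> (2::nat) \<otimes>\<^bsub>F\<^esub> xi, \<one>\<^bsub>F\<^esub>),
         (z1\<^sup>\<star>\<^bsub>F\<^esub>, z1 \<otimes>\<^bsub>F\<^esub> xi),
         (xi \<otimes>\<^bsub>F\<^esub> xi\<^sup>\<star>\<^bsub>F\<^esub>, \<one>\<^bsub>F\<^esub>),
         (xi\<^sup>\<star>\<^bsub>F\<^esub> \<otimes>\<^bsub>F\<^esub> xi, \<one>\<^bsub>F\<^esub>)} \<union>
        {(xi \<otimes>\<^bsub>F\<^esub> x, x \<otimes>\<^bsub>F\<^esub> xi) | x. x \<in> carrier F})"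

definition sigma_algebra :: "real \<Rightarrow> ((sigma_gen \<times> bool) list \<Rightarrow>\<^sub>0 complex) set star_algebra" where
  "sigma_algebra q = presented_star_algebra (sigma_relations q)"

definition sigma_generator :: "real \<Rightarrow> sigma_gen \<Rightarrow> ((sigma_gen \<times> bool) list \<Rightarrow>\<^sub>0 complex) set" where
  "sigma_generator q = presented_gen (sigma_relations q)"

fun gen_weight :: "nat \<Rightarrow> sigma_gen \<Rightarrow> int" where
  "gen_weight l Zeta0 = 1"
| "gen_weight l Zeta1 = int l"
| "gen_weight l Xi = - 2 * int l"

text \<open>By \<open>sigma_coaction_star_hom\<close>, \<open>sigma_coaction_gen\<close> and \<open>sigma_coaction_unique\<close> below, this is
  the unique star homomorphism with the given values on the generators, and by
  \<open>right_comodule_algebra_sigma\<close> it is a coaction of the Hopf star algebra \<open>laurent\<close>.\<close>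

definition sigma_coaction :: "real \<Rightarrow> nat \<Rightarrow> ((sigma_gen \<times> bool) list \<Rightarrow>\<^sub>0 complex) set \<Rightarrow>
    (((sigma_gen \<times> bool) list \<Rightarrow>\<^sub>0 complex) set, int \<Rightarrow>\<^sub>0 complex) tensor" where
  "sigma_coaction q l = presented_lift (tensor (sigma_algebra q) laurent)
     (\<lambda>g. pure_tensor (sigma_algebra q) laurent (sigma_generator q g) (laurent_u (gen_weight l g)))"

section \<open>Well-definedness and basic properties\<close>

lemma complex_alg_sel [simp]:
  "carrier complex_alg = UNIV" "x \<otimes>\<^bsub>complex_alg\<^esub> y = x * y" "\<one>\<^bsub>complex_alg\<^esub> = 1"
  "\<zero>\<^bsub>complex_alg\<^esub> = 0" "x \<oplus>\<^bsub>complex_alg\<^esub> y = x + y" "c \<odot>\<^bsub>complex_alg\<^esub> x = c * x"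
  "x\<^sup>\<star>\<^bsub>complex_alg\<^esub> = cnj x"
  by (simp_all add: complex_alg_def)

lemma cring_complex_alg: "cring complex_alg"
  by (intro cringI abelian_groupI comm_monoidI)
     (auto simp: algebra_simps intro: exI[of _ "- x" for x])

lemma a_minus_complex_alg [simp]: "\<ominus>\<^bsub>complex_alg\<^esub> x = - x"
proof -
  interpret cring complex_alg by (rule cring_complex_alg)
  show ?thesis
    by (rule sum_zero_eq_neg[symmetric]) auto
qed

lemma star_algebraI:
  fixes A (structure)
  assumes "ring A"
    and "\<And>c x. x \<in> carrier A \<Longrightarrow> c \<odot> x \<in> carrier A"
    and "\<And>c d x. x \<in> carrier A \<Longrightarrow> (c + d) \<odot> x = c \<odot> x \<oplus> d \<odot> x"
    and "\<And>c x y. \<lbrakk>x \<in> carrier A; y \<in> carrier A\<rbrakk> \<Longrightarrow> c \<odot> (x \<oplus> y) = c \<odot> x \<oplus> c \<odot> y"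
    and "\<And>c d x. x \<in> carrier A \<Longrightarrow> (c * d) \<odot> x = c \<odot> (d \<odot> x)"
    and "\<And>x. x \<in> carrier A \<Longrightarrow> 1 \<odot> x = x"
    and "\<And>c x y. \<lbrakk>x \<in> carrier A; y \<in> carrier A\<rbrakk> \<Longrightarrow> (c \<odot> x) \<otimes> y = c \<odot> (x \<otimes> y)"
    and "\<And>c x y. \<lbrakk>x \<in> carrier A; y \<in> carrier A\<rbrakk> \<Longrightarrow> x \<otimes> (c \<odot> y) = c \<odot> (x \<otimes> y)"
    and "\<And>x. x \<in> carrier A \<Longrightarrow> x\<^sup>\<star> \<in> carrier A"
    and "\<And>x y. \<lbrakk>x \<in> carrier A; y \<in> carrier A\<rbrakk> \<Longrightarrow> (x \<oplus> y)\<^sup>\<star> = x\<^sup>\<star> \<oplus> y\<^sup>\<star>"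
    and "\<And>c x. x \<in> carrier A \<Longrightarrow> (c \<odot> x)\<^sup>\<star> = cnj c \<odot> x\<^sup>\<star>"
    and "\<And>x y. \<lbrakk>x \<in> carrier A; y \<in> carrier A\<rbrakk> \<Longrightarrow> (x \<otimes> y)\<^sup>\<star> = y\<^sup>\<star> \<otimes> x\<^sup>\<star>"
    and "\<And>x. x \<in> carrier A \<Longrightarrow> (x\<^sup>\<star>)\<^sup>\<star> = x"
  shows "star_algebra A"
proof -
  interpret ring A by fact
  have "Module.module complex_alg A"
    by (intro moduleI cring_complex_alg abelian_group_axioms) (auto simp: assms)
  then show ?thesis
    by (intro star_algebra.intro star_algebra_axioms.intro) (auto simp: assms)
qed

lemma star_algebra_complex_alg: "star_algebra complex_alg"
  by (rule star_algebraI) (auto simp: algebra_simps cring.axioms(1)[OF cring_complex_alg])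

context star_algebra
begin

lemma ring_ax: "ring A" by (rule local.ring_axioms)

lemma smult_cl [simp, intro]: "x \<in> carrier A \<Longrightarrow> c \<odot> x \<in> carrier A"
  using smult_closed by simp

lemma smult_add_l: "x \<in> carrier A \<Longrightarrow> (c + d) \<odot> x = c \<odot> x \<oplus> d \<odot> x"
  using smult_l_distr[of c d x] by simp

lemma smult_add_r: "\<lbrakk>x \<in> carrier A; y \<in> carrier A\<rbrakk> \<Longrightarrow> c \<odot> (x \<oplus> y) = c \<odot> x \<oplus> c \<odot> y"
  using smult_r_distr[of c x y] by simp

lemma smult_smult: "x \<in> carrier A \<Longrightarrow> c \<odot> (d \<odot> x) = (c * d) \<odot> x"
  using smult_assoc1[of c d x] by simp

lemma smult_1 [simp]: "x \<in> carrier A \<Longrightarrow> 1 \<odot> x = x"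
  using smult_one[of x] by simp

lemma smult_0 [simp]: "x \<in> carrier A \<Longrightarrow> 0 \<odot> x = \<zero>"
  using smult_l_null[of x] by simp

lemma smult_zero [simp]: "c \<odot> \<zero> = \<zero>"
  using smult_r_null[of c] by simp

lemma smult_uminus_l: "x \<in> carrier A \<Longrightarrow> (- c) \<odot> x = \<ominus> (c \<odot> x)"
  using smult_l_minus[of c x] by simp

lemma uminus_conv: "x \<in> carrier A \<Longrightarrow> \<ominus> x = (- 1) \<odot> x"
  using smult_uminus_l[of x 1] by simp

lemma star_zero [simp]: "\<zero>\<^sup>\<star> = \<zero>"
  using star_smult[of \<zero> 0] by simp

lemma star_one [simp]: "\<one>\<^sup>\<star> = \<one>"
proof -
  have "(\<one>\<^sup>\<star> \<otimes> \<one>)\<^sup>\<star> = \<one>\<^sup>\<star> \<otimes> \<one>"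
    by (subst star_mult) auto
  then show ?thesis by simp
qed

lemma star_uminus: "x \<in> carrier A \<Longrightarrow> (\<ominus> x)\<^sup>\<star> = \<ominus> x\<^sup>\<star>"
  by (simp add: uminus_conv star_smult)

lemma diff_eq_zero_iff: "\<lbrakk>x \<in> carrier A; y \<in> carrier A\<rbrakk> \<Longrightarrow> x \<ominus> y = \<zero> \<longleftrightarrow> x = y"
  by (metis a_minus_def add.inv_closed add.inv_comm minus_equality minus_minus r_neg)

lemma linear_ext_superset:
  assumes "finite K" "Poly_Mapping.keys f \<subseteq> K" "\<And>k. k \<in> K \<Longrightarrow> g k \<in> carrier A"
  shows "linear_ext A g f = (\<Oplus>m\<in>K. Poly_Mapping.lookup f m \<odot> g m)"
  unfolding linear_ext_def
  by (rule add.finprod_mono_neutral_cong_left) (use assms in \<open>auto simp: in_keys_iff\<close>)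

lemma linear_ext_closed [simp, intro]:
  "(\<And>k. k \<in> Poly_Mapping.keys f \<Longrightarrow> g k \<in> carrier A) \<Longrightarrow> linear_ext A g f \<in> carrier A"
  unfolding linear_ext_def by (auto intro!: finsum_closed)

lemma linear_ext_add:
  assumes "\<And>k. k \<in> Poly_Mapping.keys f \<Longrightarrow> g k \<in> carrier A" "\<And>k. k \<in> Poly_Mapping.keys f' \<Longrightarrow> g k \<in> carrier A"
  shows "linear_ext A g (f + f') = linear_ext A g f \<oplus> linear_ext A g f'"
proof -
  let ?K = "Poly_Mapping.keys f \<union> Poly_Mapping.keys f'"
  have g: "g k \<in> carrier A" if "k \<in> ?K" for k using that assms by auto
  have "linear_ext A g (f + f') = (\<Oplus>m\<in>?K. Poly_Mapping.lookup (f + f') m \<odot> g m)"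
    using Poly_Mapping.keys_add[of f f'] by (intro linear_ext_superset g) auto
  also have "\<dots> = (\<Oplus>m\<in>?K. Poly_Mapping.lookup f m \<odot> g m \<oplus> Poly_Mapping.lookup f' m \<odot> g m)"
    by (rule finsum_cong') (use g in \<open>auto simp: lookup_add smult_add_l\<close>)
  also have "\<dots> = (\<Oplus>m\<in>?K. Poly_Mapping.lookup f m \<odot> g m) \<oplus> (\<Oplus>m\<in>?K. Poly_Mapping.lookup f' m \<odot> g m)"
    by (rule finsum_addf) (use g in auto)
  also have "\<dots> = linear_ext A g f \<oplus> linear_ext A g f'"
    by (intro arg_cong2[where f = "(\<oplus>)"] linear_ext_superset[symmetric]) (use g in auto)
  finally show ?thesis .
qed

lemma linear_ext_single [simp]:
  "g k \<in> carrier A \<Longrightarrow> linear_ext A g (Poly_Mapping.single k c) = c \<odot> g k"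
  by (cases "c = 0") (auto simp: linear_ext_def)

lemma linear_ext_0 [simp]: "linear_ext A g 0 = \<zero>"
  by (simp add: linear_ext_def)

end

lemma linear_homI:
  assumes "\<And>x. x \<in> carrier A \<Longrightarrow> f x \<in> carrier B"
    "\<And>x y. x \<in> carrier A \<Longrightarrow> y \<in> carrier A \<Longrightarrow> f (x \<oplus>\<^bsub>A\<^esub> y) = f x \<oplus>\<^bsub>B\<^esub> f y"
    "\<And>c x. x \<in> carrier A \<Longrightarrow> f (c \<odot>\<^bsub>A\<^esub> x) = c \<odot>\<^bsub>B\<^esub> f x"
  shows "f \<in> linear_hom A B"
  using assms by (auto simp: linear_hom_def)

lemma linear_homD:
  assumes "f \<in> linear_hom A B" "x \<in> carrier A"
  shows "f x \<in> carrier B" "y \<in> carrier A \<Longrightarrow> f (x \<oplus>\<^bsub>A\<^esub> y) = f x \<oplus>\<^bsub>B\<^esub> f y"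
    "f (c \<odot>\<^bsub>A\<^esub> x) = c \<odot>\<^bsub>B\<^esub> f x"
  using assms by (auto simp: linear_hom_def)

lemma star_homI:
  assumes "f \<in> linear_hom A B" "f \<one>\<^bsub>A\<^esub> = \<one>\<^bsub>B\<^esub>"
    "\<And>x y. x \<in> carrier A \<Longrightarrow> y \<in> carrier A \<Longrightarrow> f (x \<otimes>\<^bsub>A\<^esub> y) = f x \<otimes>\<^bsub>B\<^esub> f y"
    "\<And>x. x \<in> carrier A \<Longrightarrow> f (x\<^sup>\<star>\<^bsub>A\<^esub>) = (f x)\<^sup>\<star>\<^bsub>B\<^esub>"
  shows "f \<in> star_hom A B"
  using assms by (auto simp: linear_hom_def star_hom_def ring_hom_def)

lemma star_homD:
  assumes "f \<in> star_hom A B"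
  shows "f \<in> linear_hom A B" "f \<one>\<^bsub>A\<^esub> = \<one>\<^bsub>B\<^esub>"
    "x \<in> carrier A \<Longrightarrow> f x \<in> carrier B"
    "x \<in> carrier A \<Longrightarrow> y \<in> carrier A \<Longrightarrow> f (x \<oplus>\<^bsub>A\<^esub> y) = f x \<oplus>\<^bsub>B\<^esub> f y"
    "x \<in> carrier A \<Longrightarrow> f (c \<odot>\<^bsub>A\<^esub> x) = c \<odot>\<^bsub>B\<^esub> f x"
    "x \<in> carrier A \<Longrightarrow> y \<in> carrier A \<Longrightarrow> f (x \<otimes>\<^bsub>A\<^esub> y) = f x \<otimes>\<^bsub>B\<^esub> f y"
    "x \<in> carrier A \<Longrightarrow> f (x\<^sup>\<star>\<^bsub>A\<^esub>) = (f x)\<^sup>\<star>\<^bsub>B\<^esub>"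
  using assms by (auto simp: linear_hom_def star_hom_def ring_hom_def)

lemma linear_hom_comp: "f \<in> linear_hom A B \<Longrightarrow> g \<in> linear_hom B C \<Longrightarrow> (\<lambda>x. g (f x)) \<in> linear_hom A C"
  by (rule linear_homI) (auto simp: linear_homD)

lemma star_hom_comp: "f \<in> star_hom A B \<Longrightarrow> g \<in> star_hom B C \<Longrightarrow> (\<lambda>x. g (f x)) \<in> star_hom A C"
  by (rule star_homI) (auto simp: star_homD intro: linear_hom_comp[OF star_homD(1) star_homD(1)])

lemma linear_hom_id: "(\<lambda>x. x) \<in> linear_hom A A"
  by (rule linear_homI) auto

lemma star_hom_id: "(\<lambda>x. x) \<in> star_hom A A"
  by (rule star_homI) (auto intro: linear_hom_id)

lemma linear_hom_zero:
  assumes "star_algebra A" "star_algebra B" "f \<in> linear_hom A B"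
  shows "f \<zero>\<^bsub>A\<^esub> = \<zero>\<^bsub>B\<^esub>"
proof -
  interpret A: star_algebra A by fact
  interpret B: star_algebra B by fact
  have "f (0 \<odot>\<^bsub>A\<^esub> \<zero>\<^bsub>A\<^esub>) = 0 \<odot>\<^bsub>B\<^esub> f \<zero>\<^bsub>A\<^esub>" by (rule linear_homD[OF assms(3)]) auto
  then show ?thesis using linear_homD(1)[OF assms(3)] by simp
qed

lemma linear_hom_uminus:
  assumes "star_algebra A" "star_algebra B" "f \<in> linear_hom A B" "x \<in> carrier A"
  shows "f (\<ominus>\<^bsub>A\<^esub> x) = \<ominus>\<^bsub>B\<^esub> f x"
proof -
  interpret A: star_algebra A by fact
  interpret B: star_algebra B by fact
  show ?thesis using linear_homD[OF assms(3,4)] by (simp add: A.uminus_conv B.uminus_conv assms)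
qed

lemma linear_hom_minus:
  assumes "star_algebra A" "star_algebra B" "f \<in> linear_hom A B" "x \<in> carrier A" "y \<in> carrier A"
  shows "f (x \<ominus>\<^bsub>A\<^esub> y) = f x \<ominus>\<^bsub>B\<^esub> f y"
proof -
  interpret A: star_algebra A by fact
  interpret B: star_algebra B by fact
  show ?thesis using linear_homD[OF assms(3,4)] linear_hom_uminus[OF assms(1-3,5)]
    by (simp add: a_minus_def assms)
qed

locale star_monoid = monoid M for M (structure) and s +
  assumes s_closed [simp, intro]: "u \<in> carrier M \<Longrightarrow> s u \<in> carrier M"
    and s_mult: "\<lbrakk>u \<in> carrier M; v \<in> carrier M\<rbrakk> \<Longrightarrow> s (u \<otimes> v) = s v \<otimes> s u"
    and s_s: "u \<in> carrier M \<Longrightarrow> s (s u) = u"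

lemma pm_induct [consumes 1, case_names zero add single]:
  fixes f :: "'m \<Rightarrow>\<^sub>0 complex"
  assumes "Poly_Mapping.keys f \<subseteq> S"
    and "P 0"
    and "\<And>f g. \<lbrakk>Poly_Mapping.keys f \<subseteq> S; Poly_Mapping.keys g \<subseteq> S; P f; P g\<rbrakk> \<Longrightarrow> P (f + g)"
    and "\<And>m c. m \<in> S \<Longrightarrow> P (Poly_Mapping.single m c)"
  shows "P f"
proof -
  have "Poly_Mapping.keys f \<subseteq> S \<longrightarrow> P f"
  proof (induction f rule: Poly_Mapping.update_induct)
    case const
    then show ?case using assms by simp
  next
    case (update f a b)
    have eq: "Poly_Mapping.update a b f = f + Poly_Mapping.single a b"
      using update(1) by (intro poly_mapping_eqI)
        (auto simp: lookup_add lookup_update lookup_single when_def in_keys_iff)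
    have "Poly_Mapping.keys (Poly_Mapping.update a b f) = insert a (Poly_Mapping.keys f)"
      using update by (auto simp: keys_update)
    then show ?case using update assms(3)[of f "Poly_Mapping.single a b"] assms(4)[of a b]
      by (auto simp: eq)
  qed
  then show ?thesis using assms(1) by simp
qed

lemma scale_add: "Poly_Mapping.map ((*) (c::complex)) (f + g)
    = Poly_Mapping.map ((*) c) f + Poly_Mapping.map ((*) c) g"
  by (intro poly_mapping_eqI) (simp add: lookup_add algebra_simps)

lemma scale_sum: "Poly_Mapping.map ((*) (c::complex)) (\<Sum>i\<in>I. f i)
    = (\<Sum>i\<in>I. Poly_Mapping.map ((*) c) (f i))"
  by (intro poly_mapping_eqI) (simp add: lookup_sum sum_distrib_left)

lemma scale_0 [simp]: "Poly_Mapping.map ((*) (c::complex)) 0 = 0"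
  by (intro poly_mapping_eqI) simp

lemma keys_scale: "Poly_Mapping.keys (Poly_Mapping.map ((*) (c::complex)) f) \<subseteq> Poly_Mapping.keys f"
  by (auto simp: in_keys_iff)

lemma scale_single [simp]: "Poly_Mapping.map ((*) (c::complex)) (Poly_Mapping.single k d) = Poly_Mapping.single k (c * d)"
  by (intro poly_mapping_eqI) (simp add: lookup_single when_def)

context
  fixes M :: "('m, 'x) monoid_scheme" (structure) and s :: "'m \<Rightarrow> 'm"
begin

abbreviation "cM \<equiv> monoid_star_algebra M s"

lemma msa_sel:
  "carrier cM = {f. Poly_Mapping.keys f \<subseteq> carrier M}"
  "\<one>\<^bsub>cM\<^esub> = Poly_Mapping.single \<one> 1" "\<zero>\<^bsub>cM\<^esub> = 0" "f \<oplus>\<^bsub>cM\<^esub> g = f + g"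
  "c \<odot>\<^bsub>cM\<^esub> f = Poly_Mapping.map ((*) c) f"
  by (simp_all add: monoid_star_algebra_def)

lemma msa_mult_superset:
  assumes "finite K" "finite L" "Poly_Mapping.keys f \<subseteq> K" "Poly_Mapping.keys g \<subseteq> L"
  shows "f \<otimes>\<^bsub>cM\<^esub> g = (\<Sum>u\<in>K. \<Sum>v\<in>L.
     Poly_Mapping.single (u \<otimes> v) (Poly_Mapping.lookup f u * Poly_Mapping.lookup g v))"
proof -
  have "f \<otimes>\<^bsub>cM\<^esub> g = (\<Sum>u\<in>K. \<Sum>v\<in>Poly_Mapping.keys g.
     Poly_Mapping.single (u \<otimes> v) (Poly_Mapping.lookup f u * Poly_Mapping.lookup g v))"
    unfolding monoid_star_algebra_def using assms
    by (auto intro!: sum.mono_neutral_left sum.neutral simp: in_keys_iff)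
  also have "\<dots> = (\<Sum>u\<in>K. \<Sum>v\<in>L.
     Poly_Mapping.single (u \<otimes> v) (Poly_Mapping.lookup f u * Poly_Mapping.lookup g v))"
    using assms by (intro sum.cong sum.mono_neutral_left) (auto simp: in_keys_iff)
  finally show ?thesis .
qed

lemma msa_star_superset:
  assumes "finite K" "Poly_Mapping.keys f \<subseteq> K"
  shows "f\<^sup>\<star>\<^bsub>cM\<^esub> = (\<Sum>u\<in>K. Poly_Mapping.single (s u) (cnj (Poly_Mapping.lookup f u)))"
  unfolding monoid_star_algebra_def using assms
  by (auto intro!: sum.mono_neutral_left simp: in_keys_iff)

lemma msa_add_l: "(f + f') \<otimes>\<^bsub>cM\<^esub> g = (f \<otimes>\<^bsub>cM\<^esub> g) + (f' \<otimes>\<^bsub>cM\<^esub> g)"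
proof -
  let ?K = "Poly_Mapping.keys f \<union> Poly_Mapping.keys f'" let ?L = "Poly_Mapping.keys g"
  have "Poly_Mapping.keys (f + f') \<subseteq> ?K" by (rule Poly_Mapping.keys_add)
  then show ?thesis
    by (subst (1 2 3) msa_mult_superset[of ?K ?L])
       (auto simp: lookup_add algebra_simps single_add sum.distrib)
qed

lemma msa_add_r: "f \<otimes>\<^bsub>cM\<^esub> (g + g') = (f \<otimes>\<^bsub>cM\<^esub> g) + (f \<otimes>\<^bsub>cM\<^esub> g')"
proof -
  let ?K = "Poly_Mapping.keys f" let ?L = "Poly_Mapping.keys g \<union> Poly_Mapping.keys g'"
  have "Poly_Mapping.keys (g + g') \<subseteq> ?L" by (rule Poly_Mapping.keys_add)
  then show ?thesis
    by (subst (1 2 3) msa_mult_superset[of ?K ?L])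
       (auto simp: lookup_add algebra_simps single_add sum.distrib)
qed

lemma msa_star_add: "(f + f')\<^sup>\<star>\<^bsub>cM\<^esub> = f\<^sup>\<star>\<^bsub>cM\<^esub> + f'\<^sup>\<star>\<^bsub>cM\<^esub>"
proof -
  let ?K = "Poly_Mapping.keys f \<union> Poly_Mapping.keys f'"
  have "Poly_Mapping.keys (f + f') \<subseteq> ?K" by (rule Poly_Mapping.keys_add)
  then show ?thesis
    by (subst (1 2 3) msa_star_superset[of ?K])
       (auto simp: lookup_add single_add sum.distrib)
qed

lemma msa_scale_l: "Poly_Mapping.map ((*) c) f \<otimes>\<^bsub>cM\<^esub> g = Poly_Mapping.map ((*) c) (f \<otimes>\<^bsub>cM\<^esub> g)"
  by (subst (1 2) msa_mult_superset[of "Poly_Mapping.keys f" "Poly_Mapping.keys g"])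
     (auto simp: keys_scale scale_sum mult_ac)

lemma msa_scale_r: "f \<otimes>\<^bsub>cM\<^esub> Poly_Mapping.map ((*) c) g = Poly_Mapping.map ((*) c) (f \<otimes>\<^bsub>cM\<^esub> g)"
  by (subst (1 2) msa_mult_superset[of "Poly_Mapping.keys f" "Poly_Mapping.keys g"])
     (auto simp: keys_scale scale_sum mult_ac)

lemma msa_star_scale: "(Poly_Mapping.map ((*) c) f)\<^sup>\<star>\<^bsub>cM\<^esub> = Poly_Mapping.map ((*) (cnj c)) (f\<^sup>\<star>\<^bsub>cM\<^esub>)"
  by (subst (1 2) msa_star_superset[of "Poly_Mapping.keys f"]) (auto simp: keys_scale scale_sum)

lemma msa_zero [simp]: "0 \<otimes>\<^bsub>cM\<^esub> g = 0" "g \<otimes>\<^bsub>cM\<^esub> 0 = 0" "0\<^sup>\<star>\<^bsub>cM\<^esub> = 0"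
  by (simp_all add: monoid_star_algebra_def)

lemma msa_single [simp]:
  "Poly_Mapping.single u c \<otimes>\<^bsub>cM\<^esub> Poly_Mapping.single v d = Poly_Mapping.single (u \<otimes> v) (c * d)"
  by (subst msa_mult_superset[of "{u}" "{v}"]) (auto simp: lookup_single)

lemma msa_star_single [simp]: "(Poly_Mapping.single u c)\<^sup>\<star>\<^bsub>cM\<^esub> = Poly_Mapping.single (s u) (cnj c)"
  by (subst msa_star_superset[of "{u}"]) (auto simp: lookup_single)

end

lemma keys_single_subset: "m \<in> S \<Longrightarrow> Poly_Mapping.keys (Poly_Mapping.single m c) \<subseteq> S"
  by (auto simp: Poly_Mapping.keys_single)

context star_monoid
begin

lemma msa_star_algebra: "star_algebra (monoid_star_algebra M s)"
proof -
  let ?F = "monoid_star_algebra M s"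
  let ?k = "\<lambda>f. Poly_Mapping.keys f \<subseteq> carrier M"
  have add: "?k (f + g)" if "?k f" "?k g" for f g :: "'a \<Rightarrow>\<^sub>0 complex"
    using that Poly_Mapping.keys_add[of f g] by blast
  have mc: "?k (f \<otimes>\<^bsub>?F\<^esub> g)" if "?k f" "?k g" for f g
    using that(1)
  proof (induction rule: pm_induct)
    case (single u c)
    show ?case using that(2)
      by (induction rule: pm_induct) (auto simp: msa_add_r add single intro!: keys_single_subset)
  qed (auto simp: msa_add_l add)
  have assoc: "(f \<otimes>\<^bsub>?F\<^esub> g) \<otimes>\<^bsub>?F\<^esub> h = f \<otimes>\<^bsub>?F\<^esub> (g \<otimes>\<^bsub>?F\<^esub> h)" if "?k f" "?k g" "?k h" for f g h
    using that(1)
  proof (induction rule: pm_induct)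
    case (single u c)
    show ?case using that(2)
    proof (induction rule: pm_induct)
      case (single v d)
      show ?case using that(3)
        by (induction rule: pm_induct) (auto simp: msa_add_r single \<open>u \<in> carrier M\<close> m_assoc mult_ac)
    qed (auto simp: msa_add_l msa_add_r)
  qed (auto simp: msa_add_l)
  have onel: "Poly_Mapping.single \<one> 1 \<otimes>\<^bsub>?F\<^esub> f = f" if "?k f" for f
    using that by (induction rule: pm_induct) (auto simp: msa_add_r)
  have oner: "f \<otimes>\<^bsub>?F\<^esub> Poly_Mapping.single \<one> 1 = f" if "?k f" for f
    using that by (induction rule: pm_induct) (auto simp: msa_add_l)
  have sc: "?k (f\<^sup>\<star>\<^bsub>?F\<^esub>)" if "?k f" for f
    using that by (induction rule: pm_induct) (auto simp: msa_star_add add intro!: keys_single_subset)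
  have ss: "(f\<^sup>\<star>\<^bsub>?F\<^esub>)\<^sup>\<star>\<^bsub>?F\<^esub> = f" if "?k f" for f
    using that by (induction rule: pm_induct) (auto simp: msa_star_add s_s)
  have sm: "(f \<otimes>\<^bsub>?F\<^esub> g)\<^sup>\<star>\<^bsub>?F\<^esub> = g\<^sup>\<star>\<^bsub>?F\<^esub> \<otimes>\<^bsub>?F\<^esub> f\<^sup>\<star>\<^bsub>?F\<^esub>" if "?k f" "?k g" for f g
    using that(1)
  proof (induction rule: pm_induct)
    case (single u c)
    show ?case using that(2)
      by (induction rule: pm_induct) (auto simp: msa_add_l msa_add_r msa_star_add single s_mult mult_ac)
  qed (auto simp: msa_add_l msa_add_r msa_star_add)
  have "ring ?F"
  proof (intro ringI abelian_groupI monoidI)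
    fix f assume "f \<in> carrier ?F"
    then show "\<exists>g\<in>carrier ?F. g \<oplus>\<^bsub>?F\<^esub> f = \<zero>\<^bsub>?F\<^esub>"
      by (intro bexI[of _ "- f"]) (auto simp: msa_sel in_keys_iff)
  qed (auto simp: msa_sel add mc assoc onel oner msa_add_l msa_add_r add_ac keys_single_subset intro!: keys_single_subset)
  then show ?thesis
    by (rule star_algebraI)
       (use keys_scale in \<open>fastforce simp: msa_sel msa_scale_l msa_scale_r sc ss sm msa_star_add msa_star_scale
          scale_add lookup_add algebra_simps intro: poly_mapping_eqI\<close>)+
qed

lemma linear_ext_msa:
  assumes "star_algebra B" "\<And>m. m \<in> carrier M \<Longrightarrow> g m \<in> carrier B"
  shows "linear_ext B g \<in> linear_hom (monoid_star_algebra M s) B"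
proof -
  interpret B: star_algebra B by fact
  show ?thesis
  proof (rule linear_homI; simp add: msa_sel)
    fix c and x :: "'a \<Rightarrow>\<^sub>0 complex" assume "Poly_Mapping.keys x \<subseteq> carrier M"
    then show "linear_ext B g (Poly_Mapping.map ((*) c) x) = c \<odot>\<^bsub>B\<^esub> linear_ext B g x"
    proof (induction rule: pm_induct)
      case (add f f')
      have "linear_ext B g (Poly_Mapping.map ((*) c) (f + f'))
        = linear_ext B g (Poly_Mapping.map ((*) c) f) \<oplus>\<^bsub>B\<^esub> linear_ext B g (Poly_Mapping.map ((*) c) f')"
        unfolding scale_add using add(1,2) keys_scale[of c f] keys_scale[of c f']
        by (intro B.linear_ext_add assms(2)) auto
      then show ?case using add
        by (simp add: B.smult_add_r B.linear_ext_add assms(2) subset_iff B.linear_ext_closed)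
    qed (auto simp: assms B.smult_smult)
  qed (auto intro!: B.linear_ext_closed B.linear_ext_add assms(2))
qed

lemma msa_linear_hom_eqI:
  assumes "star_algebra B" "f \<in> linear_hom (monoid_star_algebra M s) B" "g \<in> linear_hom (monoid_star_algebra M s) B"
    and "\<And>m. m \<in> carrier M \<Longrightarrow> f (Poly_Mapping.single m 1) = g (Poly_Mapping.single m 1)"
    and "x \<in> carrier (monoid_star_algebra M s)"
  shows "f x = g x"
proof -
  interpret F: star_algebra "monoid_star_algebra M s" by (rule msa_star_algebra)
  have "Poly_Mapping.keys x \<subseteq> carrier M" using assms by (simp add: msa_sel)
  then show ?thesis
  proof (induction rule: pm_induct)
    case zero
    show ?case using linear_hom_zero[OF F.star_algebra_axioms assms(1)] assms(2,3)
      by (metis msa_sel(3))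
  next
    case (add x y)
    then show ?case using linear_homD(2)[OF assms(2), of x y] linear_homD(2)[OF assms(3), of x y]
      by (simp add: msa_sel)
  next
    case (single m c)
    then show ?case using linear_homD(3)[OF assms(2), of "Poly_Mapping.single m 1" c]
      linear_homD(3)[OF assms(3), of "Poly_Mapping.single m 1" c] assms(4)[of m]
      by (simp add: msa_sel keys_single_subset)
  qed
qed

end

locale star_ideal = star_algebra A + ideal I A for I and A (structure) +
  assumes I_star: "x \<in> I \<Longrightarrow> x\<^sup>\<star> \<in> I"
begin

abbreviation "Q \<equiv> quotient_star_algebra A I"

lemma I_smult: "x \<in> I \<Longrightarrow> c \<odot> x \<in> I"
  using I_l_closed[of x "c \<odot> \<one>"] by (simp add: smult_mult_left a_Hcarr)

lemma coset_eq_iff: "\<lbrakk>x \<in> carrier A; y \<in> carrier A\<rbrakk> \<Longrightarrow> I +> x = I +> y \<longleftrightarrow> x \<ominus> y \<in> I"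
  using quotient_eq_iff_same_a_r_cos[OF is_ideal] by auto

lemma mem_coset: "\<lbrakk>x \<in> carrier A; y \<in> I +> x\<rbrakk> \<Longrightarrow> y \<in> carrier A \<and> y \<ominus> x \<in> I"
  using a_rcos_module_imp[of x y] a_elemrcos_carrier[of x y] by (simp add: a_minus_def)

lemma coset_image:
  assumes "x \<in> carrier A" "\<And>y. y \<in> carrier A \<Longrightarrow> y \<ominus> x \<in> I \<Longrightarrow> h y = h x"
  shows "h ` (I +> x) = {h x}"
  using mem_coset[OF assms(1)] assms a_rcos_self[OF assms(1)] by blast

lemma Q_sel:
  "carrier Q = (\<lambda>x. I +> x) ` carrier A" "\<one>\<^bsub>Q\<^esub> = I +> \<one>" "\<zero>\<^bsub>Q\<^esub> = I +> \<zero>"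
  "\<lbrakk>x \<in> carrier A; y \<in> carrier A\<rbrakk> \<Longrightarrow> (I +> x) \<oplus>\<^bsub>Q\<^esub> (I +> y) = I +> (x \<oplus> y)"
  "\<lbrakk>x \<in> carrier A; y \<in> carrier A\<rbrakk> \<Longrightarrow> (I +> x) \<otimes>\<^bsub>Q\<^esub> (I +> y) = I +> (x \<otimes> y)"
  "x \<in> carrier A \<Longrightarrow> c \<odot>\<^bsub>Q\<^esub> (I +> x) = I +> (c \<odot> x)"
  "x \<in> carrier A \<Longrightarrow> (I +> x)\<^sup>\<star>\<^bsub>Q\<^esub> = I +> x\<^sup>\<star>"
proof -
  show "carrier Q = (\<lambda>x. I +> x) ` carrier A"
    by (auto simp: quotient_star_algebra_def FactRing_def A_RCOSETS_def')
  show "\<one>\<^bsub>Q\<^esub> = I +> \<one>" by (simp add: quotient_star_algebra_def FactRing_def)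
  show "\<zero>\<^bsub>Q\<^esub> = I +> \<zero>" using a_coset_add_zero[OF a_subset]
    by (simp add: quotient_star_algebra_def FactRing_def)
  show "\<lbrakk>x \<in> carrier A; y \<in> carrier A\<rbrakk> \<Longrightarrow> (I +> x) \<oplus>\<^bsub>Q\<^esub> (I +> y) = I +> (x \<oplus> y)"
    by (simp add: quotient_star_algebra_def FactRing_def a_rcos_sum)
  show "\<lbrakk>x \<in> carrier A; y \<in> carrier A\<rbrakk> \<Longrightarrow> (I +> x) \<otimes>\<^bsub>Q\<^esub> (I +> y) = I +> (x \<otimes> y)"
    by (simp add: quotient_star_algebra_def FactRing_def rcoset_mult_add)
  show "c \<odot>\<^bsub>Q\<^esub> (I +> x) = I +> (c \<odot> x)" if x: "x \<in> carrier A"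
  proof -
    have "(\<lambda>y. I +> (c \<odot> y)) ` (I +> x) = {I +> (c \<odot> x)}"
    proof (rule coset_image[OF x])
      fix y assume y: "y \<in> carrier A" "y \<ominus> x \<in> I"
      have "c \<odot> y \<ominus> c \<odot> x = c \<odot> (y \<ominus> x)"
        using x y by (simp add: a_minus_def smult_add_r uminus_conv smult_smult mult.commute)
      then show "I +> (c \<odot> y) = I +> (c \<odot> x)" using x y I_smult by (subst coset_eq_iff) auto
    qed
    then show ?thesis by (simp add: quotient_star_algebra_def)
  qed
  show "(I +> x)\<^sup>\<star>\<^bsub>Q\<^esub> = I +> x\<^sup>\<star>" if x: "x \<in> carrier A"
  proof -
    have "(\<lambda>y. I +> y\<^sup>\<star>) ` (I +> x) = {I +> x\<^sup>\<star>}"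
    proof (rule coset_image[OF x])
      fix y assume y: "y \<in> carrier A" "y \<ominus> x \<in> I"
      have "y\<^sup>\<star> \<ominus> x\<^sup>\<star> = (y \<ominus> x)\<^sup>\<star>"
        using x y by (simp add: a_minus_def star_add star_uminus)
      then show "I +> y\<^sup>\<star> = I +> x\<^sup>\<star>" using x y I_star by (subst coset_eq_iff) auto
    qed
    then show ?thesis by (simp add: quotient_star_algebra_def)
  qed
qed

lemma star_algebra_Q: "star_algebra Q"
proof (rule star_algebraI)
  have Quot: "ring (A Quot I)" by (rule quotient_is_ring)
  interpret R: ring "A Quot I" by fact
  have eq: "carrier Q = carrier (A Quot I)" "monoid.mult Q = monoid.mult (A Quot I)"
    "one Q = one (A Quot I)" "zero Q = zero (A Quot I)" "add Q = add (A Quot I)"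
    by (simp_all add: quotient_star_algebra_def)
  show "ring Q"
    by (intro ringI abelian_groupI monoidI; simp only: eq)
       (auto simp: R.add.m_ac R.m_assoc R.l_distr R.r_distr intro: R.add.l_inv_ex)
qed (auto simp: Q_sel smult_add_l smult_add_r smult_smult smult_mult_left smult_mult_right
      star_add star_smult star_mult)

lemma proj_star_hom: "(\<lambda>x. I +> x) \<in> star_hom A Q"
  by (intro star_homI linear_homI) (auto simp: Q_sel)

lemma lift_coset:
  assumes B: "star_algebra B" and f: "f \<in> linear_hom A B" and I: "\<And>x. x \<in> I \<Longrightarrow> f x = \<zero>\<^bsub>B\<^esub>"
    and x: "x \<in> carrier A"
  shows "the_elem (f ` (I +> x)) = f x"
proof -
  interpret B: star_algebra B by fact
  have "f ` (I +> x) = {f x}"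
  proof (rule coset_image[OF x])
    fix y assume y: "y \<in> carrier A" "y \<ominus> x \<in> I"
    then have "f y \<ominus>\<^bsub>B\<^esub> f x = \<zero>\<^bsub>B\<^esub>"
      using linear_hom_minus[OF star_algebra_axioms B f y(1) x] I[OF y(2)] by simp
    then show "f y = f x" using linear_homD(1)[OF f] x y by (simp add: B.diff_eq_zero_iff)
  qed
  then show ?thesis by simp
qed

lemma lift_linear_hom:
  assumes B: "star_algebra B" and f: "f \<in> linear_hom A B" and I: "\<And>x. x \<in> I \<Longrightarrow> f x = \<zero>\<^bsub>B\<^esub>"
  shows "(\<lambda>X. the_elem (f ` X)) \<in> linear_hom Q B"
  by (rule linear_homI) (auto simp: Q_sel lift_coset[OF assms] linear_homD[OF f])

lemma lift_star_hom:
  assumes B: "star_algebra B" and f: "f \<in> star_hom A B" and I: "\<And>x. x \<in> I \<Longrightarrow> f x = \<zero>\<^bsub>B\<^esub>"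
  shows "(\<lambda>X. the_elem (f ` X)) \<in> star_hom Q B"
  by (rule star_homI)
    (auto simp: Q_sel lift_coset[OF B star_homD(1)[OF f] I] star_homD[OF f]
       intro!: lift_linear_hom[OF B star_homD(1)[OF f] I])

end

interpretation word: star_monoid "\<lparr>carrier = UNIV, monoid.mult = (@), one = []\<rparr>"
    "\<lambda>w :: ('g \<times> bool) list. rev (map (apsnd Not) w)"
  by unfold_locales (auto simp: rev_map intro!: map_idI)

interpretation free: star_algebra "free_star_algebra :: (('g \<times> bool) list \<Rightarrow>\<^sub>0 complex) star_algebra"
  unfolding free_star_algebra_def by (rule word.msa_star_algebra)

lemma free_sel:
  "carrier free_star_algebra = UNIV" "\<one>\<^bsub>free_star_algebra\<^esub> = Poly_Mapping.single [] 1"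
  "Poly_Mapping.single u c \<otimes>\<^bsub>free_star_algebra\<^esub> Poly_Mapping.single v d = Poly_Mapping.single (u @ v) (c * d)"
  "(Poly_Mapping.single u c)\<^sup>\<star>\<^bsub>free_star_algebra\<^esub> = Poly_Mapping.single (rev (map (apsnd Not) u)) (cnj c)"
  "x \<oplus>\<^bsub>free_star_algebra\<^esub> y = x + y"
  "c \<odot>\<^bsub>free_star_algebra\<^esub> x = Poly_Mapping.map ((*) c) x"
  by (simp_all add: free_star_algebra_def msa_sel)

lemma free_gen_closed [simp]: "free_gen g \<in> carrier free_star_algebra"
  by (simp add: free_sel)

lemma free_induct [case_names one gen star_gen add smult]:
  assumes one: "P \<one>\<^bsub>free_star_algebra\<^esub>"
    and gen: "\<And>g x. P x \<Longrightarrow> P (free_gen g \<otimes>\<^bsub>free_star_algebra\<^esub> x)"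
    and star_gen: "\<And>g x. P x \<Longrightarrow> P ((free_gen g)\<^sup>\<star>\<^bsub>free_star_algebra\<^esub> \<otimes>\<^bsub>free_star_algebra\<^esub> x)"
    and add: "\<And>x y. P x \<Longrightarrow> P y \<Longrightarrow> P (x \<oplus>\<^bsub>free_star_algebra\<^esub> y)"
    and smult: "\<And>c x. P x \<Longrightarrow> P (c \<odot>\<^bsub>free_star_algebra\<^esub> x)"
  shows "P x"
proof -
  have w: "P (Poly_Mapping.single w 1)" for w
  proof (induction w)
    case Nil
    then show ?case using one by (simp add: free_sel)
  next
    case (Cons l w)
    obtain g b where "l = (g, b)" by force
    then show ?case using gen[OF Cons, of g] star_gen[OF Cons, of g]
      by (cases b) (simp_all add: free_gen_def free_sel)
  qed
  have "Poly_Mapping.keys x \<subseteq> UNIV" by simp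
  then show ?thesis
  proof (induction rule: pm_induct)
    case zero
    then show ?case using smult[OF one, of 0] by (simp add: free_sel)
  next
    case (add f g)
    then show ?case using assms(4) by (simp add: free_sel)
  next
    case (single m c)
    then show ?case using smult[OF w, of c] by (simp add: free_sel)
  qed
qed

lemma free_eval_star_hom:
  fixes h :: "'g \<Rightarrow> 'b"
  assumes "star_algebra B" "\<And>g. h g \<in> carrier B"
  shows "linear_ext B (word_value B h) \<in> star_hom free_star_algebra B"
    and "linear_ext B (word_value B h) (free_gen g) = h g"
proof -
  interpret B: star_algebra B by fact
  let ?e = "linear_ext B (word_value B h)"
  let ?v = "word_value B h"
  have vC [simp]: "?v w \<in> carrier B" for w
    by (induction w) (auto simp: word_value_def assms)
  have v1: "?v [l] = (if snd l then (h (fst l))\<^sup>\<star>\<^bsub>B\<^esub> else h (fst l))" for l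
    by (cases l) (simp add: word_value_def assms)
  have vapp: "?v (u @ w) = ?v u \<otimes>\<^bsub>B\<^esub> ?v w" for u w
  proof (induction u)
    case Nil
    show ?case using vC[of w] by (simp add: word_value_def)
  next
    case (Cons l u)
    obtain g b where l: "l = (g, b)" by force
    show ?case using Cons vC[of u] vC[of w] by (auto simp: word_value_def l assms B.m_assoc)
  qed
  have vstar: "?v (rev (map (apsnd Not) w)) = (?v w)\<^sup>\<star>\<^bsub>B\<^esub>" for w
  proof (induction w)
    case Nil
    then show ?case by (simp add: word_value_def)
  next
    case (Cons l w)
    have "?v (l # w) = ?v [l] \<otimes>\<^bsub>B\<^esub> ?v w" using vapp[of "[l]" w] by simp
    moreover have "?v [apsnd Not l] = (?v [l])\<^sup>\<star>\<^bsub>B\<^esub>"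
      by (cases l) (simp add: v1 assms)
    ultimately show ?case using Cons by (simp add: vapp B.star_mult)
  qed
  have lin: "?e \<in> linear_hom free_star_algebra B"
    unfolding free_star_algebra_def by (rule word.linear_ext_msa) (auto simp: assms)
  have add: "?e (x + y) = ?e x \<oplus>\<^bsub>B\<^esub> ?e y" for x y by (rule B.linear_ext_add) auto
  have cl [simp]: "?e x \<in> carrier B" for x by auto
  show "?e (free_gen g) = h g"
    using v1[of "(g, False)"] by (simp add: free_gen_def assms)
  show "?e \<in> star_hom free_star_algebra B"
  proof (rule star_homI[OF lin])
    show "?e \<one>\<^bsub>free_star_algebra\<^esub> = \<one>\<^bsub>B\<^esub>"
      by (simp add: free_sel) (simp add: word_value_def)
  next
    fix x y :: "('g \<times> bool) list \<Rightarrow>\<^sub>0 complex"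
    have "Poly_Mapping.keys x \<subseteq> UNIV" by simp
    then show "?e (x \<otimes>\<^bsub>free_star_algebra\<^esub> y) = ?e x \<otimes>\<^bsub>B\<^esub> ?e y"
    proof (induction rule: pm_induct)
      case (single u c)
      have "Poly_Mapping.keys y \<subseteq> UNIV" by simp
      then show ?case
        by (induction rule: pm_induct)
          (auto simp: free_star_algebra_def msa_add_r add B.r_distr vapp B.smult_mult_left
            B.smult_mult_right B.smult_smult mult_ac)
    qed (auto simp: free_star_algebra_def msa_add_l add B.l_distr)
  next
    fix x :: "('g \<times> bool) list \<Rightarrow>\<^sub>0 complex"
    have "Poly_Mapping.keys x \<subseteq> UNIV" by simp
    then show "?e (x\<^sup>\<star>\<^bsub>free_star_algebra\<^esub>) = (?e x)\<^sup>\<star>\<^bsub>B\<^esub>"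
      by (induction rule: pm_induct)
        (auto simp: free_star_algebra_def msa_star_add add B.star_add vstar B.star_smult)
  qed
qed

lemma (in star_algebra) ideal_genideal_star:
  assumes "D \<subseteq> carrier A"
  shows "star_ideal (Idl (D \<union> star A ` D)) A"
proof -
  let ?D = "D \<union> star A ` D"
  let ?I = "Idl ?D"
  have D: "?D \<subseteq> carrier A" using assms by auto
  interpret I: ideal ?I A by (rule genideal_ideal[OF D])
  let ?J = "{x \<in> carrier A. x\<^sup>\<star> \<in> ?I}"
  have "ideal ?J A"
  proof (intro idealI ring_ax)
    show "subgroup ?J (add_monoid A)"
      by (intro add.subgroupI)
        (auto simp: star_add star_uminus a_inv_def[symmetric] I.a_closed intro!: exI[of _ \<zero>])
  qed (auto simp: star_mult I.I_l_closed I.I_r_closed)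
  moreover have "?D \<subseteq> ?J" using D assms genideal_self[OF D] by auto
  ultimately have "?I \<subseteq> ?J" by (rule genideal_minimal)
  then show ?thesis
    by (intro star_ideal.intro star_ideal_axioms.intro star_algebra_axioms I.is_ideal) auto
qed

lemma star_ideal_relation_ideal: "star_ideal (relation_ideal R) free_star_algebra"
  unfolding relation_ideal_def Let_def by (rule free.ideal_genideal_star) (simp add: free_sel)

lemma relation_in_ideal: "(x, y) \<in> R \<Longrightarrow> x \<ominus>\<^bsub>free_star_algebra\<^esub> y \<in> relation_ideal R"
  unfolding relation_ideal_def Let_def
  by (rule subsetD[OF free.genideal_self]) (auto simp: free_sel)

lemma presented_star_algebra: "star_algebra (presented_star_algebra R)"
proof -
  interpret star_ideal "relation_ideal R" free_star_algebra by (rule star_ideal_relation_ideal)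
  show ?thesis unfolding presented_star_algebra_def by (rule star_algebra_Q)
qed

lemma presented_proj:
  "(\<lambda>x. relation_ideal R +>\<^bsub>free_star_algebra\<^esub> x) \<in> star_hom free_star_algebra (presented_star_algebra R)"
proof -
  interpret star_ideal "relation_ideal R" free_star_algebra by (rule star_ideal_relation_ideal)
  show ?thesis unfolding presented_star_algebra_def by (rule proj_star_hom)
qed

lemma presented_carrier:
  "carrier (presented_star_algebra R) = range (\<lambda>x. relation_ideal R +>\<^bsub>free_star_algebra\<^esub> x)"
proof -
  interpret star_ideal "relation_ideal R" free_star_algebra by (rule star_ideal_relation_ideal)
  show ?thesis unfolding presented_star_algebra_def by (simp add: Q_sel free_sel)
qed

lemma presented_gen_closed: "presented_gen R g \<in> carrier (presented_star_algebra R)"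
  by (auto simp: presented_carrier presented_gen_def)

lemma presented_relation:
  assumes "(x, y) \<in> R"
  shows "relation_ideal R +>\<^bsub>free_star_algebra\<^esub> x = relation_ideal R +>\<^bsub>free_star_algebra\<^esub> y"
proof -
  interpret star_ideal "relation_ideal R" free_star_algebra by (rule star_ideal_relation_ideal)
  show ?thesis using relation_in_ideal[OF assms] by (subst coset_eq_iff) (auto simp: free_sel)
qed

lemma presented_induct [consumes 1, case_names one gen star_gen add smult]:
  assumes x: "x \<in> carrier (presented_star_algebra R)"
    and one: "P \<one>\<^bsub>presented_star_algebra R\<^esub>"
    and gen: "\<And>g x. x \<in> carrier (presented_star_algebra R) \<Longrightarrow> P x \<Longrightarrow> P (presented_gen R g \<otimes>\<^bsub>presented_star_algebra R\<^esub> x)"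
    and star_gen: "\<And>g x. x \<in> carrier (presented_star_algebra R) \<Longrightarrow> P x \<Longrightarrow>
        P ((presented_gen R g)\<^sup>\<star>\<^bsub>presented_star_algebra R\<^esub> \<otimes>\<^bsub>presented_star_algebra R\<^esub> x)"
    and add: "\<And>x y. x \<in> carrier (presented_star_algebra R) \<Longrightarrow> y \<in> carrier (presented_star_algebra R) \<Longrightarrow>
        P x \<Longrightarrow> P y \<Longrightarrow> P (x \<oplus>\<^bsub>presented_star_algebra R\<^esub> y)"
    and smult: "\<And>c x. x \<in> carrier (presented_star_algebra R) \<Longrightarrow> P x \<Longrightarrow> P (c \<odot>\<^bsub>presented_star_algebra R\<^esub> x)"
  shows "P x"
proof -
  note pr = star_homD[OF presented_proj[of R], unfolded free_sel(1), simplified]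
  have "P (relation_ideal R +>\<^bsub>free_star_algebra\<^esub> y)" for y
  proof (induction y rule: free_induct)
    case one
    then show ?case using assms(2) by (simp add: pr)
  next
    case (gen g x)
    then show ?case using assms(3)[OF pr(3)] by (simp add: pr presented_gen_def)
  next
    case (star_gen g x)
    then show ?case using assms(4)[OF pr(3)] by (simp add: pr presented_gen_def)
  next
    case (add x y)
    then show ?case using assms(5)[OF pr(3) pr(3)] by (simp add: pr)
  next
    case (smult c x)
    then show ?case using assms(6)[OF pr(3)] by (simp add: pr)
  qed
  then show ?thesis using x by (auto simp: presented_carrier)
qed

lemma presented_hom_eqI:
  assumes f: "f \<in> star_hom (presented_star_algebra R) B" and f': "f' \<in> star_hom (presented_star_algebra R) B"
    and eq: "\<And>g. f (presented_gen R g) = f' (presented_gen R g)"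
    and x: "x \<in> carrier (presented_star_algebra R)"
  shows "f x = f' x"
proof -
  interpret P: star_algebra "presented_star_algebra R" by (rule presented_star_algebra)
  show ?thesis using x
    by (induction rule: presented_induct)
       (auto simp: star_homD[OF f] star_homD[OF f'] eq presented_gen_closed)
qed

lemma presented_lift:
  assumes B: "star_algebra B" and h: "\<And>g. h g \<in> carrier B"
    and R: "\<And>x y. (x, y) \<in> R \<Longrightarrow> linear_ext B (word_value B h) x = linear_ext B (word_value B h) y"
  shows "presented_lift B h \<in> star_hom (presented_star_algebra R) B"
    and "presented_lift B h (presented_gen R g) = h g"
proof -
  interpret B: star_algebra B by fact
  interpret star_ideal "relation_ideal R" free_star_algebra by (rule star_ideal_relation_ideal)
  let ?e = "linear_ext B (word_value B h)"
  note e = free_eval_star_hom[where h=h, OF B h]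
  let ?K = "{x. ?e x = \<zero>\<^bsub>B\<^esub>}"
  note eh = star_homD[OF e(1), unfolded free_sel(1), simplified]
  note ez = linear_hom_zero[OF free.star_algebra_axioms B eh(1)]
  note eu = linear_hom_uminus[OF free.star_algebra_axioms B eh(1), unfolded free_sel(1), simplified]
  note em = linear_hom_minus[OF free.star_algebra_axioms B eh(1), unfolded free_sel(1), simplified]
  have K: "ideal ?K free_star_algebra"
  proof (intro idealI free.ring_ax)
    show "subgroup ?K (add_monoid free_star_algebra)"
      by (intro free.add.subgroupI)
        (auto simp: a_inv_def[symmetric] eh eu ez free_sel(1) intro!: exI[of _ "\<zero>\<^bsub>free_star_algebra\<^esub>"])
  qed (auto simp: eh free_sel(1))
  have I: "?e x = \<zero>\<^bsub>B\<^esub>" if "x \<in> relation_ideal R" for x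
  proof -
    have "relation_ideal R \<subseteq> ?K" unfolding relation_ideal_def Let_def
      by (rule free.genideal_minimal[OF K]) (auto simp: em eh R B.diff_eq_zero_iff[THEN iffD2])
    then show ?thesis using that by auto
  qed
  show "presented_lift B h \<in> star_hom (presented_star_algebra R) B"
    unfolding presented_lift_def[abs_def] presented_star_algebra_def by (rule lift_star_hom[OF B e(1) I])
  show "presented_lift B h (presented_gen R g) = h g"
    unfolding presented_lift_def presented_gen_def
    by (subst lift_coset[OF B eh(1) I]) (auto simp: e(2))
qed

lemma scale_minus1 [simp]: "Poly_Mapping.map ((*) (- 1 :: complex)) x = - x"
  by (intro poly_mapping_eqI) simp

lemma msa_diff_l: "(f - f') \<otimes>\<^bsub>monoid_star_algebra M s\<^esub> g
    = (f \<otimes>\<^bsub>monoid_star_algebra M s\<^esub> g) - (f' \<otimes>\<^bsub>monoid_star_algebra M s\<^esub> g)"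
  by (metis add_diff_cancel diff_add_cancel msa_add_l)

lemma msa_diff_r: "g \<otimes>\<^bsub>monoid_star_algebra M s\<^esub> (f - f')
    = (g \<otimes>\<^bsub>monoid_star_algebra M s\<^esub> f) - (g \<otimes>\<^bsub>monoid_star_algebra M s\<^esub> f')"
  by (metis add_diff_cancel diff_add_cancel msa_add_r)

lemma msa_star_diff: "(f - f')\<^sup>\<star>\<^bsub>monoid_star_algebra M s\<^esub>
    = f\<^sup>\<star>\<^bsub>monoid_star_algebra M s\<^esub> - f'\<^sup>\<star>\<^bsub>monoid_star_algebra M s\<^esub>"
  by (metis add_diff_cancel diff_add_cancel msa_star_add)

locale star_algebra_pair = A: star_algebra A + B: star_algebra B
  for A :: "'a star_algebra" and B :: "'b star_algebra"
begin

abbreviation "sAB \<equiv> (\<lambda>(x, y). (x\<^sup>\<star>\<^bsub>A\<^esub>, y\<^sup>\<star>\<^bsub>B\<^esub>))"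
abbreviation "F \<equiv> pair_star_algebra A B"
abbreviation "N \<equiv> tensor_null A B"
abbreviation "Rel \<equiv> bilinear_relators A B"

sublocale AB: star_monoid "A \<times>\<times> B" sAB
  by (intro star_monoid.intro star_monoid_axioms.intro DirProd_monoid A.monoid_axioms B.monoid_axioms)
     (auto simp: A.star_mult B.star_mult)

sublocale F: star_algebra F
  unfolding pair_star_algebra_def by (rule AB.msa_star_algebra)

lemmas F_sel = msa_sel[of "A \<times>\<times> B" sAB, folded pair_star_algebra_def]

lemma F_single:
  "Poly_Mapping.single (x, y) c \<otimes>\<^bsub>F\<^esub> Poly_Mapping.single (x', y') d
     = Poly_Mapping.single (x \<otimes>\<^bsub>A\<^esub> x', y \<otimes>\<^bsub>B\<^esub> y') (c * d)"
  "(Poly_Mapping.single (x, y) c)\<^sup>\<star>\<^bsub>F\<^esub> = Poly_Mapping.single (x\<^sup>\<star>\<^bsub>A\<^esub>, y\<^sup>\<star>\<^bsub>B\<^esub>) (cnj c)"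
  by (simp_all add: pair_star_algebra_def)

lemma single_in_F: "x \<in> carrier A \<Longrightarrow> y \<in> carrier B \<Longrightarrow> Poly_Mapping.single (x, y) c \<in> carrier F"
  by (simp add: F_sel keys_single_subset)

lemma F_add: "x \<in> carrier F \<Longrightarrow> y \<in> carrier F \<Longrightarrow> x + y \<in> carrier F"
  using F.add.m_closed[of x y] by (simp add: F_sel)

lemma F_scale: "x \<in> carrier F \<Longrightarrow> Poly_Mapping.map ((*) c) x \<in> carrier F"
  using F.smult_cl[of x c] by (simp add: F_sel)

lemma F_diff: "x \<in> carrier F \<Longrightarrow> y \<in> carrier F \<Longrightarrow> x - y \<in> carrier F"
  using F_add[of x "Poly_Mapping.map ((*) (-1)) y"] F_scale[of y "-1"] by simp

lemma F_0: "0 \<in> carrier F"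
  by (simp add: F_sel)

lemma Rel_cases [consumes 1, case_names add_l add_r smult_l smult_r]:
  assumes "r \<in> Rel"
    and "\<And>x x' y. r = Poly_Mapping.single (x \<oplus>\<^bsub>A\<^esub> x', y) 1 - (Poly_Mapping.single (x, y) 1 + Poly_Mapping.single (x', y) 1) \<Longrightarrow>
        x \<in> carrier A \<Longrightarrow> x' \<in> carrier A \<Longrightarrow> y \<in> carrier B \<Longrightarrow> P"
    and "\<And>x y y'. r = Poly_Mapping.single (x, y \<oplus>\<^bsub>B\<^esub> y') 1 - (Poly_Mapping.single (x, y) 1 + Poly_Mapping.single (x, y') 1) \<Longrightarrow>
        x \<in> carrier A \<Longrightarrow> y \<in> carrier B \<Longrightarrow> y' \<in> carrier B \<Longrightarrow> P"
    and "\<And>c x y. r = Poly_Mapping.single (c \<odot>\<^bsub>A\<^esub> x, y) 1 - Poly_Mapping.single (x, y) c \<Longrightarrow>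
        x \<in> carrier A \<Longrightarrow> y \<in> carrier B \<Longrightarrow> P"
    and "\<And>c x y. r = Poly_Mapping.single (x, c \<odot>\<^bsub>B\<^esub> y) 1 - Poly_Mapping.single (x, y) c \<Longrightarrow>
        x \<in> carrier A \<Longrightarrow> y \<in> carrier B \<Longrightarrow> P"
  shows P
  using assms unfolding bilinear_relators_def by blast

lemma Rel_in_N:
  "x \<in> carrier A \<Longrightarrow> x' \<in> carrier A \<Longrightarrow> y \<in> carrier B \<Longrightarrow>
    Poly_Mapping.single (x \<oplus>\<^bsub>A\<^esub> x', y) c - (Poly_Mapping.single (x, y) c + Poly_Mapping.single (x', y) c) \<in> N"
  "x \<in> carrier A \<Longrightarrow> y \<in> carrier B \<Longrightarrow> y' \<in> carrier B \<Longrightarrow>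
    Poly_Mapping.single (x, y \<oplus>\<^bsub>B\<^esub> y') c - (Poly_Mapping.single (x, y) c + Poly_Mapping.single (x, y') c) \<in> N"
  "x \<in> carrier A \<Longrightarrow> y \<in> carrier B \<Longrightarrow>
    Poly_Mapping.single (d \<odot>\<^bsub>A\<^esub> x, y) c - Poly_Mapping.single (x, y) (c * d) \<in> N"
  "x \<in> carrier A \<Longrightarrow> y \<in> carrier B \<Longrightarrow>
    Poly_Mapping.single (x, d \<odot>\<^bsub>B\<^esub> y) c - Poly_Mapping.single (x, y) (c * d) \<in> N"
proof -
  have *: "Poly_Mapping.map ((*) c) r \<in> N" if "r \<in> Rel" for r
    unfolding tensor_null_def by (intro pm.span_scale pm.span_base that)
  have s: "Poly_Mapping.map ((*) c) (Poly_Mapping.single k a - b)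
     = Poly_Mapping.single k (c * a) - Poly_Mapping.map ((*) c) b" for k a and b :: "'a \<times> 'b \<Rightarrow>\<^sub>0 complex"
    by (simp add: pm.scale_right_diff_distrib)
  show "x \<in> carrier A \<Longrightarrow> x' \<in> carrier A \<Longrightarrow> y \<in> carrier B \<Longrightarrow>
    Poly_Mapping.single (x \<oplus>\<^bsub>A\<^esub> x', y) c - (Poly_Mapping.single (x, y) c + Poly_Mapping.single (x', y) c) \<in> N"
    using *[of "Poly_Mapping.single (x \<oplus>\<^bsub>A\<^esub> x', y) 1 - (Poly_Mapping.single (x, y) 1 + Poly_Mapping.single (x', y) 1)"]
    unfolding s scale_add scale_single by (fastforce simp: bilinear_relators_def)
  show "x \<in> carrier A \<Longrightarrow> y \<in> carrier B \<Longrightarrow> y' \<in> carrier B \<Longrightarrow>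
    Poly_Mapping.single (x, y \<oplus>\<^bsub>B\<^esub> y') c - (Poly_Mapping.single (x, y) c + Poly_Mapping.single (x, y') c) \<in> N"
    using *[of "Poly_Mapping.single (x, y \<oplus>\<^bsub>B\<^esub> y') 1 - (Poly_Mapping.single (x, y) 1 + Poly_Mapping.single (x, y') 1)"]
    unfolding s scale_add scale_single by (fastforce simp: bilinear_relators_def)
  show "x \<in> carrier A \<Longrightarrow> y \<in> carrier B \<Longrightarrow>
    Poly_Mapping.single (d \<odot>\<^bsub>A\<^esub> x, y) c - Poly_Mapping.single (x, y) (c * d) \<in> N"
    using *[of "Poly_Mapping.single (d \<odot>\<^bsub>A\<^esub> x, y) 1 - Poly_Mapping.single (x, y) d"]
    unfolding s scale_single by (fastforce simp: bilinear_relators_def)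
  show "x \<in> carrier A \<Longrightarrow> y \<in> carrier B \<Longrightarrow>
    Poly_Mapping.single (x, d \<odot>\<^bsub>B\<^esub> y) c - Poly_Mapping.single (x, y) (c * d) \<in> N"
    using *[of "Poly_Mapping.single (x, d \<odot>\<^bsub>B\<^esub> y) 1 - Poly_Mapping.single (x, y) d"]
    unfolding s scale_single by (fastforce simp: bilinear_relators_def)
qed

lemma subspace_F: "pm.subspace (carrier F)"
  by (intro pm.subspaceI) (auto simp: F_add F_scale F_0)

lemma N_subset: "N \<subseteq> carrier F"
proof -
  have "Rel \<subseteq> carrier F"
  proof
    fix r assume "r \<in> Rel"
    then show "r \<in> carrier F"
      by (cases rule: Rel_cases) (auto intro!: F_diff F_add single_in_F)
  qed
  then show ?thesis unfolding tensor_null_def by (rule pm.span_minimal) (rule subspace_F)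
qed

lemma N_add: "x \<in> N \<Longrightarrow> y \<in> N \<Longrightarrow> x + y \<in> N"
  and N_scale: "x \<in> N \<Longrightarrow> Poly_Mapping.map ((*) c) x \<in> N"
  and N_0: "0 \<in> N"
  unfolding tensor_null_def by (auto intro: pm.span_add pm.span_scale pm.span_zero)

lemma N_induct [consumes 1, case_names zero add scale rel]:
  assumes "x \<in> N" "P 0" "\<And>x y. x \<in> N \<Longrightarrow> y \<in> N \<Longrightarrow> P x \<Longrightarrow> P y \<Longrightarrow> P (x + y)"
    "\<And>c x. x \<in> N \<Longrightarrow> P x \<Longrightarrow> P (Poly_Mapping.map ((*) c) x)" "\<And>r. r \<in> Rel \<Longrightarrow> P r"
  shows "P x"
proof -
  have "N \<subseteq> {x \<in> N. P x}"
    unfolding tensor_null_def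
    by (rule pm.span_minimal)
      (use assms in \<open>auto simp: pm.subspace_def tensor_null_def pm.span_base intro: pm.span_add pm.span_scale pm.span_zero\<close>)
  then show ?thesis using assms(1) by auto
qed

lemma N_mult_l: assumes "x \<in> N" "y \<in> carrier F" shows "y \<otimes>\<^bsub>F\<^esub> x \<in> N"
  using assms(1)
proof (induction rule: N_induct)
  case (rel r)
  note r = rel
  have "Poly_Mapping.keys y \<subseteq> carrier (A \<times>\<times> B)" using assms(2) by (simp add: F_sel)
  then show "y \<otimes>\<^bsub>F\<^esub> r \<in> N"
  proof (induction rule: pm_induct)
    case (single m c)
    obtain a b where m: "m = (a, b)" by force
    show ?case using r single
      by (cases rule: Rel_cases)
        (auto simp: pair_star_algebra_def msa_diff_r msa_add_r m A.r_distr B.r_distr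
          A.smult_mult_right B.smult_mult_right intro!: Rel_in_N)
  qed (auto simp: pair_star_algebra_def msa_add_l N_0 N_add)
qed (auto simp: pair_star_algebra_def msa_add_r msa_scale_r N_0 N_add N_scale)

lemma N_mult_r: assumes "x \<in> N" "y \<in> carrier F" shows "x \<otimes>\<^bsub>F\<^esub> y \<in> N"
  using assms(1)
proof (induction rule: N_induct)
  case (rel r)
  note r = rel
  have "Poly_Mapping.keys y \<subseteq> carrier (A \<times>\<times> B)" using assms(2) by (simp add: F_sel)
  then show "r \<otimes>\<^bsub>F\<^esub> y \<in> N"
  proof (induction rule: pm_induct)
    case (single m c)
    obtain a b where m: "m = (a, b)" by force
    show ?case using r single
    proof (cases rule: Rel_cases)
      case (smult_l d x y)
      then show ?thesis using single Rel_in_N(3)[of "x \<otimes>\<^bsub>A\<^esub> a" "y \<otimes>\<^bsub>B\<^esub> b" d c]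
        by (simp add: pair_star_algebra_def msa_diff_l m A.smult_mult_left mult.commute)
    next
      case (smult_r d x y)
      then show ?thesis using single Rel_in_N(4)[of "x \<otimes>\<^bsub>A\<^esub> a" "y \<otimes>\<^bsub>B\<^esub> b" d c]
        by (simp add: pair_star_algebra_def msa_diff_l m B.smult_mult_left mult.commute)
    qed (auto simp: pair_star_algebra_def msa_diff_l msa_add_l m A.l_distr B.l_distr intro!: Rel_in_N)
  qed (auto simp: pair_star_algebra_def msa_add_r N_0 N_add)
qed (auto simp: pair_star_algebra_def msa_add_l msa_scale_l N_0 N_add N_scale)

lemma N_star: assumes "x \<in> N" shows "x\<^sup>\<star>\<^bsub>F\<^esub> \<in> N"
  using assms(1)
proof (induction rule: N_induct)
  case (rel r)
  then show "r\<^sup>\<star>\<^bsub>F\<^esub> \<in> N"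
  proof (cases rule: Rel_cases)
    case (smult_l d x y)
    then show ?thesis using Rel_in_N(3)[of "x\<^sup>\<star>\<^bsub>A\<^esub>" "y\<^sup>\<star>\<^bsub>B\<^esub>" "cnj d" 1]
      by (simp add: pair_star_algebra_def msa_star_diff A.star_smult)
  next
    case (smult_r d x y)
    then show ?thesis using Rel_in_N(4)[of "x\<^sup>\<star>\<^bsub>A\<^esub>" "y\<^sup>\<star>\<^bsub>B\<^esub>" "cnj d" 1]
      by (simp add: pair_star_algebra_def msa_star_diff B.star_smult)
  qed (auto simp: pair_star_algebra_def msa_star_diff msa_star_add A.star_add B.star_add intro!: Rel_in_N)
qed (auto simp: pair_star_algebra_def msa_star_add msa_star_scale N_0 N_add N_scale)

sublocale N: star_ideal N F
proof (intro star_ideal.intro star_ideal_axioms.intro F.star_algebra_axioms idealI F.ring_ax N_star)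
  have *: "\<ominus>\<^bsub>F\<^esub> a \<in> N" if "a \<in> N" for a
    using F.uminus_conv[of a] N_scale[OF that, of "-1"] that N_subset by (auto simp: F_sel)
  show "subgroup N (add_monoid F)"
    by (intro F.add.subgroupI) (use N_subset N_0 * in \<open>auto simp: a_inv_def[symmetric] F_sel(4) N_add\<close>)
qed (use N_mult_l N_mult_r in auto)

abbreviation "T \<equiv> tensor A B"
abbreviation "pt \<equiv> pure_tensor A B"

sublocale T: star_algebra T
  unfolding tensor_def by (rule N.star_algebra_Q)

lemma pt_closed [simp, intro]: "x \<in> carrier A \<Longrightarrow> y \<in> carrier B \<Longrightarrow> pt x y \<in> carrier T"
  by (auto simp: tensor_def pure_tensor_def N.Q_sel single_in_F)

lemma coset_eqI: "x \<in> carrier F \<Longrightarrow> y \<in> carrier F \<Longrightarrow> x - y \<in> N \<Longrightarrow> N +>\<^bsub>F\<^esub> x = N +>\<^bsub>F\<^esub> y"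
proof -
  assume *: "x \<in> carrier F" "y \<in> carrier F" "x - y \<in> N"
  have "x \<ominus>\<^bsub>F\<^esub> y = x - y"
    using * by (simp add: a_minus_def F.uminus_conv F_sel)
  then show ?thesis using * by (subst N.coset_eq_iff) auto
qed

lemma pt_add_l: "x \<in> carrier A \<Longrightarrow> x' \<in> carrier A \<Longrightarrow> y \<in> carrier B \<Longrightarrow> pt (x \<oplus>\<^bsub>A\<^esub> x') y = pt x y \<oplus>\<^bsub>T\<^esub> pt x' y"
  unfolding pure_tensor_def tensor_def
  by (simp add: N.Q_sel(4) single_in_F F_sel(4) coset_eqI F_add Rel_in_N)

lemma pt_add_r: "x \<in> carrier A \<Longrightarrow> y \<in> carrier B \<Longrightarrow> y' \<in> carrier B \<Longrightarrow> pt x (y \<oplus>\<^bsub>B\<^esub> y') = pt x y \<oplus>\<^bsub>T\<^esub> pt x y'"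
  unfolding pure_tensor_def tensor_def
  by (simp add: N.Q_sel(4) single_in_F F_sel(4) coset_eqI F_add Rel_in_N)

lemma pt_smult_l: "x \<in> carrier A \<Longrightarrow> y \<in> carrier B \<Longrightarrow> pt (c \<odot>\<^bsub>A\<^esub> x) y = c \<odot>\<^bsub>T\<^esub> pt x y"
  unfolding pure_tensor_def tensor_def using Rel_in_N(3)[of x y c 1]
  by (simp add: N.Q_sel(6) single_in_F F_sel(5) coset_eqI)

lemma pt_smult_r: "x \<in> carrier A \<Longrightarrow> y \<in> carrier B \<Longrightarrow> pt x (c \<odot>\<^bsub>B\<^esub> y) = c \<odot>\<^bsub>T\<^esub> pt x y"
  unfolding pure_tensor_def tensor_def using Rel_in_N(4)[of x y c 1]
  by (simp add: N.Q_sel(6) single_in_F F_sel(5) coset_eqI)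

lemma pt_mult: "x \<in> carrier A \<Longrightarrow> y \<in> carrier B \<Longrightarrow> x' \<in> carrier A \<Longrightarrow> y' \<in> carrier B \<Longrightarrow>
    pt x y \<otimes>\<^bsub>T\<^esub> pt x' y' = pt (x \<otimes>\<^bsub>A\<^esub> x') (y \<otimes>\<^bsub>B\<^esub> y')"
  unfolding pure_tensor_def tensor_def by (subst N.Q_sel) (auto intro!: single_in_F simp: F_single)

lemma pt_star: "x \<in> carrier A \<Longrightarrow> y \<in> carrier B \<Longrightarrow> (pt x y)\<^sup>\<star>\<^bsub>T\<^esub> = pt (x\<^sup>\<star>\<^bsub>A\<^esub>) (y\<^sup>\<star>\<^bsub>B\<^esub>)"
  unfolding pure_tensor_def tensor_def by (subst N.Q_sel) (auto intro!: single_in_F simp: F_single)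

lemma pt_one: "\<one>\<^bsub>T\<^esub> = pt \<one>\<^bsub>A\<^esub> \<one>\<^bsub>B\<^esub>"
  unfolding pure_tensor_def tensor_def by (subst N.Q_sel) (auto simp: F_sel)

lemma tensor_induct [consumes 1, case_names pure add]:
  assumes "t \<in> carrier T" "\<And>x y. x \<in> carrier A \<Longrightarrow> y \<in> carrier B \<Longrightarrow> P (pt x y)"
    "\<And>t u. t \<in> carrier T \<Longrightarrow> u \<in> carrier T \<Longrightarrow> P t \<Longrightarrow> P u \<Longrightarrow> P (t \<oplus>\<^bsub>T\<^esub> u)"
  shows "P t"
proof -
  obtain f where f: "f \<in> carrier F" "t = N +>\<^bsub>F\<^esub> f"
    using assms(1) by (auto simp: tensor_def N.Q_sel)
  have "Poly_Mapping.keys f \<subseteq> carrier A \<times> carrier B" using f by (simp add: F_sel)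
  then have "P (N +>\<^bsub>F\<^esub> f)"
  proof (induction rule: pm_induct)
    case zero
    have "P (pt (0 \<odot>\<^bsub>A\<^esub> \<one>\<^bsub>A\<^esub>) \<one>\<^bsub>B\<^esub>)" by (intro assms(2)) auto
    also have "pt (0 \<odot>\<^bsub>A\<^esub> \<one>\<^bsub>A\<^esub>) \<one>\<^bsub>B\<^esub> = \<zero>\<^bsub>T\<^esub>" by (subst pt_smult_l) auto
    finally show ?case by (simp add: tensor_def N.Q_sel F_sel)
  next
    case (add f g)
    then have "N +>\<^bsub>F\<^esub> (f + g) = (N +>\<^bsub>F\<^esub> f) \<oplus>\<^bsub>T\<^esub> (N +>\<^bsub>F\<^esub> g)"
      unfolding tensor_def by (subst N.Q_sel) (auto simp: F_sel)
    moreover have "N +>\<^bsub>F\<^esub> f \<in> carrier T" "N +>\<^bsub>F\<^esub> g \<in> carrier T"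
      using add by (auto simp: tensor_def N.Q_sel F_sel)
    ultimately show ?case using add(3,4) assms(3) by simp
  next
    case (single m c)
    obtain x y where m: "m = (x, y)" "x \<in> carrier A" "y \<in> carrier B" using single by auto
    have "P (pt (c \<odot>\<^bsub>A\<^esub> x) y)" using m by (intro assms(2)) auto
    also have "pt (c \<odot>\<^bsub>A\<^esub> x) y = N +>\<^bsub>F\<^esub> Poly_Mapping.single m c"
      unfolding pure_tensor_def using Rel_in_N(3)[of x y c 1] m
      by (simp add: coset_eqI single_in_F)
    finally show ?case .
  qed
  then show ?thesis using f by simp
qed

lemma tensor_linear_eqI:
  assumes "f \<in> linear_hom T C" "g \<in> linear_hom T C"
    "\<And>x y. x \<in> carrier A \<Longrightarrow> y \<in> carrier B \<Longrightarrow> f (pt x y) = g (pt x y)" "t \<in> carrier T"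
  shows "f t = g t"
  using assms(4) by (induction rule: tensor_induct)
    (auto simp: assms(3) linear_homD(2)[OF assms(1)] linear_homD(2)[OF assms(2)])

end

lemma star_algebra_tensor: "star_algebra A \<Longrightarrow> star_algebra B \<Longrightarrow> star_algebra (tensor A B)"
proof -
  assume "star_algebra A" "star_algebra B"
  then interpret star_algebra_pair A B by (rule star_algebra_pair.intro)
  show ?thesis by (rule T.star_algebra_axioms)
qed

definition bilinear :: "'a star_algebra \<Rightarrow> 'b star_algebra \<Rightarrow> 'c star_algebra \<Rightarrow> ('a \<Rightarrow> 'b \<Rightarrow> 'c) \<Rightarrow> bool" where
  "bilinear A B C g \<longleftrightarrow> (\<forall>y\<in>carrier B. (\<lambda>x. g x y) \<in> linear_hom A C) \<and> (\<forall>x\<in>carrier A. g x \<in> linear_hom B C)"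

lemma (in star_algebra_pair)
  assumes C: "star_algebra C" and g: "bilinear A B C g"
  shows tensor_lift_linear: "tensor_lift C g \<in> linear_hom T C"
    and tensor_lift_pt: "x \<in> carrier A \<Longrightarrow> y \<in> carrier B \<Longrightarrow> tensor_lift C g (pt x y) = g x y"
proof -
  interpret C: star_algebra C by fact
  let ?g = "\<lambda>(x, y). g x y"
  have gc [simp]: "g x y \<in> carrier C" if "x \<in> carrier A" "y \<in> carrier B" for x y
    using g that by (auto simp: bilinear_def linear_hom_def)
  have gl: "g (x \<oplus>\<^bsub>A\<^esub> x') y = g x y \<oplus>\<^bsub>C\<^esub> g x' y" "g (c \<odot>\<^bsub>A\<^esub> x) y = c \<odot>\<^bsub>C\<^esub> g x y"
    if "x \<in> carrier A" "x' \<in> carrier A" "y \<in> carrier B" for x x' y c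
    using g that by (auto simp: bilinear_def linear_hom_def)
  have gr: "g x (y \<oplus>\<^bsub>B\<^esub> y') = g x y \<oplus>\<^bsub>C\<^esub> g x y'" "g x (c \<odot>\<^bsub>B\<^esub> y) = c \<odot>\<^bsub>C\<^esub> g x y"
    if "x \<in> carrier A" "y \<in> carrier B" "y' \<in> carrier B" for x y y' c
    using g that by (auto simp: bilinear_def linear_hom_def)
  have lin: "linear_ext C ?g \<in> linear_hom F C"
    unfolding pair_star_algebra_def by (rule AB.linear_ext_msa) (auto simp: C)
  note l = linear_homD[OF lin]
  have le_add: "linear_ext C ?g (u + v) = linear_ext C ?g u \<oplus>\<^bsub>C\<^esub> linear_ext C ?g v"
    if "u \<in> carrier F" "v \<in> carrier F" for u v
    using l(2)[OF that] by (simp add: F_sel)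
  have diff: "linear_ext C ?g (u - v) = linear_ext C ?g u \<ominus>\<^bsub>C\<^esub> linear_ext C ?g v"
    if "u \<in> carrier F" "v \<in> carrier F" for u v
  proof -
    have "u \<ominus>\<^bsub>F\<^esub> v = u - v"
      using that by (simp add: a_minus_def F.uminus_conv F_sel)
    then show ?thesis using linear_hom_minus[OF F.star_algebra_axioms C lin that] by simp
  qed
  have z: "linear_ext C ?g u = \<zero>\<^bsub>C\<^esub>" if "u \<in> N" for u
    using that
  proof (induction rule: N_induct)
    case (add x y)
    then show ?case using N_subset by (subst le_add) auto
  next
    case (scale c x)
    then show ?case using l(3)[of x c] N_subset by (auto simp: F_sel)
  next
    case (rel r)
    then show ?case
    proof (cases rule: Rel_cases)
      case (add_l x x' y)
      show ?thesis unfolding add_l(1)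
        using add_l(2-) by (subst diff, auto intro!: single_in_F F_add)
           (subst le_add, auto intro!: single_in_F simp: gl C.diff_eq_zero_iff)
    next
      case (add_r x y y')
      show ?thesis unfolding add_r(1)
        using add_r(2-) by (subst diff, auto intro!: single_in_F F_add)
           (subst le_add, auto intro!: single_in_F simp: gr C.diff_eq_zero_iff)
    next
      case (smult_l c x y)
      show ?thesis unfolding smult_l(1)
        using smult_l(2-) by (subst diff) (auto intro!: single_in_F simp: gl C.diff_eq_zero_iff)
    next
      case (smult_r c x y)
      show ?thesis unfolding smult_r(1)
        using smult_r(2-) by (subst diff) (auto intro!: single_in_F simp: gr C.diff_eq_zero_iff)
    qed
  qed simp
  show "tensor_lift C g \<in> linear_hom T C"
    unfolding tensor_lift_def[abs_def] tensor_def by (rule N.lift_linear_hom[OF C lin z])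
  show "tensor_lift C g (pt x y) = g x y" if "x \<in> carrier A" "y \<in> carrier B"
    unfolding tensor_lift_def pure_tensor_def
    using that by (subst N.lift_coset[OF C lin z]) (auto intro!: single_in_F)
qed

lemma bilinearI:
  assumes "\<And>x y. x \<in> carrier A \<Longrightarrow> y \<in> carrier B \<Longrightarrow> g x y \<in> carrier C"
    "\<And>x x' y. x \<in> carrier A \<Longrightarrow> x' \<in> carrier A \<Longrightarrow> y \<in> carrier B \<Longrightarrow> g (x \<oplus>\<^bsub>A\<^esub> x') y = g x y \<oplus>\<^bsub>C\<^esub> g x' y"
    "\<And>c x y. x \<in> carrier A \<Longrightarrow> y \<in> carrier B \<Longrightarrow> g (c \<odot>\<^bsub>A\<^esub> x) y = c \<odot>\<^bsub>C\<^esub> g x y"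
    "\<And>x y y'. x \<in> carrier A \<Longrightarrow> y \<in> carrier B \<Longrightarrow> y' \<in> carrier B \<Longrightarrow> g x (y \<oplus>\<^bsub>B\<^esub> y') = g x y \<oplus>\<^bsub>C\<^esub> g x y'"
    "\<And>c x y. x \<in> carrier A \<Longrightarrow> y \<in> carrier B \<Longrightarrow> g x (c \<odot>\<^bsub>B\<^esub> y) = c \<odot>\<^bsub>C\<^esub> g x y"
  shows "bilinear A B C g"
  using assms by (auto simp: bilinear_def intro!: linear_homI)

lemma (in star_algebra_pair) tensor_lift_star_hom:
  assumes C: "star_algebra C" and g: "bilinear A B C g"
    and one: "g \<one>\<^bsub>A\<^esub> \<one>\<^bsub>B\<^esub> = \<one>\<^bsub>C\<^esub>"
    and mult: "\<And>x y x' y'. x \<in> carrier A \<Longrightarrow> y \<in> carrier B \<Longrightarrow> x' \<in> carrier A \<Longrightarrow> y' \<in> carrier B \<Longrightarrow>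
      g (x \<otimes>\<^bsub>A\<^esub> x') (y \<otimes>\<^bsub>B\<^esub> y') = g x y \<otimes>\<^bsub>C\<^esub> g x' y'"
    and star: "\<And>x y. x \<in> carrier A \<Longrightarrow> y \<in> carrier B \<Longrightarrow> g (x\<^sup>\<star>\<^bsub>A\<^esub>) (y\<^sup>\<star>\<^bsub>B\<^esub>) = (g x y)\<^sup>\<star>\<^bsub>C\<^esub>"
  shows "tensor_lift C g \<in> star_hom T C"
proof (rule star_homI)
  interpret C: star_algebra C by fact
  note lp = tensor_lift_pt[OF C g]
  have gc [simp]: "g x y \<in> carrier C" if "x \<in> carrier A" "y \<in> carrier B" for x y
    using g that by (auto simp: bilinear_def linear_hom_def)
  show lin: "tensor_lift C g \<in> linear_hom T C" by (rule tensor_lift_linear[OF C g])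
  note l = linear_homD[OF lin]
  show "tensor_lift C g \<one>\<^bsub>T\<^esub> = \<one>\<^bsub>C\<^esub>" by (simp add: pt_one lp one)
  fix t assume t: "t \<in> carrier T"
  show "tensor_lift C g (t\<^sup>\<star>\<^bsub>T\<^esub>) = (tensor_lift C g t)\<^sup>\<star>\<^bsub>C\<^esub>"
    using t by (induction rule: tensor_induct) (auto simp: pt_star lp star T.star_add C.star_add l)
  fix u assume u: "u \<in> carrier T"
  show "tensor_lift C g (t \<otimes>\<^bsub>T\<^esub> u) = tensor_lift C g t \<otimes>\<^bsub>C\<^esub> tensor_lift C g u"
    using t
  proof (induction rule: tensor_induct)
    case (pure x y)
    show ?case using u
      by (induction rule: tensor_induct) (auto simp: pt_mult lp mult pure T.r_distr C.r_distr l)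
  qed (use u in \<open>auto simp: T.l_distr C.l_distr l\<close>)
qed

lemma
  assumes A: "star_algebra A" and B: "star_algebra B" and C: "star_algebra C" and D: "star_algebra D"
    and f: "f \<in> star_hom A C" and g: "g \<in> star_hom B D"
  shows tensor_map_star_hom: "tensor_map C D f g \<in> star_hom (tensor A B) (tensor C D)"
    and tensor_map_pt: "x \<in> carrier A \<Longrightarrow> y \<in> carrier B \<Longrightarrow>
      tensor_map C D f g (pure_tensor A B x y) = pure_tensor C D (f x) (g y)"
proof -
  interpret AB: star_algebra_pair A B by (intro star_algebra_pair.intro A B)
  interpret CD: star_algebra_pair C D by (intro star_algebra_pair.intro C D)
  note ff = star_homD[OF f] and gg = star_homD[OF g]
  have bil: "bilinear A B (tensor C D) (\<lambda>x y. pure_tensor C D (f x) (g y))"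
    by (rule bilinearI) (auto simp: ff gg CD.pt_add_l CD.pt_add_r CD.pt_smult_l CD.pt_smult_r)
  show "tensor_map C D f g \<in> star_hom (tensor A B) (tensor C D)"
    unfolding tensor_map_def
    by (rule AB.tensor_lift_star_hom[OF CD.T.star_algebra_axioms bil])
       (auto simp: ff gg CD.pt_one CD.pt_mult CD.pt_star)
  show "x \<in> carrier A \<Longrightarrow> y \<in> carrier B \<Longrightarrow>
      tensor_map C D f g (pure_tensor A B x y) = pure_tensor C D (f x) (g y)"
    unfolding tensor_map_def by (rule AB.tensor_lift_pt[OF CD.T.star_algebra_axioms bil])
qed

lemma
  assumes A: "star_algebra A" and B: "star_algebra B" and C: "star_algebra C"
  shows tensor_assoc_star_hom: "tensor_assoc A B C \<in> star_hom (tensor (tensor A B) C) (tensor A (tensor B C))"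
    and tensor_assoc_pt: "x \<in> carrier A \<Longrightarrow> y \<in> carrier B \<Longrightarrow> z \<in> carrier C \<Longrightarrow>
      tensor_assoc A B C (pure_tensor (tensor A B) C (pure_tensor A B x y) z)
        = pure_tensor A (tensor B C) x (pure_tensor B C y z)"
proof -
  interpret AB: star_algebra_pair A B by (intro star_algebra_pair.intro A B)
  interpret BC: star_algebra_pair B C by (intro star_algebra_pair.intro B C)
  interpret L: star_algebra_pair "tensor A B" C by (intro star_algebra_pair.intro AB.T.star_algebra_axioms C)
  interpret R: star_algebra_pair A "tensor B C" by (intro star_algebra_pair.intro BC.T.star_algebra_axioms A)
  let ?T = "tensor A (tensor B C)"
  let ?g = "\<lambda>z x y. pure_tensor A (tensor B C) x (pure_tensor B C y z)"
  let ?h = "\<lambda>t z. tensor_lift ?T (?g z) t"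
  note Tax = R.T.star_algebra_axioms
  have bil1: "bilinear A B ?T (?g z)" if "z \<in> carrier C" for z
    using that by (intro bilinearI)
      (auto simp: BC.pt_add_l BC.pt_add_r BC.pt_smult_l BC.pt_smult_r R.pt_add_l R.pt_add_r R.pt_smult_l R.pt_smult_r)
  note lin1 = AB.tensor_lift_linear[OF Tax bil1] and pt1 = AB.tensor_lift_pt[OF Tax bil1]
  note l1 = linear_homD[OF lin1]
  have bil2: "bilinear (tensor A B) C ?T ?h"
  proof (rule bilinearI)
    fix t z z' assume t: "t \<in> carrier (tensor A B)" and z: "z \<in> carrier C" "z' \<in> carrier C"
    have "z \<oplus>\<^bsub>C\<^esub> z' \<in> carrier C" using z by simp
    note lz = linear_homD[OF lin1[OF this]] pt1[OF this]
    show "?h t (z \<oplus>\<^bsub>C\<^esub> z') = ?h t z \<oplus>\<^bsub>?T\<^esub> ?h t z'"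
      using t by (induction rule: AB.tensor_induct)
        (use z in \<open>auto simp: lz pt1 BC.pt_add_r R.pt_add_r l1 R.T.add.m_ac\<close>)
  next
    fix t c z assume t: "t \<in> carrier (tensor A B)" and z: "z \<in> carrier C"
    have "c \<odot>\<^bsub>C\<^esub> z \<in> carrier C" using z by simp
    note lz = linear_homD[OF lin1[OF this]] pt1[OF this]
    show "?h t (c \<odot>\<^bsub>C\<^esub> z) = c \<odot>\<^bsub>?T\<^esub> ?h t z"
      using t by (induction rule: AB.tensor_induct)
        (use z in \<open>auto simp: lz pt1 BC.pt_smult_r R.pt_smult_r l1 R.T.smult_add_r\<close>)
  qed (use l1 in auto)
  note pt2 = L.tensor_lift_pt[OF Tax bil2]
  have hc: "t \<in> carrier (tensor A B) \<Longrightarrow> z \<in> carrier C \<Longrightarrow> ?h t z \<in> carrier ?T" for t z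
    using l1 by auto
  show "tensor_assoc A B C \<in> star_hom (tensor (tensor A B) C) ?T"
    unfolding tensor_assoc_def
  proof (rule L.tensor_lift_star_hom[OF Tax bil2])
    show "?h \<one>\<^bsub>tensor A B\<^esub> \<one>\<^bsub>C\<^esub> = \<one>\<^bsub>?T\<^esub>"
      by (simp add: AB.pt_one pt1 R.pt_one BC.pt_one)
  next
    fix t z assume t: "t \<in> carrier (tensor A B)" and z: "z \<in> carrier C"
    have "z\<^sup>\<star>\<^bsub>C\<^esub> \<in> carrier C" using z by simp
    note lz = linear_homD[OF lin1[OF this]] pt1[OF this]
    show "?h (t\<^sup>\<star>\<^bsub>tensor A B\<^esub>) (z\<^sup>\<star>\<^bsub>C\<^esub>) = (?h t z)\<^sup>\<star>\<^bsub>?T\<^esub>"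
      using t by (induction rule: AB.tensor_induct)
        (use z in \<open>auto simp: AB.pt_star lz pt1 BC.pt_star R.pt_star l1 AB.T.star_add R.T.star_add\<close>)
  next
    fix t z t' z' assume t: "t \<in> carrier (tensor A B)" and z: "z \<in> carrier C"
      and t': "t' \<in> carrier (tensor A B)" and z': "z' \<in> carrier C"
    have "z \<otimes>\<^bsub>C\<^esub> z' \<in> carrier C" using z z' by simp
    note lz = linear_homD[OF lin1[OF this]] pt1[OF this]
    show "?h (t \<otimes>\<^bsub>tensor A B\<^esub> t') (z \<otimes>\<^bsub>C\<^esub> z') = ?h t z \<otimes>\<^bsub>?T\<^esub> ?h t' z'"
      using t
    proof (induction rule: AB.tensor_induct)
      case (pure x y)
      show ?case using t'
      proof (induction rule: AB.tensor_induct)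
        case (pure x' y')
        then show ?case using z z' \<open>x \<in> carrier A\<close> \<open>y \<in> carrier B\<close>
          by (simp add: AB.pt_mult lz pt1 BC.pt_mult R.pt_mult)
      next
        case (add t u)
        then show ?case using z z' \<open>x \<in> carrier A\<close> \<open>y \<in> carrier B\<close>
          by (simp add: AB.T.r_distr R.T.r_distr lz l1)
      qed
    next
      case (add t u)
      then show ?case using z z' t' by (simp add: AB.T.l_distr R.T.l_distr lz l1)
    qed
  qed
  show "tensor_assoc A B C (pure_tensor (tensor A B) C (pure_tensor A B x y) z)
        = pure_tensor A (tensor B C) x (pure_tensor B C y z)"
    if "x \<in> carrier A" "y \<in> carrier B" "z \<in> carrier C"
    unfolding tensor_assoc_def using that by (simp add: pt2 pt1)
qed

lemma
  assumes A: "star_algebra A" and H: "star_algebra H" and \<rho>: "\<rho> \<in> linear_hom A (tensor A H)"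
  shows lifted_canonical_map_linear: "lifted_canonical_map A H \<rho> \<in> linear_hom (tensor A A) (tensor A H)"
    and lifted_canonical_map_pt: "a \<in> carrier A \<Longrightarrow> a' \<in> carrier A \<Longrightarrow>
      lifted_canonical_map A H \<rho> (pure_tensor A A a a') = left_action A H a (\<rho> a')"
proof -
  interpret AA: star_algebra_pair A A by (intro star_algebra_pair.intro A)
  interpret AH: star_algebra_pair A H by (intro star_algebra_pair.intro A H)
  note r = linear_homD[OF \<rho>]
  have bil: "bilinear A A (tensor A H) (\<lambda>a a'. left_action A H a (\<rho> a'))"
    unfolding left_action_def
    by (rule bilinearI) (auto simp: r AH.pt_add_l AH.pt_smult_l AH.T.l_distr AH.T.r_distr
        AH.T.smult_mult_left AH.T.smult_mult_right)
  show "lifted_canonical_map A H \<rho> \<in> linear_hom (tensor A A) (tensor A H)"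
    unfolding lifted_canonical_map_def by (rule AA.tensor_lift_linear[OF AH.T.star_algebra_axioms bil])
  show "a \<in> carrier A \<Longrightarrow> a' \<in> carrier A \<Longrightarrow>
      lifted_canonical_map A H \<rho> (pure_tensor A A a a') = left_action A H a (\<rho> a')"
    unfolding lifted_canonical_map_def by (rule AA.tensor_lift_pt[OF AH.T.star_algebra_axioms bil])
qed

lemma left_module_canonical_cokernel:
  assumes A: "star_algebra A" and H: "star_algebra H" and \<rho>: "\<rho> \<in> linear_hom A (tensor A H)"
  shows "left_module A (canonical_cokernel A H \<rho>)"
proof -
  interpret AA: star_algebra_pair A A by (intro star_algebra_pair.intro A)
  interpret AH: star_algebra_pair A H by (intro star_algebra_pair.intro A H)
  let ?T = "tensor A H" let ?can = "lifted_canonical_map A H \<rho>"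
  define K where "K = ?can ` carrier (tensor A A)"
  let ?C = "canonical_cokernel A H \<rho>"
  note can = lifted_canonical_map_linear[OF A H \<rho>] lifted_canonical_map_pt[OF A H \<rho>]
  note cl = linear_homD[OF can(1)]
  have sub: "subgroup K (add_monoid ?T)"
    unfolding K_def
  proof (rule AH.T.add.subgroupI)
    fix a assume "a \<in> ?can ` carrier (tensor A A)"
    then obtain t where t: "t \<in> carrier (tensor A A)" "a = ?can t" by auto
    then show "\<ominus>\<^bsub>?T\<^esub> a \<in> ?can ` carrier (tensor A A)"
      using linear_hom_uminus[OF AA.T.star_algebra_axioms AH.T.star_algebra_axioms can(1) t(1)]
      by (auto intro!: image_eqI[of _ _ "\<ominus>\<^bsub>tensor A A\<^esub> t"])
  next
    fix a b assume "a \<in> ?can ` carrier (tensor A A)" "b \<in> ?can ` carrier (tensor A A)"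
    then obtain t s where t: "t \<in> carrier (tensor A A)" "a = ?can t" "s \<in> carrier (tensor A A)" "b = ?can s"
      by auto
    then show "a \<oplus>\<^bsub>?T\<^esub> b \<in> ?can ` carrier (tensor A A)"
      by (auto intro!: image_eqI[of _ _ "t \<oplus>\<^bsub>tensor A A\<^esub> s"] simp: cl)
  qed (auto simp: cl)
  interpret K: abelian_subgroup K ?T
    by (intro abelian_subgroupI3 additive_subgroup.intro sub AH.T.abelian_group_axioms)
  have la: "left_action A H a t \<in> carrier ?T" if "a \<in> carrier A" "t \<in> carrier ?T" for a t
    using that by (auto simp: left_action_def)
  have la_add: "left_action A H a (t \<oplus>\<^bsub>?T\<^esub> s) = left_action A H a t \<oplus>\<^bsub>?T\<^esub> left_action A H a s"
    if "a \<in> carrier A" "t \<in> carrier ?T" "s \<in> carrier ?T" for a t s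
    using that by (auto simp: left_action_def AH.T.r_distr)
  have la_add2: "left_action A H (a \<oplus>\<^bsub>A\<^esub> b) t = left_action A H a t \<oplus>\<^bsub>?T\<^esub> left_action A H b t"
    if "a \<in> carrier A" "b \<in> carrier A" "t \<in> carrier ?T" for a b t
    using that by (auto simp: left_action_def AH.T.l_distr AH.pt_add_l)
  have la_mult: "left_action A H (a \<otimes>\<^bsub>A\<^esub> b) t = left_action A H a (left_action A H b t)"
    if "a \<in> carrier A" "b \<in> carrier A" "t \<in> carrier ?T" for a b t
    using that by (simp add: left_action_def AH.pt_mult flip: AH.T.m_assoc)
  have la_one: "left_action A H \<one>\<^bsub>A\<^esub> t = t" if "t \<in> carrier ?T" for t
    using that by (simp add: left_action_def flip: AH.pt_one)
  have laK: "left_action A H a k \<in> K" if "a \<in> carrier A" and k: "k \<in> K" for a k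
  proof -
    obtain t where t: "t \<in> carrier (tensor A A)" "k = ?can t" using k by (auto simp: K_def)
    from t(1) have "left_action A H a (?can t) \<in> K"
    proof (induction rule: AA.tensor_induct)
      case (pure x y)
      have "left_action A H a (?can (pure_tensor A A x y)) = ?can (pure_tensor A A (a \<otimes>\<^bsub>A\<^esub> x) y)"
        using pure that by (simp add: can(2) la_mult linear_homD(1)[OF \<rho>])
      then show ?case using pure that by (auto simp: K_def)
    next
      case (add t u)
      then show ?case using that by (simp add: cl la_add K.a_closed)
    qed
    then show ?thesis using t by simp
  qed
  have C: "carrier ?C = (\<lambda>t. K +>\<^bsub>?T\<^esub> t) ` carrier ?T" "\<zero>\<^bsub>?C\<^esub> = K +>\<^bsub>?T\<^esub> \<zero>\<^bsub>?T\<^esub>"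
    using AH.T.a_coset_add_zero[OF K.a_subset]
    by (auto simp: canonical_cokernel_def Let_def A_RCOSETS_def' K_def[symmetric])
  have Cadd: "(K +>\<^bsub>?T\<^esub> t) \<oplus>\<^bsub>?C\<^esub> (K +>\<^bsub>?T\<^esub> s) = K +>\<^bsub>?T\<^esub> (t \<oplus>\<^bsub>?T\<^esub> s)"
    if "t \<in> carrier ?T" "s \<in> carrier ?T" for t s
    using that by (simp add: canonical_cokernel_def Let_def K.a_rcos_sum)
  have Csm: "a \<odot>\<^bsub>?C\<^esub> (K +>\<^bsub>?T\<^esub> t) = K +>\<^bsub>?T\<^esub> left_action A H a t"
    if a: "a \<in> carrier A" and t: "t \<in> carrier ?T" for a t
  proof -
    have "K +>\<^bsub>?T\<^esub> left_action A H a s = K +>\<^bsub>?T\<^esub> left_action A H a t" if s: "s \<in> K +>\<^bsub>?T\<^esub> t" for s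
    proof -
      obtain k where k: "k \<in> K" "s = k \<oplus>\<^bsub>?T\<^esub> t" using s by (auto simp: a_r_coset_def')
      then have "left_action A H a s = left_action A H a k \<oplus>\<^bsub>?T\<^esub> left_action A H a t"
        using a t K.a_Hcarr by (simp add: la_add)
      then have "left_action A H a s \<in> K +>\<^bsub>?T\<^esub> left_action A H a t"
        using laK[OF a k(1)] by (auto simp: a_r_coset_def')
      then show ?thesis using K.a_repr_independence'[of _ "left_action A H a t"] la[OF a t] by simp
    qed
    moreover have "t \<in> K +>\<^bsub>?T\<^esub> t" using K.a_rcos_self[OF t] .
    ultimately have "(\<Union>s\<in>K +>\<^bsub>?T\<^esub> t. K +>\<^bsub>?T\<^esub> left_action A H a s) = K +>\<^bsub>?T\<^esub> left_action A H a t"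
      by blast
    then show ?thesis by (simp add: canonical_cokernel_def Let_def K_def)
  qed
  have "abelian_group ?C"
  proof (rule abelian_groupI)
    fix X assume "X \<in> carrier ?C"
    then obtain t where "t \<in> carrier ?T" "X = K +>\<^bsub>?T\<^esub> t" by (auto simp: C)
    then show "\<exists>Y\<in>carrier ?C. Y \<oplus>\<^bsub>?C\<^esub> X = \<zero>\<^bsub>?C\<^esub>"
      by (intro bexI[of _ "K +>\<^bsub>?T\<^esub> (\<ominus>\<^bsub>?T\<^esub> t)"]) (auto simp: C Cadd AH.T.l_neg)
  qed (auto simp: C Cadd AH.T.add.m_ac)
  then show ?thesis
    by (intro left_module.intro left_module_axioms.intro star_algebra.ring_ax[OF A])
       (auto simp: C Cadd Csm la la_add la_add2 la_mult la_one)
qed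

interpretation int_monoid: star_monoid integer_group "uminus :: int \<Rightarrow> int"
  by unfold_locales (auto simp: integer_group_def)

interpretation laurent: star_algebra laurent
  unfolding laurent_def by (rule int_monoid.msa_star_algebra)

lemma laurent_sel:
  "carrier laurent = UNIV" "\<one>\<^bsub>laurent\<^esub> = laurent_u 0"
  "laurent_u m \<otimes>\<^bsub>laurent\<^esub> laurent_u n = laurent_u (m + n)"
  "(laurent_u m)\<^sup>\<star>\<^bsub>laurent\<^esub> = laurent_u (- m)"
  by (simp_all add: laurent_def msa_sel laurent_u_def integer_group_def)

lemma laurent_induct [case_names u add smult]:
  assumes "\<And>n. P (laurent_u n)" "\<And>x y. P x \<Longrightarrow> P y \<Longrightarrow> P (x \<oplus>\<^bsub>laurent\<^esub> y)"
    "\<And>c x. P x \<Longrightarrow> P (c \<odot>\<^bsub>laurent\<^esub> x)"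
  shows "P x"
proof -
  have "Poly_Mapping.keys x \<subseteq> UNIV" by simp
  then show ?thesis
  proof (induction rule: pm_induct)
    case zero
    then show ?case using assms(3)[OF assms(1), of 0] by (simp add: laurent_def laurent_u_def msa_sel)
  next
    case (add f g)
    then show ?case using assms(2)[of f g] by (simp add: laurent_def msa_sel)
  next
    case (single m c)
    then show ?case using assms(3)[OF assms(1), of c m] by (simp add: laurent_def laurent_u_def msa_sel)
  qed
qed

lemma laurent_comm: "x \<otimes>\<^bsub>laurent\<^esub> y = y \<otimes>\<^bsub>laurent\<^esub> x"
proof (induction x rule: laurent_induct)
  case (u n)
  show ?case
    by (induction y rule: laurent_induct)
      (auto simp: laurent_sel laurent.l_distr laurent.r_distr laurent.smult_mult_left laurent.smult_mult_right add.commute)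
qed (auto simp: laurent_sel laurent.l_distr laurent.r_distr laurent.smult_mult_left laurent.smult_mult_right)

lemma laurent_linear_ext:
  assumes B: "star_algebra B" and g: "\<And>n. g n \<in> carrier B"
  shows "linear_ext B g \<in> linear_hom laurent B" "linear_ext B g (laurent_u n) = g n"
proof -
  interpret B: star_algebra B by fact
  show "linear_ext B g \<in> linear_hom laurent B"
    unfolding laurent_def by (rule int_monoid.linear_ext_msa[OF B g])
  show "linear_ext B g (laurent_u n) = g n" using g by (simp add: laurent_u_def)
qed

lemma laurent_linear_ext_star_hom:
  assumes B: "star_algebra B" and g: "\<And>n. g n \<in> carrier B"
    and one: "g 0 = \<one>\<^bsub>B\<^esub>" and mult: "\<And>m n. g (m + n) = g m \<otimes>\<^bsub>B\<^esub> g n"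
    and star: "\<And>n. g (- n) = (g n)\<^sup>\<star>\<^bsub>B\<^esub>"
  shows "linear_ext B g \<in> star_hom laurent B"
proof -
  interpret B: star_algebra B by fact
  let ?e = "linear_ext B g"
  have e: "?e \<in> linear_hom laurent B" "\<And>n. ?e (laurent_u n) = g n"
    using laurent_linear_ext[OF B g] by auto
  note l = linear_homD[OF e(1), unfolded laurent_sel(1), simplified]
  have m: "?e (x \<otimes>\<^bsub>laurent\<^esub> y) = ?e x \<otimes>\<^bsub>B\<^esub> ?e y" for x y
  proof (induction x rule: laurent_induct)
    case (u n)
    show ?case
      by (induction y rule: laurent_induct)
        (auto simp: laurent_sel e(2) l laurent.r_distr laurent.smult_mult_right B.r_distr B.smult_mult_right g mult)
  qed (auto simp: laurent_sel l laurent.l_distr laurent.smult_mult_left B.l_distr B.smult_mult_left)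
  have s: "?e (x\<^sup>\<star>\<^bsub>laurent\<^esub>) = (?e x)\<^sup>\<star>\<^bsub>B\<^esub>" for x
    by (induction x rule: laurent_induct)
      (auto simp: laurent_sel e(2) l star laurent.star_add laurent.star_smult B.star_add B.star_smult)
  show ?thesis by (intro star_homI e(1) m s) (simp add: laurent_sel e(2) one)
qed

lemma laurent_hom_eqI:
  assumes f: "f \<in> linear_hom laurent B" and g: "g \<in> linear_hom laurent B"
    and "\<And>n. f (laurent_u n) = g (laurent_u n)"
  shows "f x = g x"
  by (induction x rule: laurent_induct)
    (auto simp: assms(3) linear_homD[OF f, unfolded laurent_sel(1), simplified]
      linear_homD[OF g, unfolded laurent_sel(1), simplified])

lemma laurent_maps:
  "laurent_comult \<in> star_hom laurent (tensor laurent laurent)"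
  "laurent_comult (laurent_u n) = pure_tensor laurent laurent (laurent_u n) (laurent_u n)"
  "laurent_counit \<in> star_hom laurent complex_alg"
  "laurent_counit (laurent_u n) = 1"
  "laurent_antipode \<in> linear_hom laurent laurent"
  "laurent_antipode (laurent_u n) = laurent_u (- n)"
proof -
  interpret laurent2: star_algebra_pair laurent laurent
    by (intro star_algebra_pair.intro laurent.star_algebra_axioms)
  note T = laurent2.T.star_algebra_axioms
  show "laurent_comult \<in> star_hom laurent (tensor laurent laurent)"
    unfolding laurent_comult_def
    by (rule laurent_linear_ext_star_hom[OF T])
      (auto simp: laurent_sel laurent2.pt_mult laurent2.pt_star laurent2.pt_one)
  show "laurent_comult (laurent_u n) = pure_tensor laurent laurent (laurent_u n) (laurent_u n)"
    unfolding laurent_comult_def by (rule laurent_linear_ext(2)[OF T]) (auto simp: laurent_sel)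
  show "laurent_counit \<in> star_hom laurent complex_alg"
    unfolding laurent_counit_def
    by (rule laurent_linear_ext_star_hom[OF star_algebra_complex_alg]) auto
  show "laurent_counit (laurent_u n) = 1"
    unfolding laurent_counit_def by (rule laurent_linear_ext(2)[OF star_algebra_complex_alg]) auto
  show "laurent_antipode \<in> linear_hom laurent laurent"
    unfolding laurent_antipode_def
    by (rule laurent_linear_ext(1)[OF laurent.star_algebra_axioms]) (auto simp: laurent_sel)
  show "laurent_antipode (laurent_u n) = laurent_u (- n)"
    unfolding laurent_antipode_def
    by (rule laurent_linear_ext(2)[OF laurent.star_algebra_axioms]) (auto simp: laurent_sel)
qed

lemma hopf_laurent: "hopf_star_algebra laurent laurent_comult laurent_counit laurent_antipode"
proof (intro hopf_star_algebra.intro hopf_star_algebra_axioms.intro laurent.star_algebra_axioms laurent_maps)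
  interpret laurent2: star_algebra_pair laurent laurent
    by (intro star_algebra_pair.intro laurent.star_algebra_axioms)
  note L = laurent.star_algebra_axioms and T = laurent2.T.star_algebra_axioms
  note lm = laurent_maps
  note eps = star_homD(1)[OF lm(3)] and del = star_homD(1)[OF lm(1)]
  note e = star_homD[OF lm(3), unfolded laurent_sel(1), simplified]
  note s = linear_homD[OF lm(5), unfolded laurent_sel(1), simplified]
  note comp = linear_hom_comp
  have L': "laurent_u n \<in> carrier laurent" for n by (simp add: laurent_sel)
  fix h
  let ?t1 = "tensor_map (tensor laurent laurent) laurent laurent_comult (\<lambda>x. x)"
  let ?t2 = "tensor_map laurent (tensor laurent laurent) (\<lambda>x. x) laurent_comult"
  note t1 = tensor_map_star_hom[OF L L T L lm(1) star_hom_id] tensor_map_pt[OF L L T L lm(1) star_hom_id]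
  note t2 = tensor_map_star_hom[OF L L L T star_hom_id lm(1)] tensor_map_pt[OF L L L T star_hom_id lm(1)]
  show "tensor_assoc laurent laurent laurent (?t1 (laurent_comult h)) = ?t2 (laurent_comult h)"
  proof (rule laurent_hom_eqI)
    show "(\<lambda>h. tensor_assoc laurent laurent laurent (?t1 (laurent_comult h))) \<in> linear_hom laurent (tensor laurent (tensor laurent laurent))"
      by (rule comp[OF comp[OF del star_homD(1)[OF t1(1)]] star_homD(1)[OF tensor_assoc_star_hom[OF L L L]]])
    show "(\<lambda>h. ?t2 (laurent_comult h)) \<in> linear_hom laurent (tensor laurent (tensor laurent laurent))"
      by (rule comp[OF del star_homD(1)[OF t2(1)]])
  qed (simp add: lm(2) t1(2) t2(2) L' tensor_assoc_pt[OF L L L])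
  have b1: "bilinear laurent laurent laurent (\<lambda>x y. laurent_counit x \<odot>\<^bsub>laurent\<^esub> y)"
    by (rule bilinearI) (auto simp: laurent_sel e laurent.smult_add_l laurent.smult_add_r laurent.smult_smult mult_ac)
  have b2: "bilinear laurent laurent laurent (\<lambda>x y. laurent_counit y \<odot>\<^bsub>laurent\<^esub> x)"
    by (rule bilinearI) (auto simp: laurent_sel e laurent.smult_add_l laurent.smult_add_r laurent.smult_smult mult_ac)
  have b3: "bilinear laurent laurent laurent (\<lambda>x y. laurent_antipode x \<otimes>\<^bsub>laurent\<^esub> y)"
    by (rule bilinearI) (auto simp: laurent_sel s laurent.l_distr laurent.r_distr laurent.smult_mult_left laurent.smult_mult_right)
  have b4: "bilinear laurent laurent laurent (\<lambda>x y. x \<otimes>\<^bsub>laurent\<^esub> laurent_antipode y)"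
    by (rule bilinearI) (auto simp: laurent_sel s laurent.l_distr laurent.r_distr laurent.smult_mult_left laurent.smult_mult_right)
  have r: "(\<lambda>h. laurent_counit h \<odot>\<^bsub>laurent\<^esub> \<one>\<^bsub>laurent\<^esub>) \<in> linear_hom laurent laurent"
    by (rule linear_homI) (auto simp: laurent_sel e laurent.smult_add_l laurent.smult_smult)
  note tl = laurent2.tensor_lift_linear[OF L] and tp = laurent2.tensor_lift_pt[OF L]
  show "tensor_lift laurent (\<lambda>x y. laurent_counit x \<odot>\<^bsub>laurent\<^esub> y) (laurent_comult h) = h"
    by (rule laurent_hom_eqI[OF comp[OF del tl[OF b1]] linear_hom_id])
       (simp add: lm tp[OF b1] L')
  show "tensor_lift laurent (\<lambda>x y. laurent_counit y \<odot>\<^bsub>laurent\<^esub> x) (laurent_comult h) = h"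
    by (rule laurent_hom_eqI[OF comp[OF del tl[OF b2]] linear_hom_id])
       (simp add: lm tp[OF b2] L')
  show "tensor_lift laurent (\<lambda>x y. laurent_antipode x \<otimes>\<^bsub>laurent\<^esub> y) (laurent_comult h)
      = laurent_counit h \<odot>\<^bsub>laurent\<^esub> \<one>\<^bsub>laurent\<^esub>"
    by (rule laurent_hom_eqI[OF comp[OF del tl[OF b3]] r])
       (simp add: lm tp[OF b3] L' laurent_sel)
  show "tensor_lift laurent (\<lambda>x y. x \<otimes>\<^bsub>laurent\<^esub> laurent_antipode y) (laurent_comult h)
      = laurent_counit h \<odot>\<^bsub>laurent\<^esub> \<one>\<^bsub>laurent\<^esub>"
    by (rule laurent_hom_eqI[OF comp[OF del tl[OF b4]] r])
       (simp add: lm tp[OF b4] L' laurent_sel)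
qed

lemma star_algebra_sigma: "star_algebra (sigma_algebra q)"
  unfolding sigma_algebra_def by (rule presented_star_algebra)

lemma sigma_generator_closed: "sigma_generator q g \<in> carrier (sigma_algebra q)"
  unfolding sigma_algebra_def sigma_generator_def by (rule presented_gen_closed)

lemma sigma_relations_hold:
  fixes q defines "\<Sigma> \<equiv> sigma_algebra q"
    and "z0 \<equiv> sigma_generator q Zeta0" and "z1 \<equiv> sigma_generator q Zeta1" and "xi \<equiv> sigma_generator q Xi"
  shows "z0 \<otimes>\<^bsub>\<Sigma>\<^esub> z1 = complex_of_real q \<odot>\<^bsub>\<Sigma>\<^esub> (z1 \<otimes>\<^bsub>\<Sigma>\<^esub> z0)"
    and "z0 \<otimes>\<^bsub>\<Sigma>\<^esub> z1\<^sup>\<star>\<^bsub>\<Sigma>\<^esub> = complex_of_real q \<odot>\<^bsub>\<Sigma>\<^esub> (z1\<^sup>\<star>\<^bsub>\<Sigma>\<^esub> \<otimes>\<^bsub>\<Sigma>\<^esub> z0)"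
    and "z0 \<otimes>\<^bsub>\<Sigma>\<^esub> z0\<^sup>\<star>\<^bsub>\<Sigma>\<^esub> = z0\<^sup>\<star>\<^bsub>\<Sigma>\<^esub> \<otimes>\<^bsub>\<Sigma>\<^esub> z0 \<oplus>\<^bsub>\<Sigma>\<^esub> complex_of_real (1 / q\<^sup>2 - 1) \<odot>\<^bsub>\<Sigma>\<^esub> (z1 \<otimes>\<^bsub>\<Sigma>\<^esub> z1 \<otimes>\<^bsub>\<Sigma>\<^esub> xi)"
    and "z0 \<otimes>\<^bsub>\<Sigma>\<^esub> z0\<^sup>\<star>\<^bsub>\<Sigma>\<^esub> \<oplus>\<^bsub>\<Sigma>\<^esub> z1 \<otimes>\<^bsub>\<Sigma>\<^esub> z1 \<otimes>\<^bsub>\<Sigma>\<^esub> xi = \<one>\<^bsub>\<Sigma>\<^esub>"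
    and "z1\<^sup>\<star>\<^bsub>\<Sigma>\<^esub> = z1 \<otimes>\<^bsub>\<Sigma>\<^esub> xi"
    and "xi \<otimes>\<^bsub>\<Sigma>\<^esub> xi\<^sup>\<star>\<^bsub>\<Sigma>\<^esub> = \<one>\<^bsub>\<Sigma>\<^esub>"
    and "xi\<^sup>\<star>\<^bsub>\<Sigma>\<^esub> \<otimes>\<^bsub>\<Sigma>\<^esub> xi = \<one>\<^bsub>\<Sigma>\<^esub>"
    and "x \<in> carrier \<Sigma> \<Longrightarrow> xi \<otimes>\<^bsub>\<Sigma>\<^esub> x = x \<otimes>\<^bsub>\<Sigma>\<^esub> xi"
proof -
  let ?R = "sigma_relations q"
  let ?p = "\<lambda>x. relation_ideal ?R +>\<^bsub>free_star_algebra\<^esub> x"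
  note p = star_homD[OF presented_proj[of ?R], unfolded free_sel(1), simplified]
  have rel: "?p x = ?p y" if "(x, y) \<in> ?R" for x y by (rule presented_relation[OF that])
  have z: "z0 = ?p (free_gen Zeta0)" "z1 = ?p (free_gen Zeta1)" "xi = ?p (free_gen Xi)"
    by (simp_all add: z0_def z1_def xi_def sigma_generator_def presented_gen_def)
  have S: "\<Sigma> = presented_star_algebra ?R" by (simp add: \<Sigma>_def sigma_algebra_def)
  have pow: "x [^]\<^bsub>free_star_algebra\<^esub> (2::nat) = x \<otimes>\<^bsub>free_star_algebra\<^esub> x"
    for x :: "(sigma_gen \<times> bool) list \<Rightarrow>\<^sub>0 complex"
    by (simp add: numeral_2_eq_2 free.nat_pow_Suc free_sel(1))
  note simps = z S p(2,4-7)[symmetric]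
  let ?F = "free_star_algebra" and ?z0 = "free_gen Zeta0" and ?z1 = "free_gen Zeta1" and ?xi = "free_gen Xi"
  note d = sigma_relations_def Let_def pow
  show "z0 \<otimes>\<^bsub>\<Sigma>\<^esub> z1 = complex_of_real q \<odot>\<^bsub>\<Sigma>\<^esub> (z1 \<otimes>\<^bsub>\<Sigma>\<^esub> z0)"
    unfolding simps by (rule rel) (simp add: d)
  show "z0 \<otimes>\<^bsub>\<Sigma>\<^esub> z1\<^sup>\<star>\<^bsub>\<Sigma>\<^esub> = complex_of_real q \<odot>\<^bsub>\<Sigma>\<^esub> (z1\<^sup>\<star>\<^bsub>\<Sigma>\<^esub> \<otimes>\<^bsub>\<Sigma>\<^esub> z0)"
    unfolding simps by (rule rel) (simp add: d)
  show "z0 \<otimes>\<^bsub>\<Sigma>\<^esub> z0\<^sup>\<star>\<^bsub>\<Sigma>\<^esub> = z0\<^sup>\<star>\<^bsub>\<Sigma>\<^esub> \<otimes>\<^bsub>\<Sigma>\<^esub> z0 \<oplus>\<^bsub>\<Sigma>\<^esub> complex_of_real (1 / q\<^sup>2 - 1) \<odot>\<^bsub>\<Sigma>\<^esub> (z1 \<otimes>\<^bsub>\<Sigma>\<^esub> z1 \<otimes>\<^bsub>\<Sigma>\<^esub> xi)"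
    unfolding simps by (rule rel) (simp add: d)
  show "z0 \<otimes>\<^bsub>\<Sigma>\<^esub> z0\<^sup>\<star>\<^bsub>\<Sigma>\<^esub> \<oplus>\<^bsub>\<Sigma>\<^esub> z1 \<otimes>\<^bsub>\<Sigma>\<^esub> z1 \<otimes>\<^bsub>\<Sigma>\<^esub> xi = \<one>\<^bsub>\<Sigma>\<^esub>"
    unfolding simps by (rule rel) (simp add: d)
  show "z1\<^sup>\<star>\<^bsub>\<Sigma>\<^esub> = z1 \<otimes>\<^bsub>\<Sigma>\<^esub> xi"
    unfolding simps by (rule rel) (simp add: d)
  show "xi \<otimes>\<^bsub>\<Sigma>\<^esub> xi\<^sup>\<star>\<^bsub>\<Sigma>\<^esub> = \<one>\<^bsub>\<Sigma>\<^esub>"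
    unfolding simps by (rule rel) (simp add: d)
  show "xi\<^sup>\<star>\<^bsub>\<Sigma>\<^esub> \<otimes>\<^bsub>\<Sigma>\<^esub> xi = \<one>\<^bsub>\<Sigma>\<^esub>"
    unfolding simps by (rule rel) (simp add: d)
  show "xi \<otimes>\<^bsub>\<Sigma>\<^esub> x = x \<otimes>\<^bsub>\<Sigma>\<^esub> xi" if x: "x \<in> carrier \<Sigma>"
  proof -
    obtain y where y: "x = ?p y" using x by (auto simp: S presented_carrier)
    show ?thesis unfolding y simps by (rule rel) (auto simp: d free_sel(1))
  qed
qed

lemma
  shows sigma_coaction_star_hom:
      "sigma_coaction q l \<in> star_hom (sigma_algebra q) (tensor (sigma_algebra q) laurent)"
    and sigma_coaction_gen: "sigma_coaction q l (sigma_generator q g)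
      = pure_tensor (sigma_algebra q) laurent (sigma_generator q g) (laurent_u (gen_weight l g))"
proof -
  let ?S = "sigma_algebra q" and ?R = "sigma_relations q"
  interpret star_algebra_pair ?S laurent
    by (intro star_algebra_pair.intro star_algebra_sigma laurent.star_algebra_axioms)
  let ?h = "\<lambda>g. pt (sigma_generator q g) (laurent_u (gen_weight l g))"
  note gc [simp] = sigma_generator_closed[of q]
  have uc [simp]: "laurent_u n \<in> carrier laurent" for n by (simp add: laurent_sel)
  have h: "?h g \<in> carrier T" for g by auto
  let ?e = "linear_ext T (word_value T ?h)"
  note e = free_eval_star_hom[where h = ?h, OF T.star_algebra_axioms h]
  note eh = star_homD[OF e(1), unfolded free_sel(1), simplified]
  note rels = sigma_relations_hold[where q = q]
  have pow: "x [^]\<^bsub>free_star_algebra\<^esub> (2::nat) = x \<otimes>\<^bsub>free_star_algebra\<^esub> x"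
    for x :: "(sigma_gen \<times> bool) list \<Rightarrow>\<^sub>0 complex"
    by (simp add: numeral_2_eq_2 free.nat_pow_Suc free_sel(1))
  have central: "?h Xi \<otimes>\<^bsub>T\<^esub> t = t \<otimes>\<^bsub>T\<^esub> ?h Xi" if "t \<in> carrier T" for t
    using that
  proof (induction rule: tensor_induct)
    case (pure x y)
    then show ?case using rels(8)[where x = x] laurent_comm[of y] by (simp add: pt_mult)
  qed (auto simp: T.l_distr T.r_distr)
  let ?F = "free_star_algebra" and ?z0 = "free_gen Zeta0" and ?z1 = "free_gen Zeta1" and ?xi = "free_gen Xi"
  let ?a = "sigma_generator q Zeta0" and ?b = "sigma_generator q Zeta1" and ?c = "sigma_generator q Xi" and ?u = laurent_u
  note ev = pow eh e(2) pt_mult pt_star laurent_sel pt_one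
  have E: "?e (?z0 \<otimes>\<^bsub>?F\<^esub> ?z1) = pt (?a \<otimes>\<^bsub>?S\<^esub> ?b) (?u (1 + int l))"
    "?e (?z1 \<otimes>\<^bsub>?F\<^esub> ?z0) = pt (?b \<otimes>\<^bsub>?S\<^esub> ?a) (?u (1 + int l))"
    "?e (?z0 \<otimes>\<^bsub>?F\<^esub> ?z1\<^sup>\<star>\<^bsub>?F\<^esub>) = pt (?a \<otimes>\<^bsub>?S\<^esub> ?b\<^sup>\<star>\<^bsub>?S\<^esub>) (?u (1 - int l))"
    "?e (?z1\<^sup>\<star>\<^bsub>?F\<^esub> \<otimes>\<^bsub>?F\<^esub> ?z0) = pt (?b\<^sup>\<star>\<^bsub>?S\<^esub> \<otimes>\<^bsub>?S\<^esub> ?a) (?u (1 - int l))"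
    "?e (?z0 \<otimes>\<^bsub>?F\<^esub> ?z0\<^sup>\<star>\<^bsub>?F\<^esub>) = pt (?a \<otimes>\<^bsub>?S\<^esub> ?a\<^sup>\<star>\<^bsub>?S\<^esub>) (?u 0)"
    "?e (?z0\<^sup>\<star>\<^bsub>?F\<^esub> \<otimes>\<^bsub>?F\<^esub> ?z0) = pt (?a\<^sup>\<star>\<^bsub>?S\<^esub> \<otimes>\<^bsub>?S\<^esub> ?a) (?u 0)"
    "?e (?z1 \<otimes>\<^bsub>?F\<^esub> ?z1 \<otimes>\<^bsub>?F\<^esub> ?xi) = pt (?b \<otimes>\<^bsub>?S\<^esub> ?b \<otimes>\<^bsub>?S\<^esub> ?c) (?u 0)"
    "?e (?z1\<^sup>\<star>\<^bsub>?F\<^esub>) = pt (?b\<^sup>\<star>\<^bsub>?S\<^esub>) (?u (- int l))"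
    "?e (?z1 \<otimes>\<^bsub>?F\<^esub> ?xi) = pt (?b \<otimes>\<^bsub>?S\<^esub> ?c) (?u (- int l))"
    "?e (?xi \<otimes>\<^bsub>?F\<^esub> ?xi\<^sup>\<star>\<^bsub>?F\<^esub>) = pt (?c \<otimes>\<^bsub>?S\<^esub> ?c\<^sup>\<star>\<^bsub>?S\<^esub>) (?u 0)"
    "?e (?xi\<^sup>\<star>\<^bsub>?F\<^esub> \<otimes>\<^bsub>?F\<^esub> ?xi) = pt (?c\<^sup>\<star>\<^bsub>?S\<^esub> \<otimes>\<^bsub>?S\<^esub> ?c) (?u 0)"
    by (simp_all add: ev add.commute)
  have one: "?e \<one>\<^bsub>?F\<^esub> = pt \<one>\<^bsub>?S\<^esub> (?u 0)" by (simp add: eh pt_one laurent_sel)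
  have R: "?e x = ?e y" if xy: "(x, y) \<in> ?R" for x y
  proof -
    consider "x = ?z0 \<otimes>\<^bsub>?F\<^esub> ?z1" "y = complex_of_real q \<odot>\<^bsub>?F\<^esub> (?z1 \<otimes>\<^bsub>?F\<^esub> ?z0)"
      | "x = ?z0 \<otimes>\<^bsub>?F\<^esub> ?z1\<^sup>\<star>\<^bsub>?F\<^esub>" "y = complex_of_real q \<odot>\<^bsub>?F\<^esub> (?z1\<^sup>\<star>\<^bsub>?F\<^esub> \<otimes>\<^bsub>?F\<^esub> ?z0)"
      | "x = ?z0 \<otimes>\<^bsub>?F\<^esub> ?z0\<^sup>\<star>\<^bsub>?F\<^esub>"
        "y = ?z0\<^sup>\<star>\<^bsub>?F\<^esub> \<otimes>\<^bsub>?F\<^esub> ?z0 \<oplus>\<^bsub>?F\<^esub> complex_of_real (1 / q\<^sup>2 - 1) \<odot>\<^bsub>?F\<^esub> (?z1 \<otimes>\<^bsub>?F\<^esub> ?z1 \<otimes>\<^bsub>?F\<^esub> ?xi)"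
      | "x = ?z0 \<otimes>\<^bsub>?F\<^esub> ?z0\<^sup>\<star>\<^bsub>?F\<^esub> \<oplus>\<^bsub>?F\<^esub> ?z1 \<otimes>\<^bsub>?F\<^esub> ?z1 \<otimes>\<^bsub>?F\<^esub> ?xi" "y = \<one>\<^bsub>?F\<^esub>"
      | "x = ?z1\<^sup>\<star>\<^bsub>?F\<^esub>" "y = ?z1 \<otimes>\<^bsub>?F\<^esub> ?xi"
      | "x = ?xi \<otimes>\<^bsub>?F\<^esub> ?xi\<^sup>\<star>\<^bsub>?F\<^esub>" "y = \<one>\<^bsub>?F\<^esub>"
      | "x = ?xi\<^sup>\<star>\<^bsub>?F\<^esub> \<otimes>\<^bsub>?F\<^esub> ?xi" "y = \<one>\<^bsub>?F\<^esub>"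
      | w where "x = ?xi \<otimes>\<^bsub>?F\<^esub> w" "y = w \<otimes>\<^bsub>?F\<^esub> ?xi"
      using xy unfolding sigma_relations_def Let_def pow Un_iff insert_iff by blast
    then show ?thesis
    proof cases
      case 1
      show ?thesis unfolding 1 eh(5) E by (simp add: rels(1) pt_smult_l)
    next
      case 2
      show ?thesis unfolding 2 eh(5) E by (simp add: rels(2) pt_smult_l)
    next
      case 3
      show ?thesis unfolding 3 eh(4) eh(5) E by (simp add: rels(3) pt_add_l pt_smult_l)
    next
      case 4
      have "pt (?a \<otimes>\<^bsub>?S\<^esub> ?a\<^sup>\<star>\<^bsub>?S\<^esub>) (?u 0) \<oplus>\<^bsub>T\<^esub> pt (?b \<otimes>\<^bsub>?S\<^esub> ?b \<otimes>\<^bsub>?S\<^esub> ?c) (?u 0)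
          = pt (?a \<otimes>\<^bsub>?S\<^esub> ?a\<^sup>\<star>\<^bsub>?S\<^esub> \<oplus>\<^bsub>?S\<^esub> ?b \<otimes>\<^bsub>?S\<^esub> ?b \<otimes>\<^bsub>?S\<^esub> ?c) (?u 0)"
        by (rule pt_add_l[symmetric]) auto
      then show ?thesis unfolding 4 eh(4) E one rels(4) .
    next
      case 5
      show ?thesis unfolding 5 E rels(5) ..
    next
      case 6
      show ?thesis unfolding 6 E one rels(6) ..
    next
      case 7
      show ?thesis unfolding 7 E one rels(7) ..
    next
      case (8 w)
      show ?thesis unfolding 8 eh(6) e(2) by (rule central) (rule eh(3))
    qed
  qed
  show "sigma_coaction q l \<in> star_hom ?S T"
    "sigma_coaction q l (sigma_generator q g) = ?h g"
    using presented_lift[where h = ?h, OF T.star_algebra_axioms h R]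
    unfolding sigma_coaction_def sigma_algebra_def sigma_generator_def by auto
qed

lemma sigma_coaction_unique:
  assumes "f \<in> star_hom (sigma_algebra q) (tensor (sigma_algebra q) laurent)"
    and "\<And>g. f (sigma_generator q g) = pure_tensor (sigma_algebra q) laurent (sigma_generator q g) (laurent_u (gen_weight l g))"
    and "a \<in> carrier (sigma_algebra q)"
  shows "f a = sigma_coaction q l a"
  using assms(1,3) sigma_coaction_star_hom[of q l] unfolding sigma_algebra_def
  by (rule_tac presented_hom_eqI[of f "sigma_relations q" _ "sigma_coaction q l"])
     (auto simp: assms(2) sigma_coaction_gen simp flip: sigma_generator_def)

lemma right_comodule_algebra_sigma:
  "right_comodule_algebra (sigma_algebra q) laurent laurent_comult laurent_counit laurent_antipode (sigma_coaction q l)"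
proof -
  let ?S = "sigma_algebra q" and ?L = laurent and ?rho = "sigma_coaction q l"
  note S = star_algebra_sigma[of q] and L = laurent.star_algebra_axioms
  interpret SL: star_algebra_pair ?S laurent by (intro star_algebra_pair.intro S L)
  interpret LL: star_algebra_pair laurent laurent by (intro star_algebra_pair.intro L)
  note rho = sigma_coaction_star_hom[of q l] and rg = sigma_coaction_gen[of q l]
  note gc [simp] = sigma_generator_closed[of q]
  have uc [simp]: "laurent_u n \<in> carrier laurent" for n by (simp add: laurent_sel)
  note T = SL.T.star_algebra_axioms and T2 = LL.T.star_algebra_axioms
  note lm = laurent_maps
  note t1 = tensor_map_star_hom[OF S L T L rho star_hom_id] tensor_map_pt[OF S L T L rho star_hom_id]
  note t2 = tensor_map_star_hom[OF S L S T2 star_hom_id lm(1)] tensor_map_pt[OF S L S T2 star_hom_id lm(1)]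
  note as = tensor_assoc_star_hom[OF S L L] tensor_assoc_pt[OF S L L]
  note e = star_homD[OF lm(3), unfolded laurent_sel(1), simplified]
  have eq: "f a = g a" if "f \<in> star_hom ?S B" "g \<in> star_hom ?S B" "a \<in> carrier ?S"
    "\<And>x. f (sigma_generator q x) = g (sigma_generator q x)" for f g a and B :: "'z star_algebra"
    using presented_hom_eqI[of f "sigma_relations q" B g a] that
    by (auto simp: sigma_algebra_def sigma_generator_def)
  have eq2: "f a = g a" if "f \<in> star_hom ?S ?S" "g \<in> star_hom ?S ?S" "a \<in> carrier ?S"
    "\<And>x. f (sigma_generator q x) = g (sigma_generator q x)" for f g a
    using presented_hom_eqI[of f "sigma_relations q" ?S g a] that
    by (auto simp: sigma_algebra_def sigma_generator_def)
  have c1: "tensor_assoc ?S ?L ?L (tensor_map (tensor ?S ?L) ?L ?rho (\<lambda>x. x) (?rho a))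
          = tensor_map ?S (tensor ?L ?L) (\<lambda>x. x) laurent_comult (?rho a)" if a: "a \<in> carrier ?S" for a
  proof (rule eq[OF star_hom_comp[OF star_hom_comp[OF rho t1(1)] as(1)] star_hom_comp[OF rho t2(1)] a])
  qed (simp add: rg t1(2) t2(2) lm as(2))
  have bil: "bilinear ?S ?L ?S (\<lambda>x h. laurent_counit h \<odot>\<^bsub>?S\<^esub> x)"
    by (rule bilinearI) (auto simp: laurent_sel e SL.A.smult_add_l SL.A.smult_add_r SL.A.smult_smult mult_ac)
  have sh: "tensor_lift ?S (\<lambda>x h. laurent_counit h \<odot>\<^bsub>?S\<^esub> x) \<in> star_hom (tensor ?S ?L) ?S"
    by (rule SL.tensor_lift_star_hom[OF S bil])
      (auto simp: e SL.A.smult_mult_left SL.A.smult_mult_right SL.A.smult_smult SL.A.star_smult mult_ac)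
  have c2: "tensor_lift ?S (\<lambda>x h. laurent_counit h \<odot>\<^bsub>?S\<^esub> x) (?rho a) = a" if a: "a \<in> carrier ?S" for a
    by (rule eq2[OF star_hom_comp[OF rho sh] star_hom_id a])
       (simp add: rg SL.tensor_lift_pt[OF S bil] lm)
  show ?thesis
    by (intro right_comodule_algebra.intro right_comodule_algebra_axioms.intro hopf_laurent S rho c1 c2)
qed

end

theory Submission
  imports Defs
begin

text \<open>
  The lifted canonical map is in fact surjective, so that its cokernel vanishes.

  Let \<open>K\<close> be its image, and for \<open>h\<close> in \<open>H = \<O>(U(1))\<close> let \<open>coefficients h\<close> be the left ideal of
  all \<open>c\<close> with \<open>c \<otimes> h \<in> K\<close>. Surjectivity means that each of these ideals contains \<open>1\<close>. Since \<open>H\<close> is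
  commutative and the coaction is multiplicative, the \<open>h\<close> with \<open>1 \<otimes> h \<in> K\<close> are closed under
  products (\<open>one_in_coefficients_mult\<close>), hence it is enough to reach \<open>1 \<otimes> u\<close> and \<open>1 \<otimes> u\<^sup>-\<^sup>1\<close>. An
  element \<open>a'\<close> of degree \<open>n\<close> puts every product \<open>a a'\<close> into \<open>coefficients (u\<^sup>n)\<close>.

  Put \<open>x = \<zeta>\<^sub>1 \<zeta>\<^sub>1\<^sup>*\<close>. In degree \<open>1\<close> there are \<open>\<zeta>\<^sub>0\<close> and \<open>\<zeta>\<^sub>1 \<zeta>\<^sub>0\<^sup>*\<^sup>m\<close> with \<open>m = l - 1\<close>; they contribute
  \<open>\<zeta>\<^sub>0\<^sup>* \<zeta>\<^sub>0 = 1 - q\<^sup>-\<^sup>2 x\<close> and \<open>\<zeta>\<^sub>0\<^sup>m x \<zeta>\<^sub>0\<^sup>*\<^sup>m\<close>. The latter is a polynomial in \<open>x\<close> with roots \<open>0\<close> and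
  \<open>q\<^sup>-\<^sup>2\<^sup>k\<close> for \<open>0 \<le> k < m\<close>, which has no root in common with \<open>1 - q\<^sup>-\<^sup>2 x\<close>, so the two generate the
  unit ideal. Degree \<open>-1\<close> is similar, with \<open>\<zeta>\<^sub>0 \<zeta>\<^sub>0\<^sup>* = 1 - x\<close> and \<open>\<zeta>\<^sub>0\<^sup>*\<^sup>m x \<zeta>\<^sub>0\<^sup>m\<close>, whose roots are \<open>0\<close>
  and \<open>q\<^sup>2\<^sup>k\<close> for \<open>1 \<le> k \<le> m\<close>. The lemma \<open>one_mem_if_sandwich_mem\<close> covers both cases.
\<close>

section \<open>Left ideals of an algebra\<close>

locale left_ideal = star_algebra A for L and A (structure) +
  assumes subset: "L \<subseteq> carrier A"
    and add_closed: "\<lbrakk>x \<in> L; y \<in> L\<rbrakk> \<Longrightarrow> x \<oplus> y \<in> L"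
    and mult_closed: "\<lbrakk>c \<in> carrier A; x \<in> L\<rbrakk> \<Longrightarrow> c \<otimes> x \<in> L"
begin

lemma smult_in: "x \<in> L \<Longrightarrow> c \<odot> x \<in> L"
  using mult_closed[of "c \<odot> \<one>" x] subset by (auto simp: smult_mult_left)

lemma smult_cancel: "\<lbrakk>c \<odot> x \<in> L; c \<noteq> 0; x \<in> carrier A\<rbrakk> \<Longrightarrow> x \<in> L"
  using smult_in[of "c \<odot> x" "1 / c"] by (simp add: smult_smult)

lemma add_cancel:
  assumes "x \<oplus> y \<in> L" "y \<in> L" "x \<in> carrier A"
  shows "x \<in> L"
proof -
  have y: "y \<in> carrier A" using assms subset by auto
  have "(x \<oplus> y) \<oplus> (- 1) \<odot> y \<in> L" by (intro add_closed smult_in assms)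
  also have "(x \<oplus> y) \<oplus> (- 1) \<odot> y = x"
    using y assms(3) by (simp add: a_assoc r_neg flip: uminus_conv)
  finally show ?thesis .
qed

text \<open>Modulo \<open>L\<close>, the element \<open>x\<close> may be replaced by the scalar \<open>r\<close> at the right end of a product.
  Moving \<open>x\<close> to the right end of \<open>a\<^sup>m x b\<^sup>m\<close>, and then of the factor \<open>a b = 1 - s x\<close> in the middle of
  \<open>a\<^sup>k\<^sup>+\<^sup>1 b\<^sup>k\<^sup>+\<^sup>1\<close>, therefore reduces \<open>a\<^sup>m x b\<^sup>m\<close> to a product of the scalars \<open>t\<^sup>m\<close>, \<open>r\<close> and
  \<open>1 - s r t\<^sup>k = 1 - t\<^sup>k\<^sup>+\<^sup>1\<close> for \<open>k < m\<close>, none of which vanishes.\<close>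

lemma one_mem_if_sandwich_mem:
  assumes cl: "a \<in> carrier A" "b \<in> carrier A" "x \<in> carrier A"
    and ab: "a \<otimes> b = \<one> \<oplus> (- s) \<odot> x" and xb: "x \<otimes> b = t \<odot> (b \<otimes> x)"
    and xr: "x \<oplus> (- r) \<odot> \<one> \<in> L"
    and t: "t = s * r" "t \<noteq> 0" and root_of_unity: "\<And>k. t ^ Suc k \<noteq> 1"
    and mem: "a [^] (m::nat) \<otimes> x \<otimes> b [^] m \<in> L"
  shows "\<one> \<in> L"
proof -
  have r: "r \<noteq> 0" and ne: "s * r * t ^ k \<noteq> 1" for k
    using t root_of_unity[of k] by auto
  have pw: "x \<otimes> b [^] k = t ^ k \<odot> (b [^] k \<otimes> x)" for k :: nat
  proof (induction k)
    case (Suc k)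
    have "x \<otimes> b [^] Suc k = (x \<otimes> b [^] k) \<otimes> b" using cl by (simp add: m_assoc)
    also have "\<dots> = t ^ k \<odot> (b [^] k \<otimes> (x \<otimes> b))"
      unfolding Suc using cl by (simp add: smult_mult_left m_assoc)
    also have "\<dots> = t ^ Suc k \<odot> (b [^] Suc k \<otimes> x)"
      unfolding xb using cl by (simp add: smult_mult_right smult_smult m_assoc mult.commute)
    finally show ?case .
  qed (use cl in simp)
  have red: "c \<otimes> x \<oplus> (- r) \<odot> c \<in> L" if "c \<in> carrier A" for c
    using mult_closed[OF that xr] that cl by (simp add: r_distr smult_mult_right)
  let ?d = "\<lambda>k::nat. a [^] k \<otimes> b [^] k"
  have d: "?d k \<in> carrier A" for k using cl by simp
  have step: "?d k \<in> L" if "?d (Suc k) \<in> L" for k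
  proof -
    let ?w = "- s * t ^ k"
    have "?d (Suc k) = a [^] k \<otimes> ((a \<otimes> b) \<otimes> b [^] k)"
      using cl by (simp add: m_assoc nat_pow_Suc2 del: nat_pow_Suc)
        (simp add: nat_pow_Suc2[symmetric] m_assoc[symmetric] del: nat_pow_Suc)
    also have "\<dots> = ?d k \<oplus> ?w \<odot> (?d k \<otimes> x)"
      unfolding ab using cl
      by (simp add: l_distr r_distr smult_mult_left smult_mult_right pw smult_smult m_assoc)
    finally have 1: "?d k \<oplus> ?w \<odot> (?d k \<otimes> x) \<in> L" using that by simp
    have "(1 - s * r * t ^ k) \<odot> ?d k \<oplus> ?w \<odot> (?d k \<otimes> x \<oplus> (- r) \<odot> ?d k)
        = ?d k \<oplus> ?w \<odot> (?d k \<otimes> x)"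
    proof -
      have "(1 - s * r * t ^ k) \<odot> ?d k \<oplus> ?w \<odot> (?d k \<otimes> x \<oplus> (- r) \<odot> ?d k)
          = ((1 - s * r * t ^ k) \<odot> ?d k \<oplus> (?w * - r) \<odot> ?d k) \<oplus> ?w \<odot> (?d k \<otimes> x)"
        using d[of k] cl by (simp add: smult_add_r smult_smult a_ac)
      also have "(1 - s * r * t ^ k) \<odot> ?d k \<oplus> (?w * - r) \<odot> ?d k = 1 \<odot> ?d k"
        unfolding smult_add_l[OF d[of k], symmetric] by simp
      finally show ?thesis using d[of k] by simp
    qed
    then have "(1 - s * r * t ^ k) \<odot> ?d k \<oplus> ?w \<odot> (?d k \<otimes> x \<oplus> (- r) \<odot> ?d k) \<in> L"
      using 1 by (simp only:)
    then have "(1 - s * r * t ^ k) \<odot> ?d k \<in> L"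
      by (rule add_cancel[OF _ smult_in[OF red[OF d]] smult_cl[OF d]])
    then show ?thesis by (rule smult_cancel[OF _ _ d]) (use ne[of k] in simp)
  qed
  have "?d m \<in> L"
  proof -
    have "t ^ m \<odot> (?d m \<otimes> x) \<in> L"
      using mem cl by (simp add: m_assoc pw smult_mult_right)
    then have "?d m \<otimes> x \<in> L" by (rule smult_cancel) (use t(2) cl in auto)
    moreover have "(- r) \<odot> ?d m \<oplus> ?d m \<otimes> x \<in> L"
      using red[OF d[of m]] d[of m] cl by (simp add: a_comm)
    ultimately have "(- r) \<odot> ?d m \<in> L" using add_cancel d[of m] by blast
    then show ?thesis by (rule smult_cancel[OF _ _ d]) (use r in simp)
  qed
  then have "?d 0 \<in> L" using step by (induction m) blast+
  then show ?thesis by simp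
qed

end

section \<open>The image of the lifted canonical map\<close>

definition canonical_image :: "'a star_algebra \<Rightarrow> 'h star_algebra \<Rightarrow> ('a \<Rightarrow> ('a, 'h) tensor) \<Rightarrow> ('a, 'h) tensor set" where
  "canonical_image A H \<rho> = lifted_canonical_map A H \<rho> ` carrier (tensor A A)"

locale coaction_map = star_algebra_pair A H for A :: "'a star_algebra" and H :: "'h star_algebra" +
  fixes \<rho> :: "'a \<Rightarrow> ('a, 'h) tensor"
  assumes \<rho>_hom: "\<rho> \<in> star_hom A (tensor A H)"
begin

abbreviation "K \<equiv> canonical_image A H \<rho>"

lemmas \<rho> = star_homD[OF \<rho>_hom]

sublocale AA: star_algebra_pair A A
  by unfold_locales

lemmas can_linear = linear_homD[OF
  lifted_canonical_map_linear[OF A.star_algebra_axioms B.star_algebra_axioms \<rho>(1)]]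
lemmas can_pt = lifted_canonical_map_pt[OF A.star_algebra_axioms B.star_algebra_axioms \<rho>(1),
  unfolded left_action_def]

lemma K_subset: "K \<subseteq> carrier T"
  by (auto simp: canonical_image_def can_linear)

lemma K_add: "\<lbrakk>s \<in> K; t \<in> K\<rbrakk> \<Longrightarrow> s \<oplus>\<^bsub>T\<^esub> t \<in> K"
  unfolding canonical_image_def
  by (auto simp flip: can_linear(2))

lemma K_generator: "\<lbrakk>a \<in> carrier A; a' \<in> carrier A\<rbrakk> \<Longrightarrow> pt a \<one>\<^bsub>H\<^esub> \<otimes>\<^bsub>T\<^esub> \<rho> a' \<in> K"
  unfolding canonical_image_def by (auto simp flip: can_pt)

lemma K_induct [consumes 1, case_names generator add]:
  assumes "t \<in> K"
    and "\<And>a a'. \<lbrakk>a \<in> carrier A; a' \<in> carrier A\<rbrakk> \<Longrightarrow> P (pt a \<one>\<^bsub>H\<^esub> \<otimes>\<^bsub>T\<^esub> \<rho> a')"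
    and "\<And>s t. \<lbrakk>s \<in> K; t \<in> K; P s; P t\<rbrakk> \<Longrightarrow> P (s \<oplus>\<^bsub>T\<^esub> t)"
  shows "P t"
proof -
  obtain s where s: "s \<in> carrier (tensor A A)" "t = lifted_canonical_map A H \<rho> s"
    using assms(1) by (auto simp: canonical_image_def)
  from s(1) have "P (lifted_canonical_map A H \<rho> s)"
    by (induction rule: AA.tensor_induct)
      (auto simp: can_pt can_linear(2) assms(2) intro!: assms(3) simp: canonical_image_def)
  then show ?thesis using s(2) by simp
qed

text \<open>The image is an \<open>A\<close>-bimodule, with \<open>A\<close> acting through \<open>c \<otimes> 1\<close> on the left and through \<open>\<rho>\<close> on the
  right: \<open>c\<close> is absorbed by the first argument of the canonical map and \<open>\<rho> a'\<close> by the second.\<close>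

lemma K_act:
  assumes "c \<in> carrier A" "t \<in> K"
  shows "pt c \<one>\<^bsub>H\<^esub> \<otimes>\<^bsub>T\<^esub> t \<in> K"
  using assms(2)
proof (induction rule: K_induct)
  case (generator a a')
  then have "pt c \<one>\<^bsub>H\<^esub> \<otimes>\<^bsub>T\<^esub> (pt a \<one>\<^bsub>H\<^esub> \<otimes>\<^bsub>T\<^esub> \<rho> a') = pt (c \<otimes>\<^bsub>A\<^esub> a) \<one>\<^bsub>H\<^esub> \<otimes>\<^bsub>T\<^esub> \<rho> a'"
    using assms(1) \<rho>(3) by (simp add: pt_mult flip: T.m_assoc)
  then show ?case using generator assms(1) by (simp add: K_generator)
next
  case (add s t)
  then show ?case using assms(1) K_subset
    by (subst T.r_distr) (auto intro: K_add)
qed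

lemma K_mult_coaction:
  assumes "t \<in> K" "a' \<in> carrier A"
  shows "t \<otimes>\<^bsub>T\<^esub> \<rho> a' \<in> K"
  using assms(1)
proof (induction rule: K_induct)
  case (generator a b)
  then have "(pt a \<one>\<^bsub>H\<^esub> \<otimes>\<^bsub>T\<^esub> \<rho> b) \<otimes>\<^bsub>T\<^esub> \<rho> a' = pt a \<one>\<^bsub>H\<^esub> \<otimes>\<^bsub>T\<^esub> \<rho> (b \<otimes>\<^bsub>A\<^esub> a')"
    using assms(2) \<rho>(3,6) by (simp add: T.m_assoc)
  then show ?case using generator assms(2) by (simp add: K_generator)
next
  case (add s t)
  then show ?case using assms(2) K_subset \<rho>(3)
    by (subst T.l_distr) (auto intro: K_add)
qed

definition coefficients :: "'h \<Rightarrow> 'a set" where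
  "coefficients h = {c \<in> carrier A. pt c h \<in> K}"

lemma left_ideal_coefficients:
  assumes "h \<in> carrier H"
  shows "left_ideal (coefficients h) A"
proof (intro left_ideal.intro left_ideal_axioms.intro A.star_algebra_axioms)
  fix c x assume "c \<in> carrier A" "x \<in> coefficients h"
  then show "c \<otimes>\<^bsub>A\<^esub> x \<in> coefficients h"
    using K_act[of c "pt x h"] assms by (auto simp: coefficients_def pt_mult)
qed (use assms in \<open>auto simp: coefficients_def pt_add_l K_add\<close>)

text \<open>Write \<open>1 \<otimes> h' = \<Sum> a\<^sub>i \<rho>(a\<^sub>i')\<close>. As \<open>1 \<otimes> h\<close> is central, \<open>1 \<otimes> h h' = \<Sum> a\<^sub>i (1 \<otimes> h) \<rho>(a\<^sub>i')\<close>, and each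
  summand stays in \<open>K\<close> because \<open>K\<close> is stable under \<open>A\<close> on the left and \<open>\<rho>(A)\<close> on the right.\<close>

lemma one_in_coefficients_mult:
  assumes comm: "\<And>x y. \<lbrakk>x \<in> carrier H; y \<in> carrier H\<rbrakk> \<Longrightarrow> x \<otimes>\<^bsub>H\<^esub> y = y \<otimes>\<^bsub>H\<^esub> x"
    and h: "h \<in> carrier H" "h' \<in> carrier H"
    and one: "\<one>\<^bsub>A\<^esub> \<in> coefficients h" "\<one>\<^bsub>A\<^esub> \<in> coefficients h'"
  shows "\<one>\<^bsub>A\<^esub> \<in> coefficients (h \<otimes>\<^bsub>H\<^esub> h')"
proof -
  let ?h = "pt \<one>\<^bsub>A\<^esub> h"
  have hK: "?h \<in> K" and hc: "?h \<in> carrier T" using one h by (auto simp: coefficients_def)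
  have central: "t \<otimes>\<^bsub>T\<^esub> ?h = ?h \<otimes>\<^bsub>T\<^esub> t" if "t \<in> carrier T" for t
    using that
    by (induction rule: tensor_induct) (auto simp: pt_mult h comm T.l_distr T.r_distr)
  have "?h \<otimes>\<^bsub>T\<^esub> t \<in> K" if "t \<in> K" for t
    using that
  proof (induction rule: K_induct)
    case (generator a a')
    then have "?h \<otimes>\<^bsub>T\<^esub> (pt a \<one>\<^bsub>H\<^esub> \<otimes>\<^bsub>T\<^esub> \<rho> a') = pt a \<one>\<^bsub>H\<^esub> \<otimes>\<^bsub>T\<^esub> (?h \<otimes>\<^bsub>T\<^esub> \<rho> a')"
      using hc \<rho>(3) central[of "pt a \<one>\<^bsub>H\<^esub>"] by (simp flip: T.m_assoc)
    then show ?case using generator by (simp add: K_act K_mult_coaction hK)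
  next
    case (add s t)
    then show ?case using hc K_subset by (subst T.r_distr) (auto intro: K_add)
  qed
  from this[of "pt \<one>\<^bsub>A\<^esub> h'"] show ?thesis
    using one h by (simp add: coefficients_def pt_mult)
qed

text \<open>The image is then the whole of \<open>A \<otimes> H\<close>, and the zero module has the empty set of generators.\<close>

lemma almost_free_if_one_in_coefficients:
  assumes gen: "\<And>h. h \<in> carrier H \<Longrightarrow> \<one>\<^bsub>A\<^esub> \<in> coefficients h"
  shows "almost_free A H \<rho>"
proof -
  have "t \<in> K" if "t \<in> carrier T" for t
    using that
  proof (induction rule: tensor_induct)
    case (pure x y)
    interpret left_ideal "coefficients y" A by (rule left_ideal_coefficients[OF pure(2)])
    show ?case using mult_closed[OF pure(1) gen[OF pure(2)]] pure by (simp add: coefficients_def)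
  qed (rule K_add)
  then have K: "K = carrier T" using K_subset by auto
  let ?C = "canonical_cokernel A H \<rho>"
  have C: "carrier ?C = a_rcosets\<^bsub>T\<^esub> carrier T" "\<zero>\<^bsub>?C\<^esub> = carrier T"
    using K by (simp_all add: canonical_cokernel_def canonical_image_def Let_def)
  interpret C: left_module A ?C
    by (rule left_module_canonical_cokernel[OF A.star_algebra_axioms B.star_algebra_axioms \<rho>(1)])
  have "m = \<zero>\<^bsub>?C\<^esub>" if "m \<in> carrier ?C" for m
  proof -
    obtain t where t: "t \<in> carrier T" "m = carrier T +>\<^bsub>T\<^esub> t"
      using \<open>m \<in> carrier ?C\<close> by (auto simp: C A_RCOSETS_def')
    show ?thesis
      unfolding C(2) t(2) using t(1) T.add.coset_join2[OF t(1) T.add.subgroup_self]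
      by (simp add: a_r_coset_def)
  qed
  then show ?thesis
    unfolding almost_free_def finitely_generated_left_module_def
    by (intro conjI C.left_module_axioms exI[of _ "{}"]) auto
qed

end

section \<open>Coactions of the Laurent polynomials\<close>

locale laurent_coaction_map = coaction_map A laurent \<rho>
  for A :: "'a star_algebra" and \<rho>
begin

definition homogeneous :: "int \<Rightarrow> 'a \<Rightarrow> bool" where
  "homogeneous n a \<longleftrightarrow> a \<in> carrier A \<and> \<rho> a = pt a (laurent_u n)"

lemma laurent_u_closed [simp]: "laurent_u n \<in> carrier laurent"
  by (simp add: laurent_sel)

lemma homogeneous_mult:
  "\<lbrakk>homogeneous m a; homogeneous n b\<rbrakk> \<Longrightarrow> homogeneous (m + n) (a \<otimes>\<^bsub>A\<^esub> b)"
  by (simp add: homogeneous_def \<rho> pt_mult laurent_sel)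

lemma homogeneous_star: "homogeneous n a \<Longrightarrow> homogeneous (- n) (a\<^sup>\<star>\<^bsub>A\<^esub>)"
  by (simp add: homogeneous_def \<rho> pt_star laurent_sel)

lemma homogeneous_power: "homogeneous n a \<Longrightarrow> homogeneous (int k * n) (a [^]\<^bsub>A\<^esub> k)"
proof (induction k)
  case 0
  show ?case by (simp add: homogeneous_def \<rho> pt_one laurent_sel)
next
  case (Suc k)
  then show ?case using homogeneous_mult[of "int k * n" _ n a] by (simp add: algebra_simps)
qed

lemma mult_homogeneous_in_coefficients:
  "\<lbrakk>a \<in> carrier A; homogeneous n a'\<rbrakk> \<Longrightarrow> a \<otimes>\<^bsub>A\<^esub> a' \<in> coefficients (laurent_u n)"
  using K_generator[of a a'] by (auto simp: homogeneous_def coefficients_def pt_mult)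

lemma almost_free_if_one_in_coefficients_u:
  assumes "\<one>\<^bsub>A\<^esub> \<in> coefficients (laurent_u 1)" "\<one>\<^bsub>A\<^esub> \<in> coefficients (laurent_u (- 1))"
  shows "almost_free A laurent \<rho>"
proof (rule almost_free_if_one_in_coefficients)
  have add: "\<one>\<^bsub>A\<^esub> \<in> coefficients (laurent_u (m + n))"
    if "\<one>\<^bsub>A\<^esub> \<in> coefficients (laurent_u m)" "\<one>\<^bsub>A\<^esub> \<in> coefficients (laurent_u n)" for m n
    using one_in_coefficients_mult[OF laurent_comm _ _ that] by (simp add: laurent_sel)
  have zero: "\<one>\<^bsub>A\<^esub> \<in> coefficients (laurent_u 0)"
    using add[OF assms] by simp
  have u: "\<one>\<^bsub>A\<^esub> \<in> coefficients (laurent_u n)" for n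
  proof (induction n rule: int_induct[where k = 0])
    case (step2 i)
    then show ?case using add[OF _ assms(2), of i] by simp
  qed (auto intro: zero add assms(1))
  show "\<one>\<^bsub>A\<^esub> \<in> coefficients h" for h
  proof (induction h rule: laurent_induct)
    case (add x y)
    then show ?case using K_add by (simp add: coefficients_def pt_add_r laurent_sel(1))
  next
    case (smult c x)
    interpret left_ideal "coefficients x" A
      by (rule left_ideal_coefficients) (simp add: laurent_sel(1))
    show ?case using smult_in[OF smult, of c]
      by (simp add: coefficients_def pt_smult_l pt_smult_r laurent_sel(1))
  qed (rule u)
qed

end

section \<open>The algebra \<open>\<O>(\<Sigma>\<^sub>q\<^sup>3)\<close> and its coaction\<close>

text \<open>Here \<open>x = \<zeta>\<^sub>1\<^sup>2 \<xi>\<close>, and \<open>\<zeta>\<^sub>1\<close> is normal because \<open>\<xi>\<close> is central. The third and the fourth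
  defining relation express \<open>\<zeta>\<^sub>0\<^sup>* \<zeta>\<^sub>0\<close> and \<open>\<zeta>\<^sub>0 \<zeta>\<^sub>0\<^sup>*\<close> by \<open>x\<close>, and applying the first two in turn gives
  \<open>\<zeta>\<^sub>0 x = q\<^sup>2 x \<zeta>\<^sub>0\<close>, whose adjoint is the last claim because \<open>x\<close> is self-adjoint.\<close>

lemma
  fixes q :: real
  defines "\<Sigma> \<equiv> sigma_algebra q"
    and "z0 \<equiv> sigma_generator q Zeta0" and "z1 \<equiv> sigma_generator q Zeta1"
  defines "x \<equiv> z1 \<otimes>\<^bsub>\<Sigma>\<^esub> z1\<^sup>\<star>\<^bsub>\<Sigma>\<^esub>"
  assumes q: "q \<noteq> 0"
  shows zeta1_normal: "z1\<^sup>\<star>\<^bsub>\<Sigma>\<^esub> \<otimes>\<^bsub>\<Sigma>\<^esub> z1 = x"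
    and zeta0_star_zeta0: "z0\<^sup>\<star>\<^bsub>\<Sigma>\<^esub> \<otimes>\<^bsub>\<Sigma>\<^esub> z0 = \<one>\<^bsub>\<Sigma>\<^esub> \<oplus>\<^bsub>\<Sigma>\<^esub> (- complex_of_real (1 / q\<^sup>2)) \<odot>\<^bsub>\<Sigma>\<^esub> x"
    and zeta0_zeta0_star: "z0 \<otimes>\<^bsub>\<Sigma>\<^esub> z0\<^sup>\<star>\<^bsub>\<Sigma>\<^esub> = \<one>\<^bsub>\<Sigma>\<^esub> \<oplus>\<^bsub>\<Sigma>\<^esub> (- 1) \<odot>\<^bsub>\<Sigma>\<^esub> x"
    and modulus_zeta0: "x \<otimes>\<^bsub>\<Sigma>\<^esub> z0 = complex_of_real (1 / q\<^sup>2) \<odot>\<^bsub>\<Sigma>\<^esub> (z0 \<otimes>\<^bsub>\<Sigma>\<^esub> x)"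
    and modulus_zeta0_star: "x \<otimes>\<^bsub>\<Sigma>\<^esub> z0\<^sup>\<star>\<^bsub>\<Sigma>\<^esub> = complex_of_real (q\<^sup>2) \<odot>\<^bsub>\<Sigma>\<^esub> (z0\<^sup>\<star>\<^bsub>\<Sigma>\<^esub> \<otimes>\<^bsub>\<Sigma>\<^esub> x)"
proof -
  interpret S: star_algebra \<Sigma> unfolding \<Sigma>_def by (rule star_algebra_sigma)
  define xi where "xi = sigma_generator q Xi"
  have cl [simp]: "z0 \<in> carrier \<Sigma>" "z1 \<in> carrier \<Sigma>" "xi \<in> carrier \<Sigma>" "x \<in> carrier \<Sigma>"
    by (auto simp: \<Sigma>_def z0_def z1_def xi_def x_def sigma_generator_closed
        intro!: star_algebra.star_closed[OF star_algebra_sigma] S.m_closed[unfolded \<Sigma>_def])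
  note rels = sigma_relations_hold[where q = q, folded \<Sigma>_def z0_def z1_def xi_def]
  have x: "z1 \<otimes>\<^bsub>\<Sigma>\<^esub> z1 \<otimes>\<^bsub>\<Sigma>\<^esub> xi = x"
    by (simp add: x_def rels(5) S.m_assoc)
  show "z1\<^sup>\<star>\<^bsub>\<Sigma>\<^esub> \<otimes>\<^bsub>\<Sigma>\<^esub> z1 = x"
    using rels(8)[where x = z1] by (simp add: x_def rels(5) S.m_assoc)
  have sx: "x\<^sup>\<star>\<^bsub>\<Sigma>\<^esub> = x" by (simp add: x_def S.star_mult)
  have neg: "x \<oplus>\<^bsub>\<Sigma>\<^esub> (- 1) \<odot>\<^bsub>\<Sigma>\<^esub> x = \<zero>\<^bsub>\<Sigma>\<^esub>"
    by (simp add: S.r_neg flip: S.uminus_conv)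
  have "z0 \<otimes>\<^bsub>\<Sigma>\<^esub> z0\<^sup>\<star>\<^bsub>\<Sigma>\<^esub> = (z0 \<otimes>\<^bsub>\<Sigma>\<^esub> z0\<^sup>\<star>\<^bsub>\<Sigma>\<^esub> \<oplus>\<^bsub>\<Sigma>\<^esub> x) \<oplus>\<^bsub>\<Sigma>\<^esub> (- 1) \<odot>\<^bsub>\<Sigma>\<^esub> x"
    by (simp add: S.a_assoc neg)
  then show A: "z0 \<otimes>\<^bsub>\<Sigma>\<^esub> z0\<^sup>\<star>\<^bsub>\<Sigma>\<^esub> = \<one>\<^bsub>\<Sigma>\<^esub> \<oplus>\<^bsub>\<Sigma>\<^esub> (- 1) \<odot>\<^bsub>\<Sigma>\<^esub> x"
    using rels(4) by (simp add: x)
  let ?c = "complex_of_real (1 / q\<^sup>2 - 1)"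
  have "z0\<^sup>\<star>\<^bsub>\<Sigma>\<^esub> \<otimes>\<^bsub>\<Sigma>\<^esub> z0 = z0\<^sup>\<star>\<^bsub>\<Sigma>\<^esub> \<otimes>\<^bsub>\<Sigma>\<^esub> z0 \<oplus>\<^bsub>\<Sigma>\<^esub> (?c + - ?c) \<odot>\<^bsub>\<Sigma>\<^esub> x"
    by simp
  also have "\<dots> = (z0\<^sup>\<star>\<^bsub>\<Sigma>\<^esub> \<otimes>\<^bsub>\<Sigma>\<^esub> z0 \<oplus>\<^bsub>\<Sigma>\<^esub> ?c \<odot>\<^bsub>\<Sigma>\<^esub> x) \<oplus>\<^bsub>\<Sigma>\<^esub> (- ?c) \<odot>\<^bsub>\<Sigma>\<^esub> x"
    unfolding S.smult_add_l[OF cl(4)] by (simp add: S.a_assoc)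
  also have "\<dots> = (\<one>\<^bsub>\<Sigma>\<^esub> \<oplus>\<^bsub>\<Sigma>\<^esub> (- 1) \<odot>\<^bsub>\<Sigma>\<^esub> x) \<oplus>\<^bsub>\<Sigma>\<^esub> (- ?c) \<odot>\<^bsub>\<Sigma>\<^esub> x"
    using rels(3) A by (simp add: x)
  also have "\<dots> = \<one>\<^bsub>\<Sigma>\<^esub> \<oplus>\<^bsub>\<Sigma>\<^esub> (- 1 + - ?c) \<odot>\<^bsub>\<Sigma>\<^esub> x"
    unfolding S.smult_add_l[OF cl(4)] by (simp add: S.a_assoc)
  also have "- 1 + - ?c = - complex_of_real (1 / q\<^sup>2)" by simp
  finally show "z0\<^sup>\<star>\<^bsub>\<Sigma>\<^esub> \<otimes>\<^bsub>\<Sigma>\<^esub> z0 = \<one>\<^bsub>\<Sigma>\<^esub> \<oplus>\<^bsub>\<Sigma>\<^esub> (- complex_of_real (1 / q\<^sup>2)) \<odot>\<^bsub>\<Sigma>\<^esub> x" .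
  have "z0 \<otimes>\<^bsub>\<Sigma>\<^esub> x = (z0 \<otimes>\<^bsub>\<Sigma>\<^esub> z1) \<otimes>\<^bsub>\<Sigma>\<^esub> z1\<^sup>\<star>\<^bsub>\<Sigma>\<^esub>" by (simp add: x_def S.m_assoc)
  also have "\<dots> = complex_of_real q \<odot>\<^bsub>\<Sigma>\<^esub> (z1 \<otimes>\<^bsub>\<Sigma>\<^esub> (z0 \<otimes>\<^bsub>\<Sigma>\<^esub> z1\<^sup>\<star>\<^bsub>\<Sigma>\<^esub>))"
    unfolding rels(1) by (simp add: S.smult_mult_left S.m_assoc)
  also have "\<dots> = complex_of_real (q\<^sup>2) \<odot>\<^bsub>\<Sigma>\<^esub> (x \<otimes>\<^bsub>\<Sigma>\<^esub> z0)"
    unfolding rels(2) by (simp add: x_def S.smult_mult_right S.smult_smult S.m_assoc power2_eq_square)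
  finally have zx: "z0 \<otimes>\<^bsub>\<Sigma>\<^esub> x = complex_of_real (q\<^sup>2) \<odot>\<^bsub>\<Sigma>\<^esub> (x \<otimes>\<^bsub>\<Sigma>\<^esub> z0)" .
  show "x \<otimes>\<^bsub>\<Sigma>\<^esub> z0 = complex_of_real (1 / q\<^sup>2) \<odot>\<^bsub>\<Sigma>\<^esub> (z0 \<otimes>\<^bsub>\<Sigma>\<^esub> x)"
    unfolding zx using q by (simp add: S.smult_smult)
  have "(z0 \<otimes>\<^bsub>\<Sigma>\<^esub> x)\<^sup>\<star>\<^bsub>\<Sigma>\<^esub> = (complex_of_real (q\<^sup>2) \<odot>\<^bsub>\<Sigma>\<^esub> (x \<otimes>\<^bsub>\<Sigma>\<^esub> z0))\<^sup>\<star>\<^bsub>\<Sigma>\<^esub>"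
    by (simp only: zx)
  then show "x \<otimes>\<^bsub>\<Sigma>\<^esub> z0\<^sup>\<star>\<^bsub>\<Sigma>\<^esub> = complex_of_real (q\<^sup>2) \<odot>\<^bsub>\<Sigma>\<^esub> (z0\<^sup>\<star>\<^bsub>\<Sigma>\<^esub> \<otimes>\<^bsub>\<Sigma>\<^esub> x)"
    by (simp add: S.star_mult S.star_smult sx)
qed

theorem proposition4p6:
  fixes q :: real and l :: nat
  assumes "0 < q" and "q < 1" and "0 < l"
  shows "almost_free (sigma_algebra q) laurent (sigma_coaction q l)"
proof -
  define \<Sigma> where "\<Sigma> = sigma_algebra q"
  define z0 where "z0 = sigma_generator q Zeta0"
  define z1 where "z1 = sigma_generator q Zeta1"
  define x where "x = z1 \<otimes>\<^bsub>\<Sigma>\<^esub> z1\<^sup>\<star>\<^bsub>\<Sigma>\<^esub>"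
  define m where "m = l - 1"
  interpret S: star_algebra \<Sigma> unfolding \<Sigma>_def by (rule star_algebra_sigma)
  interpret R: laurent_coaction_map \<Sigma> "sigma_coaction q l"
    by (intro laurent_coaction_map.intro coaction_map.intro star_algebra_pair.intro
        coaction_map_axioms.intro S.star_algebra_axioms laurent.star_algebra_axioms)
      (simp add: \<Sigma>_def sigma_coaction_star_hom)
  have cl [simp]: "z0 \<in> carrier \<Sigma>" "z1 \<in> carrier \<Sigma>"
    by (auto simp: \<Sigma>_def z0_def z1_def sigma_generator_closed)
  have xcl [simp]: "x \<in> carrier \<Sigma>" by (simp add: x_def)
  have hom: "R.homogeneous 1 z0" "R.homogeneous (int l) z1"
    using sigma_coaction_gen[of q l Zeta0] sigma_coaction_gen[of q l Zeta1]
    by (simp_all add: R.homogeneous_def) (simp_all add: \<Sigma>_def z0_def z1_def)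
  note hs = hom[THEN R.homogeneous_star]
  have q: "q \<noteq> 0" using assms(1) by simp
  note rel = zeta1_normal[OF q] zeta0_star_zeta0[OF q] zeta0_zeta0_star[OF q]
    modulus_zeta0[OF q] modulus_zeta0_star[OF q]
  note rel = rel[folded \<Sigma>_def z0_def z1_def, folded x_def]
  have "(q\<^sup>2) ^ Suc k \<noteq> 1" for k
    using power_Suc_less_one[of "q\<^sup>2" k] power_Suc_less_one[of q 1] assms
    by (simp add: numeral_2_eq_2)
  then have "complex_of_real ((q\<^sup>2) ^ Suc k) \<noteq> 1" "complex_of_real (1 / (q\<^sup>2) ^ Suc k) \<noteq> 1" for k
    using q by (simp_all only: of_real_eq_1_iff divide_eq_1_iff simp_thms) auto
  then have q2: "complex_of_real (q\<^sup>2) ^ Suc k \<noteq> 1" "complex_of_real (1 / q\<^sup>2) ^ Suc k \<noteq> 1" for k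
    by (simp_all only: of_real_power[symmetric] power_one_over not_False_eq_True)
  \<comment> \<open>Degree \<open>1\<close>: \<open>s = 1\<close> and \<open>t = r = q\<^sup>2\<close>, the root of \<open>1 - q\<^sup>-\<^sup>2 x\<close>. The exponent \<open>m = l - 1\<close> gives
    \<open>\<zeta>\<^sub>1 \<zeta>\<^sub>0\<^sup>*\<^sup>m\<close> the degree \<open>l - m = 1\<close>.\<close>
  have pos: "\<one>\<^bsub>\<Sigma>\<^esub> \<in> R.coefficients (laurent_u 1)"
  proof -
    interpret left_ideal "R.coefficients (laurent_u 1)" \<Sigma>
      by (rule R.left_ideal_coefficients) simp
    have "(- complex_of_real (q\<^sup>2)) \<odot>\<^bsub>\<Sigma>\<^esub> (z0\<^sup>\<star>\<^bsub>\<Sigma>\<^esub> \<otimes>\<^bsub>\<Sigma>\<^esub> z0) \<in> R.coefficients (laurent_u 1)"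
      by (intro smult_in R.mult_homogeneous_in_coefficients hom) simp
    also have "(- complex_of_real (q\<^sup>2)) \<odot>\<^bsub>\<Sigma>\<^esub> (z0\<^sup>\<star>\<^bsub>\<Sigma>\<^esub> \<otimes>\<^bsub>\<Sigma>\<^esub> z0) = x \<oplus>\<^bsub>\<Sigma>\<^esub> (- complex_of_real (q\<^sup>2)) \<odot>\<^bsub>\<Sigma>\<^esub> \<one>\<^bsub>\<Sigma>\<^esub>"
      unfolding rel(2) using q by (simp add: S.smult_add_r S.smult_smult S.a_comm)
    finally have xr: "x \<oplus>\<^bsub>\<Sigma>\<^esub> (- complex_of_real (q\<^sup>2)) \<odot>\<^bsub>\<Sigma>\<^esub> \<one>\<^bsub>\<Sigma>\<^esub> \<in> R.coefficients (laurent_u 1)" .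
    have "R.homogeneous 1 (z1 \<otimes>\<^bsub>\<Sigma>\<^esub> (z0\<^sup>\<star>\<^bsub>\<Sigma>\<^esub>) [^]\<^bsub>\<Sigma>\<^esub> m)"
      using R.homogeneous_mult[OF hom(2) R.homogeneous_power[OF hs(1), of m]] assms(3)
      by (simp add: m_def of_nat_diff)
    from R.mult_homogeneous_in_coefficients[OF _ this, of "z0 [^]\<^bsub>\<Sigma>\<^esub> m \<otimes>\<^bsub>\<Sigma>\<^esub> z1\<^sup>\<star>\<^bsub>\<Sigma>\<^esub>"]
    have "z0 [^]\<^bsub>\<Sigma>\<^esub> m \<otimes>\<^bsub>\<Sigma>\<^esub> (z1\<^sup>\<star>\<^bsub>\<Sigma>\<^esub> \<otimes>\<^bsub>\<Sigma>\<^esub> z1) \<otimes>\<^bsub>\<Sigma>\<^esub> (z0\<^sup>\<star>\<^bsub>\<Sigma>\<^esub>) [^]\<^bsub>\<Sigma>\<^esub> m \<in> R.coefficients (laurent_u 1)"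
      by (simp add: S.m_assoc)
    then show ?thesis
      unfolding rel(1)
      using q by (intro one_mem_if_sandwich_mem[OF _ _ _ rel(3) rel(5) xr _ _ q2(1)]) auto
  qed
  \<comment> \<open>Degree \<open>-1\<close>: the roles of \<open>\<zeta>\<^sub>0\<close> and its adjoint are exchanged, so that \<open>s = t = q\<^sup>-\<^sup>2\<close>, and \<open>r = 1\<close>
    is the root of \<open>1 - x\<close>.\<close>
  have neg: "\<one>\<^bsub>\<Sigma>\<^esub> \<in> R.coefficients (laurent_u (- 1))"
  proof -
    interpret left_ideal "R.coefficients (laurent_u (- 1))" \<Sigma>
      by (rule R.left_ideal_coefficients) simp
    have "(- 1) \<odot>\<^bsub>\<Sigma>\<^esub> (z0 \<otimes>\<^bsub>\<Sigma>\<^esub> z0\<^sup>\<star>\<^bsub>\<Sigma>\<^esub>) \<in> R.coefficients (laurent_u (- 1))"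
      by (intro smult_in R.mult_homogeneous_in_coefficients hs) simp
    also have "(- 1) \<odot>\<^bsub>\<Sigma>\<^esub> (z0 \<otimes>\<^bsub>\<Sigma>\<^esub> z0\<^sup>\<star>\<^bsub>\<Sigma>\<^esub>) = x \<oplus>\<^bsub>\<Sigma>\<^esub> (- 1) \<odot>\<^bsub>\<Sigma>\<^esub> \<one>\<^bsub>\<Sigma>\<^esub>"
      unfolding rel(3) by (simp add: S.smult_add_r S.smult_smult S.a_comm)
    finally have xr: "x \<oplus>\<^bsub>\<Sigma>\<^esub> (- 1) \<odot>\<^bsub>\<Sigma>\<^esub> \<one>\<^bsub>\<Sigma>\<^esub> \<in> R.coefficients (laurent_u (- 1))" .
    have "R.homogeneous (- 1) (z1\<^sup>\<star>\<^bsub>\<Sigma>\<^esub> \<otimes>\<^bsub>\<Sigma>\<^esub> z0 [^]\<^bsub>\<Sigma>\<^esub> m)"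
      using R.homogeneous_mult[OF hs(2) R.homogeneous_power[OF hom(1), of m]] assms(3)
      by (simp add: m_def of_nat_diff)
    from R.mult_homogeneous_in_coefficients[OF _ this, of "(z0\<^sup>\<star>\<^bsub>\<Sigma>\<^esub>) [^]\<^bsub>\<Sigma>\<^esub> m \<otimes>\<^bsub>\<Sigma>\<^esub> z1"]
    have "(z0\<^sup>\<star>\<^bsub>\<Sigma>\<^esub>) [^]\<^bsub>\<Sigma>\<^esub> m \<otimes>\<^bsub>\<Sigma>\<^esub> x \<otimes>\<^bsub>\<Sigma>\<^esub> z0 [^]\<^bsub>\<Sigma>\<^esub> m \<in> R.coefficients (laurent_u (- 1))"
      by (simp add: x_def S.m_assoc)
    then show ?thesis
      using q by (intro one_mem_if_sandwich_mem[OF _ _ _ rel(2) rel(4) xr _ _ q2(2)]) auto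
  qed
  show ?thesis
    using R.almost_free_if_one_in_coefficients_u[OF pos neg] by (simp add: \<Sigma>_def)
qed

end
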